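(* Every split quasi-hereditary algebra over a local commutative Noetherian ring is semi-perfect.
   Context: A ring $A$ is semi-perfect if every finitely generated left $A$-module has a projective cover. **Split quasi-hereditary algebras.** Let $R$ be a commutative Noetherian ring and $A$ an $R$-algebra which is finitely generated and projective as an $R$-module. A two-sided ideal $J$ of $A$ is a split heredity ideal if: (i) $A/J$ is projective over $R$; (ii) $J$ is projective as a left $A$-module; (iii) $J^2=J$; (iv) the $R$-algebra $\operatorname{End}_A({}_AJ)^{op}$ is Morita equivalent to $R$. The algebra $A$ is split quasi-hereditary (over $R$) if there is a finite chain of ideals $0=J_{t+1}\subset J_t\subset\cdots\subset J_1=A$ such that $J_i/J_{i+1}$ is a split heredity ideal of $A/J_{i+1}$ for $1\leq i\leq t$. *)

theory Defs
  imports "HOL-Algebra.Algebra"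
begin

section \<open>Left modules over a not necessarily commutative ring\<close>

text \<open>
  The library locale \<^locale>\<open>module\<close> assumes a commutative base ring.  We keep its record type
  and drop commutativity; the fields \<^const>\<open>monoid.mult\<close> and \<^const>\<open>one\<close> of the module record are
  irrelevant.
\<close>

locale left_module = A?: ring A + M?: abelian_group M
    for A :: "('a, 'b) ring_scheme" (structure) and M :: "('a, 'm) module" (structure) +
  assumes lsmult_closed [simp, intro]:
      "\<lbrakk>a \<in> carrier A; x \<in> carrier M\<rbrakk> \<Longrightarrow> a \<odot>\<^bsub>M\<^esub> x \<in> carrier M"
    and lsmult_l_distr:
      "\<lbrakk>a \<in> carrier A; b \<in> carrier A; x \<in> carrier M\<rbrakk> \<Longrightarrow>
        (a \<oplus> b) \<odot>\<^bsub>M\<^esub> x = a \<odot>\<^bsub>M\<^esub> x \<oplus>\<^bsub>M\<^esub> b \<odot>\<^bsub>M\<^esub> x"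
    and lsmult_r_distr:
      "\<lbrakk>a \<in> carrier A; x \<in> carrier M; y \<in> carrier M\<rbrakk> \<Longrightarrow>
        a \<odot>\<^bsub>M\<^esub> (x \<oplus>\<^bsub>M\<^esub> y) = a \<odot>\<^bsub>M\<^esub> x \<oplus>\<^bsub>M\<^esub> a \<odot>\<^bsub>M\<^esub> y"
    and lsmult_assoc:
      "\<lbrakk>a \<in> carrier A; b \<in> carrier A; x \<in> carrier M\<rbrakk> \<Longrightarrow>
        (a \<otimes> b) \<odot>\<^bsub>M\<^esub> x = a \<odot>\<^bsub>M\<^esub> (b \<odot>\<^bsub>M\<^esub> x)"
    and lsmult_one [simp]: "x \<in> carrier M \<Longrightarrow> \<one> \<odot>\<^bsub>M\<^esub> x = x"

definition regular_module :: "('a, 'b) ring_scheme \<Rightarrow> ('a, 'a) module" where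
  "regular_module A =
    \<lparr>carrier = carrier A, monoid.mult = (\<otimes>\<^bsub>A\<^esub>), one = \<one>\<^bsub>A\<^esub>,
     ring.zero = \<zero>\<^bsub>A\<^esub>, ring.add = (\<oplus>\<^bsub>A\<^esub>), smult = (\<otimes>\<^bsub>A\<^esub>)\<rparr>"

text \<open>
  Homomorphisms are extensional functions, so that equality of homomorphisms is equality of
  functions and composition is \<^const>\<open>compose\<close>.
\<close>

definition mod_hom :: "('a, 'b) ring_scheme \<Rightarrow> ('a, 'm) module \<Rightarrow> ('a, 'n) module \<Rightarrow> ('m \<Rightarrow> 'n) set"
  where
  "mod_hom A M N = {f \<in> carrier M \<rightarrow>\<^sub>E carrier N.
      (\<forall>x\<in>carrier M. \<forall>y\<in>carrier M. f (x \<oplus>\<^bsub>M\<^esub> y) = f x \<oplus>\<^bsub>N\<^esub> f y) \<and>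
      (\<forall>a\<in>carrier A. \<forall>x\<in>carrier M. f (a \<odot>\<^bsub>M\<^esub> x) = a \<odot>\<^bsub>N\<^esub> f x)}"

definition mod_id :: "('a, 'm) module \<Rightarrow> 'm \<Rightarrow> 'm" where
  "mod_id M = restrict (\<lambda>x. x) (carrier M)"

definition mod_ker :: "('a, 'm) module \<Rightarrow> ('a, 'n) module \<Rightarrow> ('m \<Rightarrow> 'n) \<Rightarrow> 'm set" where
  "mod_ker M N f = {x \<in> carrier M. f x = \<zero>\<^bsub>N\<^esub>}"

definition fin_gen_module :: "('a, 'b) ring_scheme \<Rightarrow> ('a, 'm) module \<Rightarrow> bool" where
  "fin_gen_module A M \<longleftrightarrow>
    (\<exists>S\<subseteq>carrier M. finite S \<and> (\<forall>N. submodule N A M \<and> S \<subseteq> N \<longrightarrow> N = carrier M))"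

text \<open>
  Projectivity is the lifting property along surjections \<open>g : N \<rightarrow> M\<close>.  A definition
  can only quantify over modules with elements of fixed types; the types below are large
  enough for the free module on the carrier of \<open>P\<close> and for \<open>P\<close> itself.  Lemma
  \<open>projective_module_lift\<close> shows that the lifting property then holds for modules with
  elements of arbitrary types.
\<close>

definition projective_module :: "('a, 'b) ring_scheme \<Rightarrow> ('a, 'p) module \<Rightarrow> bool" where
  "projective_module A P \<longleftrightarrow> left_module A P \<and>
    (\<forall>(N :: ('a, 'p \<Rightarrow> 'a) module) (M :: ('a, 'p) module).
      \<forall>g\<in>mod_hom A N M. \<forall>h\<in>mod_hom A P M.
        left_module A N \<and> left_module A M \<and> g ` carrier N = carrier M \<longrightarrow>
        (\<exists>k\<in>mod_hom A P N. compose (carrier P) g k = h))"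

definition free_module :: "('a, 'b) ring_scheme \<Rightarrow> 'i set \<Rightarrow> ('a, 'i \<Rightarrow> 'a) module" where
  "free_module A I =
    \<lparr>carrier = {c. finite {i. c i \<noteq> \<zero>\<^bsub>A\<^esub>} \<and> (\<forall>i\<in>I. c i \<in> carrier A) \<and> (\<forall>i. i \<notin> I \<longrightarrow> c i = \<zero>\<^bsub>A\<^esub>)},
     monoid.mult = undefined, one = undefined, ring.zero = (\<lambda>i. \<zero>\<^bsub>A\<^esub>),
     ring.add = (\<lambda>c d i. c i \<oplus>\<^bsub>A\<^esub> d i), smult = (\<lambda>a c i. a \<otimes>\<^bsub>A\<^esub> c i)\<rparr>"

definition lin_comb ::
  "('a, 'b) ring_scheme \<Rightarrow> ('a, 'm) module \<Rightarrow> ('i \<Rightarrow> 'm) \<Rightarrow> ('i \<Rightarrow> 'a) \<Rightarrow> 'm" where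
  "lin_comb A M u c = (\<Oplus>\<^bsub>M\<^esub>i\<in>{i. c i \<noteq> \<zero>\<^bsub>A\<^esub>}. c i \<odot>\<^bsub>M\<^esub> u i)"

lemma mod_homD:
  assumes "f \<in> mod_hom A M N"
  shows "\<And>x. x \<in> carrier M \<Longrightarrow> f x \<in> carrier N"
    and "\<And>x y. \<lbrakk>x \<in> carrier M; y \<in> carrier M\<rbrakk> \<Longrightarrow> f (x \<oplus>\<^bsub>M\<^esub> y) = f x \<oplus>\<^bsub>N\<^esub> f y"
    and "\<And>a x. \<lbrakk>a \<in> carrier A; x \<in> carrier M\<rbrakk> \<Longrightarrow> f (a \<odot>\<^bsub>M\<^esub> x) = a \<odot>\<^bsub>N\<^esub> f x"
    and "f \<in> extensional (carrier M)"
  using assms unfolding mod_hom_def by (auto simp: PiE_iff)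

lemma mod_homI:
  assumes "\<And>x. x \<in> carrier M \<Longrightarrow> f x \<in> carrier N"
    and "\<And>x y. \<lbrakk>x \<in> carrier M; y \<in> carrier M\<rbrakk> \<Longrightarrow> f (x \<oplus>\<^bsub>M\<^esub> y) = f x \<oplus>\<^bsub>N\<^esub> f y"
    and "\<And>a x. \<lbrakk>a \<in> carrier A; x \<in> carrier M\<rbrakk> \<Longrightarrow> f (a \<odot>\<^bsub>M\<^esub> x) = a \<odot>\<^bsub>N\<^esub> f x"
    and "f \<in> extensional (carrier M)"
  shows "f \<in> mod_hom A M N"
  using assms unfolding mod_hom_def by (auto simp: PiE_iff)

lemma mod_hom_compose:
  assumes "left_module A L" "f \<in> mod_hom A L M" "g \<in> mod_hom A M N"
  shows "compose (carrier L) g f \<in> mod_hom A L N"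
proof -
  interpret L: left_module A L by fact
  show ?thesis
    by (rule mod_homI)
      (use mod_homD[OF assms(2)] mod_homD[OF assms(3)] in \<open>auto simp: compose_def\<close>)
qed

lemma mod_hom_zero:
  assumes "left_module A M" "left_module A N" "f \<in> mod_hom A M N"
  shows "f \<zero>\<^bsub>M\<^esub> = \<zero>\<^bsub>N\<^esub>"
proof -
  interpret M: left_module A M by fact
  interpret N: left_module A N by fact
  have "f \<zero>\<^bsub>M\<^esub> \<oplus>\<^bsub>N\<^esub> f \<zero>\<^bsub>M\<^esub> = f \<zero>\<^bsub>M\<^esub>"
    using mod_homD(2)[OF assms(3), of "\<zero>\<^bsub>M\<^esub>" "\<zero>\<^bsub>M\<^esub>"] by simp
  then show ?thesis
    using mod_homD(1)[OF assms(3), of "\<zero>\<^bsub>M\<^esub>"] N.M.add.l_cancel_one'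
    by (metis M.M.zero_closed)
qed

lemma mod_hom_finsum:
  assumes "left_module A M" "left_module A N" "f \<in> mod_hom A M N"
    and "finite S" "\<And>i. i \<in> S \<Longrightarrow> v i \<in> carrier M"
  shows "f (\<Oplus>\<^bsub>M\<^esub>i\<in>S. v i) = (\<Oplus>\<^bsub>N\<^esub>i\<in>S. f (v i))"
proof -
  interpret M: left_module A M by fact
  interpret N: left_module A N by fact
  show ?thesis
    using assms(4,5)
  proof (induction S)
    case empty
    show ?case using mod_hom_zero[OF assms(1-3)] by simp
  next
    case (insert i S)
    have v: "v \<in> S \<rightarrow> carrier M" "(\<lambda>i. f (v i)) \<in> S \<rightarrow> carrier N"
      using insert.prems mod_homD(1)[OF assms(3)] by auto
    then show ?case
      using insert mod_homD[OF assms(3)] by (simp add: M.M.finsum_insert N.M.finsum_insert)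
  qed
qed

context left_module
begin

lemma lsmult_zero_l [simp]:
  assumes "x \<in> carrier M" shows "\<zero>\<^bsub>A\<^esub> \<odot>\<^bsub>M\<^esub> x = \<zero>\<^bsub>M\<^esub>"
proof -
  have "\<zero>\<^bsub>A\<^esub> \<odot>\<^bsub>M\<^esub> x \<oplus>\<^bsub>M\<^esub> \<zero>\<^bsub>A\<^esub> \<odot>\<^bsub>M\<^esub> x = \<zero>\<^bsub>A\<^esub> \<odot>\<^bsub>M\<^esub> x"
    using lsmult_l_distr[of "\<zero>\<^bsub>A\<^esub>" "\<zero>\<^bsub>A\<^esub>" x] assms by simp
  then show ?thesis using assms M.add.l_cancel_one' by (metis A.zero_closed lsmult_closed)
qed

lemma lsmult_zero_r [simp]:
  assumes "a \<in> carrier A" shows "a \<odot>\<^bsub>M\<^esub> \<zero>\<^bsub>M\<^esub> = \<zero>\<^bsub>M\<^esub>"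
proof -
  have "a \<odot>\<^bsub>M\<^esub> \<zero>\<^bsub>M\<^esub> \<oplus>\<^bsub>M\<^esub> a \<odot>\<^bsub>M\<^esub> \<zero>\<^bsub>M\<^esub> = a \<odot>\<^bsub>M\<^esub> \<zero>\<^bsub>M\<^esub>"
    using lsmult_r_distr[of a "\<zero>\<^bsub>M\<^esub>" "\<zero>\<^bsub>M\<^esub>"] assms by simp
  then show ?thesis using assms M.add.l_cancel_one' by (metis M.zero_closed lsmult_closed)
qed

lemma lsmult_finsum:
  assumes "finite S" "a \<in> carrier A" "\<And>i. i \<in> S \<Longrightarrow> v i \<in> carrier M"
  shows "a \<odot>\<^bsub>M\<^esub> (\<Oplus>\<^bsub>M\<^esub>i\<in>S. v i) = (\<Oplus>\<^bsub>M\<^esub>i\<in>S. a \<odot>\<^bsub>M\<^esub> v i)"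
  using assms(1,3)
proof (induction S)
  case empty
  show ?case using assms(2) by simp
next
  case (insert i S)
  have v: "v \<in> S \<rightarrow> carrier M" "(\<lambda>i. a \<odot>\<^bsub>M\<^esub> v i) \<in> S \<rightarrow> carrier M"
    using insert.prems assms(2) by auto
  then show ?case
    using insert assms(2) by (simp add: M.finsum_insert lsmult_r_distr)
qed

lemma free_module_carrierD:
  assumes "c \<in> carrier (free_module A I)"
  shows "finite {i. c i \<noteq> \<zero>\<^bsub>A\<^esub>}" "\<And>i. c i \<in> carrier A" "\<And>i. i \<notin> I \<Longrightarrow> c i = \<zero>\<^bsub>A\<^esub>"
    "{i. c i \<noteq> \<zero>\<^bsub>A\<^esub>} \<subseteq> I"
proof -
  show c: "finite {i. c i \<noteq> \<zero>\<^bsub>A\<^esub>}" "\<And>i. i \<notin> I \<Longrightarrow> c i = \<zero>\<^bsub>A\<^esub>" "{i. c i \<noteq> \<zero>\<^bsub>A\<^esub>} \<subseteq> I"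
    using assms by (auto simp: free_module_def)
  show "c i \<in> carrier A" for i
    using assms by (cases "i \<in> I") (auto simp: free_module_def)
qed

lemma free_module_left_module: "left_module A (free_module A I)"
proof -
  let ?F = "free_module A I"
  have add: "c \<oplus>\<^bsub>?F\<^esub> d \<in> carrier ?F" if "c \<in> carrier ?F" "d \<in> carrier ?F" for c d
  proof -
    have "finite ({i. c i \<noteq> \<zero>\<^bsub>A\<^esub>} \<union> {i. d i \<noteq> \<zero>\<^bsub>A\<^esub>})"
      using that by (simp add: free_module_carrierD)
    then have "finite {i. c i \<oplus>\<^bsub>A\<^esub> d i \<noteq> \<zero>\<^bsub>A\<^esub>}"
      by (rule rev_finite_subset) auto
    then show ?thesis
      using that[THEN free_module_carrierD(2)] that[THEN free_module_carrierD(3)]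
      by (simp add: free_module_def)
  qed
  have smult: "a \<odot>\<^bsub>?F\<^esub> c \<in> carrier ?F" if "a \<in> carrier A" "c \<in> carrier ?F" for a c
  proof -
    have "finite {i. a \<otimes>\<^bsub>A\<^esub> c i \<noteq> \<zero>\<^bsub>A\<^esub>}"
      by (rule rev_finite_subset[OF free_module_carrierD(1)[OF that(2)]]) (use that in auto)
    then show ?thesis
      using that(1) free_module_carrierD(2,3)[OF that(2)] by (simp add: free_module_def)
  qed
  have inv: "\<exists>d\<in>carrier ?F. d \<oplus>\<^bsub>?F\<^esub> c = \<zero>\<^bsub>?F\<^esub>" if "c \<in> carrier ?F" for c
  proof
    have "finite {i. \<ominus>\<^bsub>A\<^esub> c i \<noteq> \<zero>\<^bsub>A\<^esub>}"
      by (rule rev_finite_subset[OF free_module_carrierD(1)[OF that]]) auto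
    then show "(\<lambda>i. \<ominus>\<^bsub>A\<^esub> c i) \<in> carrier ?F"
      using free_module_carrierD(2,3)[OF that] by (simp add: free_module_def)
    show "(\<lambda>i. \<ominus>\<^bsub>A\<^esub> c i) \<oplus>\<^bsub>?F\<^esub> c = \<zero>\<^bsub>?F\<^esub>"
      using free_module_carrierD(2)[OF that] by (simp add: free_module_def A.l_neg)
  qed
  have coeff: "c i \<in> carrier A" if "c \<in> carrier ?F" for c i
    using free_module_carrierD(2)[OF that] .
  have ag: "abelian_group ?F"
  proof (rule abelian_groupI)
    show "\<zero>\<^bsub>?F\<^esub> \<in> carrier ?F" by (simp add: free_module_def)
  next
    fix x y z assume x: "x \<in> carrier ?F" and y: "y \<in> carrier ?F" and z: "z \<in> carrier ?F"
    show "(x \<oplus>\<^bsub>?F\<^esub> y) \<oplus>\<^bsub>?F\<^esub> z = x \<oplus>\<^bsub>?F\<^esub> (y \<oplus>\<^bsub>?F\<^esub> z)"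
      using coeff[OF x] coeff[OF y] coeff[OF z] by (simp add: free_module_def A.a_assoc)
  next
    fix x y assume x: "x \<in> carrier ?F" and y: "y \<in> carrier ?F"
    show "x \<oplus>\<^bsub>?F\<^esub> y = y \<oplus>\<^bsub>?F\<^esub> x"
      using coeff[OF x] coeff[OF y] by (simp add: free_module_def A.a_comm)
  next
    fix x assume x: "x \<in> carrier ?F"
    show "\<zero>\<^bsub>?F\<^esub> \<oplus>\<^bsub>?F\<^esub> x = x"
      using coeff[OF x] by (simp add: free_module_def)
  qed (use add inv in auto)
  show ?thesis
  proof (intro left_module.intro left_module_axioms.intro)
    show "ring A" by (rule A.ring_axioms)
    show "abelian_group ?F" by (rule ag)
  next
    fix a b x assume "a \<in> carrier A" "b \<in> carrier A" and x: "x \<in> carrier ?F"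
    then show "(a \<oplus>\<^bsub>A\<^esub> b) \<odot>\<^bsub>?F\<^esub> x = a \<odot>\<^bsub>?F\<^esub> x \<oplus>\<^bsub>?F\<^esub> b \<odot>\<^bsub>?F\<^esub> x"
      and "(a \<otimes>\<^bsub>A\<^esub> b) \<odot>\<^bsub>?F\<^esub> x = a \<odot>\<^bsub>?F\<^esub> (b \<odot>\<^bsub>?F\<^esub> x)"
      using coeff[OF x] by (simp_all add: free_module_def A.l_distr A.m_assoc)
  next
    fix a x y assume "a \<in> carrier A" and x: "x \<in> carrier ?F" and y: "y \<in> carrier ?F"
    then show "a \<odot>\<^bsub>?F\<^esub> (x \<oplus>\<^bsub>?F\<^esub> y) = a \<odot>\<^bsub>?F\<^esub> x \<oplus>\<^bsub>?F\<^esub> a \<odot>\<^bsub>?F\<^esub> y"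
      using coeff[OF x] coeff[OF y] by (simp add: free_module_def A.r_distr)
  next
    fix x assume x: "x \<in> carrier ?F"
    show "\<one>\<^bsub>A\<^esub> \<odot>\<^bsub>?F\<^esub> x = x" using coeff[OF x] by (simp add: free_module_def)
  qed (use smult in auto)
qed

lemma lin_comb_eq:
  assumes "finite S" "{i. c i \<noteq> \<zero>\<^bsub>A\<^esub>} \<subseteq> S"
    and "\<And>i. i \<in> S \<Longrightarrow> c i \<in> carrier A" "\<And>i. i \<in> S \<Longrightarrow> u i \<in> carrier M"
  shows "lin_comb A M u c = (\<Oplus>\<^bsub>M\<^esub>i\<in>S. c i \<odot>\<^bsub>M\<^esub> u i)"
  unfolding lin_comb_def
  by (rule M.add.finprod_mono_neutral_cong_left) (use assms in auto)

lemma lin_comb_hom: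
  assumes u: "\<And>i. i \<in> I \<Longrightarrow> u i \<in> carrier M"
  shows "restrict (lin_comb A M u) (carrier (free_module A I)) \<in> mod_hom A (free_module A I) M"
proof -
  let ?F = "free_module A I"
  interpret F: left_module A ?F by (rule free_module_left_module)
  show ?thesis
  proof (rule mod_homI)
    fix c assume c: "c \<in> carrier ?F"
    have "lin_comb A M u c \<in> carrier M"
      unfolding lin_comb_def
      by (rule M.finsum_closed) (use free_module_carrierD[OF c] u in auto)
    then show "restrict (lin_comb A M u) (carrier ?F) c \<in> carrier M"
      using c by simp
  next
    fix c d assume c: "c \<in> carrier ?F" and d: "d \<in> carrier ?F"
    let ?S = "{i. c i \<noteq> \<zero>\<^bsub>A\<^esub>} \<union> {i. d i \<noteq> \<zero>\<^bsub>A\<^esub>}"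
    note C = free_module_carrierD[OF c] and D = free_module_carrierD[OF d]
    have S: "finite ?S" "?S \<subseteq> I" using C D by auto
    have uS: "\<And>i. i \<in> ?S \<Longrightarrow> u i \<in> carrier M" using S(2) u by blast
    have cd: "(c \<oplus>\<^bsub>?F\<^esub> d) i = c i \<oplus>\<^bsub>A\<^esub> d i" for i by (simp add: free_module_def)
    have "lin_comb A M u (c \<oplus>\<^bsub>?F\<^esub> d) = (\<Oplus>\<^bsub>M\<^esub>i\<in>?S. (c i \<oplus>\<^bsub>A\<^esub> d i) \<odot>\<^bsub>M\<^esub> u i)"
      unfolding cd[symmetric] by (rule lin_comb_eq) (use S uS C D in \<open>auto simp: cd\<close>)
    also have "\<dots> = (\<Oplus>\<^bsub>M\<^esub>i\<in>?S. c i \<odot>\<^bsub>M\<^esub> u i \<oplus>\<^bsub>M\<^esub> d i \<odot>\<^bsub>M\<^esub> u i)"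
      by (rule M.add.finprod_cong') (use uS C D in \<open>auto simp: lsmult_l_distr\<close>)
    also have "\<dots> = (\<Oplus>\<^bsub>M\<^esub>i\<in>?S. c i \<odot>\<^bsub>M\<^esub> u i) \<oplus>\<^bsub>M\<^esub> (\<Oplus>\<^bsub>M\<^esub>i\<in>?S. d i \<odot>\<^bsub>M\<^esub> u i)"
      by (rule M.finsum_addf) (use uS C D in auto)
    also have "\<dots> = lin_comb A M u c \<oplus>\<^bsub>M\<^esub> lin_comb A M u d"
      using lin_comb_eq[OF S(1) _ _ uS, of c] lin_comb_eq[OF S(1) _ _ uS, of d] C D by auto
    finally show "restrict (lin_comb A M u) (carrier ?F) (c \<oplus>\<^bsub>?F\<^esub> d) =
        restrict (lin_comb A M u) (carrier ?F) c \<oplus>\<^bsub>M\<^esub> restrict (lin_comb A M u) (carrier ?F) d"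
      using c d by simp
  next
    fix a c assume a: "a \<in> carrier A" and c: "c \<in> carrier ?F"
    let ?S = "{i. c i \<noteq> \<zero>\<^bsub>A\<^esub>}"
    note C = free_module_carrierD[OF c]
    have uS: "\<And>i. i \<in> ?S \<Longrightarrow> u i \<in> carrier M" using C(4) u by blast
    have ac: "(a \<odot>\<^bsub>?F\<^esub> c) i = a \<otimes>\<^bsub>A\<^esub> c i" for i by (simp add: free_module_def)
    have "lin_comb A M u (a \<odot>\<^bsub>?F\<^esub> c) = (\<Oplus>\<^bsub>M\<^esub>i\<in>?S. (a \<otimes>\<^bsub>A\<^esub> c i) \<odot>\<^bsub>M\<^esub> u i)"
      unfolding ac[symmetric] by (rule lin_comb_eq) (use a uS C in \<open>auto simp: ac\<close>)
    also have "\<dots> = (\<Oplus>\<^bsub>M\<^esub>i\<in>?S. a \<odot>\<^bsub>M\<^esub> (c i \<odot>\<^bsub>M\<^esub> u i))"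
      by (rule M.add.finprod_cong') (use a uS C in \<open>auto simp: lsmult_assoc\<close>)
    also have "\<dots> = a \<odot>\<^bsub>M\<^esub> lin_comb A M u c"
      unfolding lin_comb_def by (rule lsmult_finsum[symmetric]) (use a uS C in auto)
    finally show "restrict (lin_comb A M u) (carrier ?F) (a \<odot>\<^bsub>?F\<^esub> c) =
        a \<odot>\<^bsub>M\<^esub> restrict (lin_comb A M u) (carrier ?F) c"
      using a c by simp
  qed simp
qed

end

lemma mod_hom_lin_comb:
  assumes "left_module A M" "left_module A N" "f \<in> mod_hom A M N"
    and "c \<in> carrier (free_module A I)" "\<And>i. i \<in> I \<Longrightarrow> u i \<in> carrier M"
  shows "f (lin_comb A M u c) = lin_comb A N (\<lambda>i. f (u i)) c"
proof -
  interpret M: left_module A M by fact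
  interpret N: left_module A N by fact
  note C = M.free_module_carrierD[OF assms(4)]
  have u: "u i \<in> carrier M" if "c i \<noteq> \<zero>\<^bsub>A\<^esub>" for i
    using that assms(5) C(4) by blast
  have "f (lin_comb A M u c) = (\<Oplus>\<^bsub>N\<^esub>i\<in>{i. c i \<noteq> \<zero>\<^bsub>A\<^esub>}. f (c i \<odot>\<^bsub>M\<^esub> u i))"
    unfolding lin_comb_def by (rule mod_hom_finsum[OF assms(1-3) C(1)]) (use C u in auto)
  also have "\<dots> = lin_comb A N (\<lambda>i. f (u i)) c"
    unfolding lin_comb_def
    by (rule N.M.add.finprod_cong') (use C u mod_homD[OF assms(3)] in auto)
  finally show ?thesis .
qed

lemma projective_module_lift:
  fixes P :: "('a, 'p) module" and N :: "('a, 'n) module" and M :: "('a, 'm) module"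
  assumes P: "projective_module A P" and N: "left_module A N" and M: "left_module A M"
    and g: "g \<in> mod_hom A N M" "g ` carrier N = carrier M" and h: "h \<in> mod_hom A P M"
  shows "\<exists>k\<in>mod_hom A P N. compose (carrier P) g k = h"
proof -
  let ?F = "free_module A (carrier P)"
  have lP: "left_module A P" using P by (simp add: projective_module_def)
  interpret P: left_module A P by fact
  interpret N: left_module A N by fact
  interpret M: left_module A M by fact
  interpret F: left_module A ?F by (rule P.free_module_left_module)
  define e where "e = restrict (lin_comb A P (\<lambda>p. p)) (carrier ?F)"
  have e: "e \<in> mod_hom A ?F P"
    unfolding e_def by (rule P.lin_comb_hom) simp
  have "p \<in> e ` carrier ?F" if p: "p \<in> carrier P" for p
  proof
    let ?c = "\<lambda>q. if q = p then \<one>\<^bsub>A\<^esub> else \<zero>\<^bsub>A\<^esub>"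
    have "finite {q. ?c q \<noteq> \<zero>\<^bsub>A\<^esub>}" by (rule finite_subset[of _ "{p}"]) auto
    then show c: "?c \<in> carrier ?F" using p by (auto simp: free_module_def)
    have "lin_comb A P (\<lambda>q. q) ?c = (\<Oplus>\<^bsub>P\<^esub>q\<in>{p}. ?c q \<odot>\<^bsub>P\<^esub> q)"
      by (rule P.lin_comb_eq) (use p in auto)
    then show "p = e ?c" using p c by (simp add: e_def)
  qed
  then have surj: "e ` carrier ?F = carrier P"
    using mod_homD(1)[OF e] by blast
  have idP: "mod_id P \<in> mod_hom A P P"
    by (rule mod_homI) (auto simp: mod_id_def)
  obtain s where s: "s \<in> mod_hom A P ?F" "compose (carrier P) e s = mod_id P"
    using P e idP surj F.left_module_axioms lP unfolding projective_module_def by blast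
  have "\<forall>p\<in>carrier P. \<exists>n\<in>carrier N. g n = h p"
    using mod_homD(1)[OF h] g(2) by (metis imageE)
  then obtain n where n: "\<And>p. p \<in> carrier P \<Longrightarrow> n p \<in> carrier N"
      "\<And>p. p \<in> carrier P \<Longrightarrow> g (n p) = h p"
    by metis
  define l where "l = restrict (lin_comb A N n) (carrier ?F)"
  have l: "l \<in> mod_hom A ?F N"
    unfolding l_def by (rule N.lin_comb_hom) (rule n)
  have gl: "g (l c) = h (e c)" if c: "c \<in> carrier ?F" for c
  proof -
    have "g (l c) = lin_comb A M (\<lambda>p. g (n p)) c"
      using mod_hom_lin_comb[OF N M g(1) c] n c by (simp add: l_def)
    also have "\<dots> = lin_comb A M h c"
      unfolding lin_comb_def
      by (rule M.M.add.finprod_cong')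
        (use P.free_module_carrierD[OF c] n mod_homD(1)[OF h] in auto)
    also have "\<dots> = h (e c)"
      using mod_hom_lin_comb[OF lP M h c, of "\<lambda>p. p"] c by (simp add: e_def)
    finally show ?thesis .
  qed
  have "compose (carrier P) g (compose (carrier P) l s) = h"
  proof (rule extensionalityI)
    show "h \<in> extensional (carrier P)" by (rule mod_homD(4)[OF h])
    fix p assume p: "p \<in> carrier P"
    have "e (s p) = p" using s(2) p by (metis compose_eq mod_id_def restrict_apply')
    then show "compose (carrier P) g (compose (carrier P) l s) p = h p"
      using p gl[OF mod_homD(1)[OF s(1) p]] by (simp add: compose_eq)
  qed simp
  then show ?thesis
    using mod_hom_compose[OF lP s(1) l] by blast
qed

definition superfluous :: "('a, 'b) ring_scheme \<Rightarrow> ('a, 'p) module \<Rightarrow> 'p set \<Rightarrow> bool" where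
  "superfluous A P K \<longleftrightarrow> submodule K A P \<and>
    (\<forall>N. submodule N A P \<and> N <+>\<^bsub>P\<^esub> K = carrier P \<longrightarrow> N = carrier P)"

definition projective_cover ::
  "('a, 'b) ring_scheme \<Rightarrow> ('a, 'm) module \<Rightarrow> ('a, 'p) module \<Rightarrow> ('p \<Rightarrow> 'm) \<Rightarrow> bool" where
  "projective_cover A M P f \<longleftrightarrow> projective_module A P \<and> f \<in> mod_hom A P M \<and>
    f ` carrier P = carrier M \<and> superfluous A P (mod_ker P M f)"

text \<open>
  The type parameter \<open>'m\<close> is the type of elements of the modules under consideration.  It
  stays free, so a theorem about \<open>semi_perfect TYPE('m) A\<close> is about all finitely generated
  modules.  A projective cover of a finitely generated module is itself finitely generated,
  hence a direct summand of some \<open>A\<^sup>n\<close>; so it can always be found in the type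
  \<open>nat \<Rightarrow> 'a\<close>.
\<close>

definition semi_perfect :: "'m itself \<Rightarrow> ('a, 'b) ring_scheme \<Rightarrow> bool" where
  "semi_perfect _ A \<longleftrightarrow> ring A \<and>
    (\<forall>M :: ('a, 'm) module. left_module A M \<and> fin_gen_module A M \<longrightarrow>
      (\<exists>(P :: ('a, nat \<Rightarrow> 'a) module) f. projective_cover A M P f))"


section \<open>Algebras over a commutative ring\<close>

text \<open>The library locale \<^locale>\<open>algebra\<close> is restricted to commutative algebras.\<close>

locale nc_algebra = module R A + ring A for R (structure) and A (structure) +
  assumes smult_mult_l: "\<lbrakk>r \<in> carrier R; x \<in> carrier A; y \<in> carrier A\<rbrakk> \<Longrightarrow>
        (r \<odot>\<^bsub>A\<^esub> x) \<otimes>\<^bsub>A\<^esub> y = r \<odot>\<^bsub>A\<^esub> (x \<otimes>\<^bsub>A\<^esub> y)"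
    and smult_mult_r: "\<lbrakk>r \<in> carrier R; x \<in> carrier A; y \<in> carrier A\<rbrakk> \<Longrightarrow>
        x \<otimes>\<^bsub>A\<^esub> (r \<odot>\<^bsub>A\<^esub> y) = r \<odot>\<^bsub>A\<^esub> (x \<otimes>\<^bsub>A\<^esub> y)"

text \<open>The action of the base ring on a module over the algebra \<open>A\<close>.\<close>

definition base_smult :: "('r, 'a) module \<Rightarrow> ('a, 'm) module \<Rightarrow> 'r \<Rightarrow> 'm \<Rightarrow> 'm" where
  "base_smult A M r x = (r \<odot>\<^bsub>A\<^esub> \<one>\<^bsub>A\<^esub>) \<odot>\<^bsub>M\<^esub> x"

definition quot_algebra :: "('r, 'a) module \<Rightarrow> 'a set \<Rightarrow> ('r, 'a set) module" where
  "quot_algebra A J =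
    \<lparr>carrier = carrier (A Quot J), monoid.mult = (\<otimes>\<^bsub>A Quot J\<^esub>),
     one = \<one>\<^bsub>A Quot J\<^esub>, ring.zero = \<zero>\<^bsub>A Quot J\<^esub>, ring.add = (\<oplus>\<^bsub>A Quot J\<^esub>),
     smult = (\<lambda>r U. \<Union>x\<in>U. J +>\<^bsub>A\<^esub> (r \<odot>\<^bsub>A\<^esub> x))\<rparr>"

definition quot_ideal :: "('r, 'a) module \<Rightarrow> 'a set \<Rightarrow> 'a set \<Rightarrow> 'a set set" where
  "quot_ideal A J I = (\<lambda>x. J +>\<^bsub>A\<^esub> x) ` I"

definition hom_add :: "('a, 'm) module \<Rightarrow> ('a, 'n) module \<Rightarrow> ('m \<Rightarrow> 'n) \<Rightarrow> ('m \<Rightarrow> 'n) \<Rightarrow> 'm \<Rightarrow> 'n"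
  where "hom_add M N f g = (\<lambda>x\<in>carrier M. f x \<oplus>\<^bsub>N\<^esub> g x)"

definition hom_smult ::
  "('r, 'a) module \<Rightarrow> ('a, 'm) module \<Rightarrow> ('a, 'n) module \<Rightarrow> 'r \<Rightarrow> ('m \<Rightarrow> 'n) \<Rightarrow> 'm \<Rightarrow> 'n" where
  "hom_smult A M N r f = (\<lambda>x\<in>carrier M. base_smult A N r (f x))"

definition end_algebra :: "('r, 'a) module \<Rightarrow> ('a, 'm) module \<Rightarrow> ('r, 'm \<Rightarrow> 'm) module" where
  "end_algebra A M =
    \<lparr>carrier = mod_hom A M M, monoid.mult = compose (carrier M), one = mod_id M,
     ring.zero = (\<lambda>x\<in>carrier M. \<zero>\<^bsub>M\<^esub>), ring.add = hom_add M M, smult = hom_smult A M M\<rparr>"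

definition op_algebra :: "('r, 'a) module \<Rightarrow> ('r, 'a) module" where
  "op_algebra A = A\<lparr>monoid.mult := (\<lambda>x y. y \<otimes>\<^bsub>A\<^esub> x)\<rparr>"


section \<open>Morita equivalence\<close>

text \<open>
  A functor from the category of left \<open>B\<close>-modules to that of left \<open>C\<close>-modules, with elements
  in fixed types, that is \<open>R\<close>-linear on homomorphism modules: an object part \<open>Fo\<close> and an
  arrow part \<open>Fm\<close>.  The arrow part takes source and target as arguments since the target
  is not determined by the function.
\<close>

definition linear_functor ::
  "('r, 's) ring_scheme \<Rightarrow> ('r, 'b) module \<Rightarrow> ('r, 'c) module \<Rightarrow>
   (('b, 'u) module \<Rightarrow> ('c, 'v) module) \<Rightarrow>
   (('b, 'u) module \<Rightarrow> ('b, 'u) module \<Rightarrow> ('u \<Rightarrow> 'u) \<Rightarrow> ('v \<Rightarrow> 'v)) \<Rightarrow> bool" where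
  "linear_functor R B C Fo Fm \<longleftrightarrow>
    (\<forall>M. left_module B M \<longrightarrow> left_module C (Fo M)) \<and>
    (\<forall>M N. left_module B M \<and> left_module B N \<longrightarrow>
      (\<forall>f\<in>mod_hom B M N. Fm M N f \<in> mod_hom C (Fo M) (Fo N))) \<and>
    (\<forall>M. left_module B M \<longrightarrow> Fm M M (mod_id M) = mod_id (Fo M)) \<and>
    (\<forall>L M N. left_module B L \<and> left_module B M \<and> left_module B N \<longrightarrow>
      (\<forall>f\<in>mod_hom B L M. \<forall>g\<in>mod_hom B M N.
        Fm L N (compose (carrier L) g f) = compose (carrier (Fo L)) (Fm M N g) (Fm L M f))) \<and>
    (\<forall>M N. left_module B M \<and> left_module B N \<longrightarrow>
      (\<forall>f\<in>mod_hom B M N. \<forall>g\<in>mod_hom B M N.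
        Fm M N (hom_add M N f g) = hom_add (Fo M) (Fo N) (Fm M N f) (Fm M N g)) \<and>
      (\<forall>r\<in>carrier R. \<forall>f\<in>mod_hom B M N.
        Fm M N (hom_smult B M N r f) = hom_smult C (Fo M) (Fo N) r (Fm M N f)))"

text \<open>
  A natural isomorphism from the endofunctor \<open>(Fo, Fm)\<close> to the identity functor; isomorphisms
  of modules are bijective homomorphisms.
\<close>

definition nat_iso_to_id ::
  "('r, 'b) module \<Rightarrow> (('b, 'u) module \<Rightarrow> ('b, 'u) module) \<Rightarrow>
   (('b, 'u) module \<Rightarrow> ('b, 'u) module \<Rightarrow> ('u \<Rightarrow> 'u) \<Rightarrow> ('u \<Rightarrow> 'u)) \<Rightarrow>
   (('b, 'u) module \<Rightarrow> 'u \<Rightarrow> 'u) \<Rightarrow> bool" where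
  "nat_iso_to_id B Fo Fm \<eta> \<longleftrightarrow>
    (\<forall>M. left_module B M \<longrightarrow>
      \<eta> M \<in> mod_hom B (Fo M) M \<and> bij_betw (\<eta> M) (carrier (Fo M)) (carrier M)) \<and>
    (\<forall>M N. left_module B M \<and> left_module B N \<longrightarrow>
      (\<forall>f\<in>mod_hom B M N.
        compose (carrier (Fo M)) (\<eta> N) (Fm M N f) = compose (carrier (Fo M)) f (\<eta> M)))"

text \<open>
  Morita equivalence of \<open>R\<close>-algebras: an \<open>R\<close>-linear equivalence between the categories of
  left modules.  Both categories consist of the modules with elements in the infinite type
  \<open>nat \<Rightarrow> 'b + 'c\<close>, which up to isomorphism contains all modules generated by countably
  many elements and is closed under submodules, quotients and countable direct sums.
  An equivalence of the categories of all modules is given by tensoring with a finitely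
  generated bimodule, so it restricts to these categories up to isomorphism.  Conversely,
  these categories contain the regular modules and allow one to express projectivity, finite
  generation and the generator property of the image of a regular module, so an equivalence
  between them yields a progenerator and extends to all modules.
\<close>

definition morita_equivalent ::
  "('r, 's) ring_scheme \<Rightarrow> ('r, 'b) module \<Rightarrow> ('r, 'c) module \<Rightarrow> bool" where
  "morita_equivalent R B C \<longleftrightarrow>
    (\<exists>(Fo :: ('b, nat \<Rightarrow> 'b + 'c) module \<Rightarrow> ('c, nat \<Rightarrow> 'b + 'c) module) Fm Go Gm \<eta> \<epsilon>.
      linear_functor R B C Fo Fm \<and> linear_functor R C B Go Gm \<and>
      nat_iso_to_id B (Go \<circ> Fo) (\<lambda>M N f. Gm (Fo M) (Fo N) (Fm M N f)) \<eta> \<and>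
      nat_iso_to_id C (Fo \<circ> Go) (\<lambda>M N f. Fm (Go M) (Go N) (Gm M N f)) \<epsilon>)"


section \<open>Split quasi-hereditary algebras\<close>

definition local_ring :: "('r, 's) ring_scheme \<Rightarrow> bool" where
  "local_ring R \<longleftrightarrow> cring R \<and> (\<exists>!\<mm>. maximalideal \<mm> R)"

definition left_ideal_module :: "('r, 'a) module \<Rightarrow> 'a set \<Rightarrow> ('a, 'a) module" where
  "left_ideal_module A J = (regular_module A)\<lparr>carrier := J\<rparr>"

definition split_heredity_ideal :: "('r, 's) ring_scheme \<Rightarrow> ('r, 'a) module \<Rightarrow> 'a set \<Rightarrow> bool" where
  "split_heredity_ideal R A J \<longleftrightarrow> ideal J A \<and>
    projective_module R (quot_algebra A J) \<and>
    projective_module A (left_ideal_module A J) \<and>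
    J \<cdot>\<^bsub>A\<^esub> J = J \<and>
    morita_equivalent R (op_algebra (end_algebra A (left_ideal_module A J))) (regular_module R)"

definition split_quasi_hereditary :: "('r, 's) ring_scheme \<Rightarrow> ('r, 'a) module \<Rightarrow> bool" where
  "split_quasi_hereditary R A \<longleftrightarrow>
    cring R \<and> noetherian_ring R \<and> nc_algebra R A \<and>
    fin_gen_module R A \<and> projective_module R A \<and>
    (\<exists>t (J :: nat \<Rightarrow> 'a set).
      J 1 = carrier A \<and> J (t + 1) = {\<zero>\<^bsub>A\<^esub>} \<and>
      (\<forall>i\<in>{1..t + 1}. ideal (J i) A) \<and>
      (\<forall>i\<in>{1..t}. J (i + 1) \<subseteq> J i \<and>
        split_heredity_ideal R (quot_algebra A (J (i + 1))) (quot_ideal A (J (i + 1)) (J i))))"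

end

theory Submission
  imports Defs
begin

text \<open>
  It suffices to find, for every maximal left ideal \<open>N\<close> of \<open>A\<close>, an idempotent \<open>e\<close> such that \<open>A e\<close>
  is a projective cover of \<open>A / N\<close>: in a Noetherian projective module \<open>F\<close> with a submodule
  \<open>K\<close>, a direct summand that is maximal among those contained in \<open>K\<close> then has a
  complement whose intersection with \<open>K\<close> is superfluous, since otherwise another \<open>A e\<close> splits off.

  The idempotents are found by induction along the chain of ideals, so let \<open>J\<close> be a heredity ideal
  of \<open>A\<close> and suppose that they exist for \<open>A / J\<close>.  If \<open>J\<close> is not contained in \<open>N\<close>, then \<open>A / N\<close> is a
  quotient of \<open>J\<close>.  The Morita equivalence makes the endomorphism ring of \<open>J\<close> look like a matrix
  ring over the local ring \<open>R\<close>, and the cover is a summand of \<open>J\<close>.  If \<open>J\<close> is contained in \<open>N\<close>,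
  take \<open>f\<close> in \<open>A\<close> representing the idempotent for \<open>A / J\<close>.  The left ideal \<open>L = A f + J\<close> is
  projective because \<open>x = x f + x (1 - f)\<close> with \<open>x (1 - f)\<close> in \<open>J\<close> for \<open>x\<close> in \<open>L\<close>; splitting off
  the covers of simple modules not killed by \<open>J\<close> from \<open>L\<close> leaves the cover of \<open>A / N\<close>.
\<close>

section \<open>Ascending chains of submodules\<close>

text \<open>\<open>R\<close> is only local, not complete, so idempotents cannot simply be lifted
  from a residue algebra: the Gaussian integers over the integers localized at 5 are finite and free
  over a local ring, have two maximal ideals and no nontrivial idempotent. The split condition
  excludes this. The Morita equivalence compares endomorphisms of a heredity ideal with matrices
  over \<open>R\<close> itself, so an idempotent arises by inverting a matrix entry, and locality of
  \<open>R\<close> separates the units from the elements that kill simple \<open>R\<close>-modules.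

  Three encodings keep element types under control. A simple module is a maximal submodule, and the
  quotient by it is never formed; a direct summand is an idempotent endomorphism; finitely generated
  projectivity is a dual basis. The induction statement for \<open>A / I\<close> is phrased in
  \<open>A\<close> by congruences modulo \<open>I\<close>, which is the reason for the parameter
  \<open>I\<close> of \<open>local_lift\<close>.

  The maximality arguments over \<open>A\<close> rest on one chain condition: \<open>A\<close> is
  finitely generated over the Noetherian ring \<open>R\<close>, and left ideals are
  \<open>R\<close>-submodules.\<close>

definition acc :: "'x set set \<Rightarrow> bool" where
  "acc \<C> \<longleftrightarrow> (\<forall>N :: nat \<Rightarrow> 'x set. (\<forall>k. N k \<in> \<C> \<and> N k \<subseteq> N (Suc k)) \<longrightarrow> (\<exists>k. \<forall>m\<ge>k. N m = N k))"

lemma acc_subset: "acc \<C> \<Longrightarrow> \<D> \<subseteq> \<C> \<Longrightarrow> acc \<D>"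
  unfolding acc_def by (meson subsetD)

text \<open>Without a maximal element above \<open>W\<close>, dependent choice builds a strictly
  ascending chain. The subfamily \<open>\<T>\<close> is arbitrary; later uses include the kernels of
  certain idempotents and the finitely generated submodules.\<close>

lemma acc_maximal:
  assumes acc: "acc \<C>" and T: "\<T> \<subseteq> \<C>" "W \<in> \<T>"
  obtains Y where "Y \<in> \<T>" "W \<subseteq> Y" "\<And>Z. Z \<in> \<T> \<Longrightarrow> Y \<subseteq> Z \<Longrightarrow> Z = Y"
proof -
  have "\<exists>Y\<in>\<T>. W \<subseteq> Y \<and> (\<forall>Z\<in>\<T>. Y \<subseteq> Z \<longrightarrow> Z = Y)"
  proof (rule ccontr)
    assume no: "\<not> ?thesis"
    have *: "\<exists>Z. (Z \<in> \<T> \<and> W \<subseteq> Z) \<and> Y \<subset> Z" if "Y \<in> \<T> \<and> W \<subseteq> Y" for Y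
    proof -
      have "\<not> (\<forall>Z\<in>\<T>. Y \<subseteq> Z \<longrightarrow> Z = Y)" using no that by meson
      then obtain Z where "Z \<in> \<T>" "Y \<subseteq> Z" "Z \<noteq> Y" by meson
      then show ?thesis using that by (intro exI[of _ Z]) auto
    qed
    have "\<exists>f. \<forall>n. (f n \<in> \<T> \<and> W \<subseteq> f n) \<and> f n \<subset> f (Suc n)"
      by (rule dependent_nat_choice[where P = "\<lambda>_ Y. Y \<in> \<T> \<and> W \<subseteq> Y" and Q = "\<lambda>_ Y Z. Y \<subset> Z"])
        (use T in blast, rule *)
    then obtain f where "\<forall>n. (f n \<in> \<T> \<and> W \<subseteq> f n) \<and> f n \<subset> f (Suc n)" ..
    then have f: "f n \<in> \<T>" "f n \<subset> f (Suc n)" for n by simp_all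
    then have "\<forall>k. f k \<in> \<C> \<and> f k \<subseteq> f (Suc k)" using T(1) by auto
    then have "\<exists>k. \<forall>m\<ge>k. f m = f k"
      using acc[unfolded acc_def, THEN spec, of f] by simp
    then obtain k where k: "\<forall>m\<ge>k. f m = f k" ..
    have "f (Suc k) = f k" by (rule k[rule_format]) (rule le_SucI, rule order_refl)
    then show False using f(2)[of k] by simp
  qed
  then obtain Y where Y: "Y \<in> \<T>" "W \<subseteq> Y" "\<forall>Z\<in>\<T>. Y \<subseteq> Z \<longrightarrow> Z = Y" by auto
  show thesis by (rule that[OF Y(1,2)]) (rule Y(3)[rule_format])
qed

text \<open>The pair \<open>M\<close>, \<open>N\<close> stands for the simple module
  \<open>M / N\<close>.\<close>

definition maximal_submodule :: "('a, 'b) ring_scheme \<Rightarrow> ('a, 'm) module \<Rightarrow> 'm set \<Rightarrow> bool" where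
  "maximal_submodule A M N \<longleftrightarrow> submodule N A M \<and> N \<noteq> carrier M \<and>
    (\<forall>V. submodule V A M \<and> N \<subseteq> V \<longrightarrow> V = N \<or> V = carrier M)"

context left_module
begin

lemma submodule_subset: "submodule N A M \<Longrightarrow> N \<subseteq> carrier M"
  and submodule_zero: "submodule N A M \<Longrightarrow> \<zero>\<^bsub>M\<^esub> \<in> N"
  and submodule_add: "submodule N A M \<Longrightarrow> x \<in> N \<Longrightarrow> y \<in> N \<Longrightarrow> x \<oplus>\<^bsub>M\<^esub> y \<in> N"
  and submodule_smult: "submodule N A M \<Longrightarrow> a \<in> carrier A \<Longrightarrow> x \<in> N \<Longrightarrow> a \<odot>\<^bsub>M\<^esub> x \<in> N"
  and submodule_neg: "submodule N A M \<Longrightarrow> x \<in> N \<Longrightarrow> \<ominus>\<^bsub>M\<^esub> x \<in> N"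
  using subgroup.subset[of N "add_monoid M"] subgroup.one_closed[of N "add_monoid M"]
    subgroup.m_closed[of N "add_monoid M" x y] subgroup.m_inv_closed[of N "add_monoid M" x]
  by (simp_all add: submodule_def submodule_axioms_def a_inv_def)

lemma submodule_diff:
  "submodule N A M \<Longrightarrow> x \<in> N \<Longrightarrow> y \<in> N \<Longrightarrow> x \<ominus>\<^bsub>M\<^esub> y \<in> N"
  by (simp add: a_minus_def submodule_add submodule_neg)

lemma submodule_closed: "submodule N A M \<Longrightarrow> x \<in> N \<Longrightarrow> x \<in> carrier M"
  using submodule_subset by blast

lemma lsmult_minus_l:
  assumes "a \<in> carrier A" "x \<in> carrier M" shows "(\<ominus> a) \<odot>\<^bsub>M\<^esub> x = \<ominus>\<^bsub>M\<^esub> (a \<odot>\<^bsub>M\<^esub> x)"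
proof -
  have "(\<ominus> a) \<odot>\<^bsub>M\<^esub> x \<oplus>\<^bsub>M\<^esub> a \<odot>\<^bsub>M\<^esub> x = \<zero>\<^bsub>M\<^esub>"
    using assms lsmult_l_distr[of "\<ominus> a" a x] by (simp add: A.l_neg)
  then show ?thesis using assms by (simp add: M.minus_equality)
qed

lemma lsmult_minus_r:
  assumes "a \<in> carrier A" "x \<in> carrier M" shows "a \<odot>\<^bsub>M\<^esub> (\<ominus>\<^bsub>M\<^esub> x) = \<ominus>\<^bsub>M\<^esub> (a \<odot>\<^bsub>M\<^esub> x)"
proof -
  have "a \<odot>\<^bsub>M\<^esub> (\<ominus>\<^bsub>M\<^esub> x) \<oplus>\<^bsub>M\<^esub> a \<odot>\<^bsub>M\<^esub> x = \<zero>\<^bsub>M\<^esub>"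
    using assms lsmult_r_distr[of a "\<ominus>\<^bsub>M\<^esub> x" x] by (simp add: M.l_neg)
  then show ?thesis using assms by (simp add: M.minus_equality)
qed

lemma lsmult_diff_l:
  assumes "a \<in> carrier A" "b \<in> carrier A" "x \<in> carrier M"
  shows "(a \<ominus> b) \<odot>\<^bsub>M\<^esub> x = a \<odot>\<^bsub>M\<^esub> x \<ominus>\<^bsub>M\<^esub> b \<odot>\<^bsub>M\<^esub> x"
  using assms by (simp add: a_minus_def lsmult_l_distr lsmult_minus_l)

lemma lsmult_diff_r:
  assumes "a \<in> carrier A" "x \<in> carrier M" "y \<in> carrier M"
  shows "a \<odot>\<^bsub>M\<^esub> (x \<ominus>\<^bsub>M\<^esub> y) = a \<odot>\<^bsub>M\<^esub> x \<ominus>\<^bsub>M\<^esub> a \<odot>\<^bsub>M\<^esub> y"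
  using assms by (simp add: a_minus_def lsmult_r_distr lsmult_minus_r)

lemma submoduleI:
  assumes "N \<subseteq> carrier M" "\<zero>\<^bsub>M\<^esub> \<in> N"
    and "\<And>x y. x \<in> N \<Longrightarrow> y \<in> N \<Longrightarrow> x \<oplus>\<^bsub>M\<^esub> y \<in> N"
    and "\<And>a x. a \<in> carrier A \<Longrightarrow> x \<in> N \<Longrightarrow> a \<odot>\<^bsub>M\<^esub> x \<in> N"
  shows "submodule N A M"
proof -
  have "\<ominus>\<^bsub>M\<^esub> x \<in> N" if "x \<in> N" for x
    using assms(4)[OF _ that, of "\<ominus> \<one>"] assms(1) that by (auto simp: lsmult_minus_l)
  then show ?thesis
    unfolding submodule_def submodule_axioms_def subgroup_def using assms
    by (auto simp: a_inv_def)
qed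

lemma submodule_trivial: "submodule {\<zero>\<^bsub>M\<^esub>} A M"
  by (rule submoduleI) auto

lemma submodule_Int: "submodule N A M \<Longrightarrow> submodule K A M \<Longrightarrow> submodule (N \<inter> K) A M"
  by (rule submoduleI) (use submodule_subset in \<open>auto intro: submodule_zero submodule_add submodule_smult\<close>)

lemma submodule_finsum:
  assumes "submodule N A M" "finite S" "\<And>i. i \<in> S \<Longrightarrow> v i \<in> N"
  shows "(\<Oplus>\<^bsub>M\<^esub>i\<in>S. v i) \<in> N"
  using assms(2,3)
proof (induction S)
  case empty
  then show ?case using submodule_zero[OF assms(1)] by simp
next
  case (insert i S)
  then show ?case using submodule_closed[OF assms(1)]
    by (subst M.finsum_insert) (auto intro: submodule_add[OF assms(1)])
qed

lemma submodule_left_module: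
  assumes "submodule N A M" shows "left_module A (M\<lparr>carrier := N\<rparr>)"
proof -
  note [simp] = submodule_closed[OF assms] submodule_zero[OF assms] submodule_add[OF assms]
    submodule_smult[OF assms]
  have "abelian_group (M\<lparr>carrier := N\<rparr>)"
  proof (rule abelian_groupI)
    fix x assume "x \<in> carrier (M\<lparr>carrier := N\<rparr>)"
    then show "\<exists>y\<in>carrier (M\<lparr>carrier := N\<rparr>). y \<oplus>\<^bsub>M\<lparr>carrier := N\<rparr>\<^esub> x = \<zero>\<^bsub>M\<lparr>carrier := N\<rparr>\<^esub>"
      using submodule_neg[OF assms] by (auto intro!: bexI[of _ "\<ominus>\<^bsub>M\<^esub> x"] simp: M.l_neg)
  qed (auto simp: M.a_ac)
  then show ?thesis
    by (intro left_module.intro left_module_axioms.intro A.ring_axioms)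
      (auto simp: lsmult_l_distr lsmult_r_distr lsmult_assoc)
qed

lemma submodule_adjoin:
  assumes N: "submodule N A M" and x: "x \<in> carrier M"
  shows "submodule {a \<odot>\<^bsub>M\<^esub> x \<oplus>\<^bsub>M\<^esub> n | a n. a \<in> carrier A \<and> n \<in> N} A M" (is "submodule ?V A M")
    and "N \<subseteq> {a \<odot>\<^bsub>M\<^esub> x \<oplus>\<^bsub>M\<^esub> n | a n. a \<in> carrier A \<and> n \<in> N}"
    and "x \<in> {a \<odot>\<^bsub>M\<^esub> x \<oplus>\<^bsub>M\<^esub> n | a n. a \<in> carrier A \<and> n \<in> N}"
proof -
  note N' = submodule_closed[OF N]
  show sub: "N \<subseteq> ?V"
  proof
    fix n assume "n \<in> N"
    then show "n \<in> ?V" using x N' by (intro CollectI exI[of _ "\<zero>"] exI[of _ n]) auto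
  qed
  show "x \<in> ?V" using x submodule_zero[OF N]
    by (intro CollectI exI[of _ "\<one>"] exI[of _ "\<zero>\<^bsub>M\<^esub>"]) auto
  show "submodule ?V A M"
  proof (rule submoduleI)
    show "?V \<subseteq> carrier M" using x N' by auto
    show "\<zero>\<^bsub>M\<^esub> \<in> ?V" using sub submodule_zero[OF N] by blast
  next
    fix v w assume "v \<in> ?V" "w \<in> ?V"
    then obtain a n b m where "a \<in> carrier A" "n \<in> N" "v = a \<odot>\<^bsub>M\<^esub> x \<oplus>\<^bsub>M\<^esub> n"
      "b \<in> carrier A" "m \<in> N" "w = b \<odot>\<^bsub>M\<^esub> x \<oplus>\<^bsub>M\<^esub> m" by blast
    moreover from this have "v \<oplus>\<^bsub>M\<^esub> w = (a \<oplus> b) \<odot>\<^bsub>M\<^esub> x \<oplus>\<^bsub>M\<^esub> (n \<oplus>\<^bsub>M\<^esub> m)"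
      using x N' by (simp add: lsmult_l_distr M.a_ac)
    ultimately show "v \<oplus>\<^bsub>M\<^esub> w \<in> ?V" using submodule_add[OF N] by blast
  next
    fix c v assume c: "c \<in> carrier A" and "v \<in> ?V"
    then obtain a n where "a \<in> carrier A" "n \<in> N" "v = a \<odot>\<^bsub>M\<^esub> x \<oplus>\<^bsub>M\<^esub> n" by blast
    moreover from this have "c \<odot>\<^bsub>M\<^esub> v = (c \<otimes> a) \<odot>\<^bsub>M\<^esub> x \<oplus>\<^bsub>M\<^esub> c \<odot>\<^bsub>M\<^esub> n"
      using c x N' by (simp add: lsmult_r_distr lsmult_assoc)
    ultimately show "c \<odot>\<^bsub>M\<^esub> v \<in> ?V" using c submodule_smult[OF N] by blast
  qed
qed

text \<open>Simplicity of \<open>M / N\<close> in elementwise form: \<open>A x + N\<close> is a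
  submodule strictly larger than \<open>N\<close>, hence everything.\<close>

lemma maximal_submodule_reach:
  assumes N: "maximal_submodule A M N" and x: "x \<in> carrier M" "x \<notin> N" and y: "y \<in> carrier M"
  obtains a n where "a \<in> carrier A" "n \<in> N" "y = a \<odot>\<^bsub>M\<^esub> x \<oplus>\<^bsub>M\<^esub> n"
proof -
  let ?V = "{a \<odot>\<^bsub>M\<^esub> x \<oplus>\<^bsub>M\<^esub> n | a n. a \<in> carrier A \<and> n \<in> N}"
  have "submodule N A M" using N by (simp add: maximal_submodule_def)
  note V = submodule_adjoin[OF this x(1)]
  have "?V \<noteq> N" using V(3) x(2) by metis
  then have "?V = carrier M" using N V(1,2) unfolding maximal_submodule_def by meson
  then have "y \<in> ?V" using y by simp
  then show thesis using that by blast
qed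

lemma maximal_submodule_exists:
  assumes acc: "acc {N. submodule N A M}" and U: "submodule U A M" "U \<noteq> carrier M"
  obtains N where "maximal_submodule A M N" "U \<subseteq> N"
proof -
  let ?S = "{N. submodule N A M \<and> N \<noteq> carrier M}"
  have "?S \<subseteq> {N. submodule N A M}" "U \<in> ?S" using U by auto
  then show thesis
  proof (rule acc_maximal[OF acc])
    fix N assume N: "N \<in> ?S" "U \<subseteq> N" and max: "\<And>Z. Z \<in> ?S \<Longrightarrow> N \<subseteq> Z \<Longrightarrow> Z = N"
    have "V = N \<or> V = carrier M" if "submodule V A M" "N \<subseteq> V" for V
      using that max[of V] by auto
    then have "maximal_submodule A M N"
      unfolding maximal_submodule_def using N(1) by simp
    then show thesis using N(2) by (rule that)
  qed
qed

end

lemma (in ring) regular_left_module: "left_module R (regular_module R)"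
proof -
  have "abelian_group (regular_module R)"
  proof (rule abelian_groupI)
    fix x assume "x \<in> carrier (regular_module R)"
    then show "\<exists>y\<in>carrier (regular_module R). y \<oplus>\<^bsub>regular_module R\<^esub> x = \<zero>\<^bsub>regular_module R\<^esub>"
      by (auto intro!: bexI[of _ "\<ominus> x"] simp: regular_module_def l_neg)
  qed (auto simp: regular_module_def a_ac)
  then show ?thesis
    by (intro left_module.intro left_module_axioms.intro ring_axioms)
      (auto simp: regular_module_def l_distr r_distr m_assoc)
qed

context left_module
begin

text \<open>A chain inside \<open>A x + U\<close> is controlled by two others: the left ideals of
  coefficients that occur at \<open>x\<close>, and the intersections with \<open>U\<close>. Once
  both are stationary, so is the given chain.\<close>

lemma acc_adjoin:
  assumes reg: "acc {I. submodule I A (regular_module A)}"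
    and U: "submodule U A M" "acc {N. submodule N A M \<and> N \<subseteq> U}" and x: "x \<in> carrier M"
  shows "acc {N. submodule N A M \<and> N \<subseteq> {a \<odot>\<^bsub>M\<^esub> x \<oplus>\<^bsub>M\<^esub> u | a u. a \<in> carrier A \<and> u \<in> U}}"
  unfolding acc_def
proof (intro allI impI)
  interpret R: left_module A "regular_module A" by (rule A.regular_left_module)
  fix N :: "nat \<Rightarrow> _"
  assume N: "\<forall>k. N k \<in> {N. submodule N A M \<and> N \<subseteq> {a \<odot>\<^bsub>M\<^esub> x \<oplus>\<^bsub>M\<^esub> u | a u. a \<in> carrier A \<and> u \<in> U}} \<and>
    N k \<subseteq> N (Suc k)"
  have sub: "submodule (N k) A M" for k using N by auto
  have mono: "k \<le> m \<Longrightarrow> N k \<subseteq> N m" for k m using N lift_Suc_mono_le[of N] by blast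
  note U' = submodule_closed[OF U(1)]
  define I where "I k = {a \<in> carrier A. \<exists>u\<in>U. a \<odot>\<^bsub>M\<^esub> x \<oplus>\<^bsub>M\<^esub> u \<in> N k}" for k
  have I: "submodule (I k) A (regular_module A)" for k
  proof (rule R.submoduleI)
    show "I k \<subseteq> carrier (regular_module A)" by (auto simp: I_def regular_module_def)
    show "\<zero>\<^bsub>regular_module A\<^esub> \<in> I k"
      using submodule_zero[OF U(1)] submodule_zero[OF sub] x
      by (auto simp: I_def regular_module_def intro!: bexI[of _ "\<zero>\<^bsub>M\<^esub>"])
  next
    fix a b assume "a \<in> I k" "b \<in> I k"
    then obtain u v where uv: "a \<in> carrier A" "b \<in> carrier A" "u \<in> U" "v \<in> U"
      "a \<odot>\<^bsub>M\<^esub> x \<oplus>\<^bsub>M\<^esub> u \<in> N k" "b \<odot>\<^bsub>M\<^esub> x \<oplus>\<^bsub>M\<^esub> v \<in> N k" by (auto simp: I_def)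
    have "(a \<oplus> b) \<odot>\<^bsub>M\<^esub> x \<oplus>\<^bsub>M\<^esub> (u \<oplus>\<^bsub>M\<^esub> v) = (a \<odot>\<^bsub>M\<^esub> x \<oplus>\<^bsub>M\<^esub> u) \<oplus>\<^bsub>M\<^esub> (b \<odot>\<^bsub>M\<^esub> x \<oplus>\<^bsub>M\<^esub> v)"
      using uv U' x by (simp add: lsmult_l_distr M.a_ac)
    then show "a \<oplus>\<^bsub>regular_module A\<^esub> b \<in> I k"
      using uv submodule_add[OF U(1)] submodule_add[OF sub]
      by (auto simp: I_def regular_module_def intro!: bexI[of _ "u \<oplus>\<^bsub>M\<^esub> v"])
  next
    fix c a assume c: "c \<in> carrier A" and "a \<in> I k"
    then obtain u where u: "a \<in> carrier A" "u \<in> U" "a \<odot>\<^bsub>M\<^esub> x \<oplus>\<^bsub>M\<^esub> u \<in> N k" by (auto simp: I_def)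
    have "(c \<otimes> a) \<odot>\<^bsub>M\<^esub> x \<oplus>\<^bsub>M\<^esub> c \<odot>\<^bsub>M\<^esub> u = c \<odot>\<^bsub>M\<^esub> (a \<odot>\<^bsub>M\<^esub> x \<oplus>\<^bsub>M\<^esub> u)"
      using c u U' x by (simp add: lsmult_r_distr lsmult_assoc)
    then show "c \<odot>\<^bsub>regular_module A\<^esub> a \<in> I k"
      using c u submodule_smult[OF U(1)] submodule_smult[OF sub]
      by (auto simp: I_def regular_module_def intro!: bexI[of _ "c \<odot>\<^bsub>M\<^esub> u"])
  qed
  have "I k \<subseteq> I (Suc k)" for k using mono[of k "Suc k"] by (auto simp: I_def)
  then obtain k1 where k1: "\<And>m. m \<ge> k1 \<Longrightarrow> I m = I k1"
    using reg[unfolded acc_def, rule_format, of I] I by auto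
  have "N k \<inter> U \<in> {N. submodule N A M \<and> N \<subseteq> U} \<and> N k \<inter> U \<subseteq> N (Suc k) \<inter> U" for k
    using submodule_Int[OF sub U(1)] mono[of k "Suc k"] by auto
  then obtain k2 where k2: "\<And>m. m \<ge> k2 \<Longrightarrow> N m \<inter> U = N k2 \<inter> U"
    using U(2)[unfolded acc_def, rule_format, of "\<lambda>k. N k \<inter> U"] by blast
  let ?k = "max k1 k2"
  have "N m \<subseteq> N ?k" if m: "m \<ge> ?k" for m
  proof
    fix y assume y: "y \<in> N m"
    then obtain a u where au: "a \<in> carrier A" "u \<in> U" "y = a \<odot>\<^bsub>M\<^esub> x \<oplus>\<^bsub>M\<^esub> u" using N by blast
    then have "a \<in> I m" using y by (auto simp: I_def)
    \<comment> \<open>Equal coefficient ideals supply an element of \<open>N ?k\<close> with the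
      same coefficient at \<open>x\<close> as \<open>y\<close>; its difference from \<open>y\<close>
      lies in \<open>U\<close> and is handled by the second chain.\<close>
    then have "a \<in> I ?k" using k1[of m] k1[of ?k] m by simp
    then obtain v where v: "v \<in> U" "a \<odot>\<^bsub>M\<^esub> x \<oplus>\<^bsub>M\<^esub> v \<in> N ?k" by (auto simp: I_def)
    then have "a \<odot>\<^bsub>M\<^esub> x \<oplus>\<^bsub>M\<^esub> v \<in> N m" using mono m by blast
    then have "y \<ominus>\<^bsub>M\<^esub> (a \<odot>\<^bsub>M\<^esub> x \<oplus>\<^bsub>M\<^esub> v) \<in> N m" using y submodule_diff[OF sub] by blast
    moreover have "y \<ominus>\<^bsub>M\<^esub> (a \<odot>\<^bsub>M\<^esub> x \<oplus>\<^bsub>M\<^esub> v) = u \<ominus>\<^bsub>M\<^esub> v"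
    proof -
      have "a \<odot>\<^bsub>M\<^esub> x \<in> carrier M" "u \<in> carrier M" "v \<in> carrier M" using au v U' x by auto
      then show ?thesis unfolding au(3) by (simp add: a_minus_def M.minus_add M.a_ac M.r_neg M.r_neg1 M.r_neg2)
    qed
    ultimately have "u \<ominus>\<^bsub>M\<^esub> v \<in> N m \<inter> U" using submodule_diff[OF U(1)] au v by simp
    then have "u \<ominus>\<^bsub>M\<^esub> v \<in> N ?k" using k2[of m] k2[of ?k] m by auto
    then have "(a \<odot>\<^bsub>M\<^esub> x \<oplus>\<^bsub>M\<^esub> v) \<oplus>\<^bsub>M\<^esub> (u \<ominus>\<^bsub>M\<^esub> v) \<in> N ?k" using v submodule_add[OF sub] by blast
    moreover have "(a \<odot>\<^bsub>M\<^esub> x \<oplus>\<^bsub>M\<^esub> v) \<oplus>\<^bsub>M\<^esub> (u \<ominus>\<^bsub>M\<^esub> v) = y"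
    proof -
      have "a \<odot>\<^bsub>M\<^esub> x \<in> carrier M" "u \<in> carrier M" "v \<in> carrier M" using au v U' x by auto
      then show ?thesis unfolding au(3) by (simp add: a_minus_def M.a_ac M.r_neg M.r_neg1 M.r_neg2)
    qed
    ultimately show "y \<in> N ?k" by simp
  qed
  then show "\<exists>k. \<forall>m\<ge>k. N m = N k" using mono by (intro exI[of _ ?k]) blast
qed

text \<open>The generators are adjoined one at a time to the zero submodule; the submodule reached
  at the end contains all of them and so equals \<open>M\<close>.\<close>

lemma acc_fin_gen:
  assumes reg: "acc {I. submodule I A (regular_module A)}" and fg: "fin_gen_module A M"
  shows "acc {N. submodule N A M}"
proof -
  obtain S where S: "S \<subseteq> carrier M" "finite S" "\<And>N. submodule N A M \<Longrightarrow> S \<subseteq> N \<Longrightarrow> N = carrier M"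
    using fg unfolding fin_gen_module_def by metis
  have "\<exists>U. submodule U A M \<and> S \<subseteq> U \<and> acc {N. submodule N A M \<and> N \<subseteq> U}"
    using S(2,1)
  proof (induction S)
    case empty
    have "acc {N. submodule N A M \<and> N \<subseteq> {\<zero>\<^bsub>M\<^esub>}}"
      unfolding acc_def
    proof (intro allI impI exI[of _ 0])
      fix N :: "nat \<Rightarrow> _" and m :: nat
      assume "\<forall>k. N k \<in> {N. submodule N A M \<and> N \<subseteq> {\<zero>\<^bsub>M\<^esub>}} \<and> N k \<subseteq> N (Suc k)"
      then have "N k = {\<zero>\<^bsub>M\<^esub>}" for k using submodule_zero[of "N k"] by blast
      then show "N m = N 0" by simp
    qed
    then show ?case using submodule_trivial by blast
  next
    case (insert x S)
    then obtain U where U: "submodule U A M" "S \<subseteq> U" "acc {N. submodule N A M \<and> N \<subseteq> U}" by auto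
    have x: "x \<in> carrier M" using insert by simp
    show ?case
      using submodule_adjoin[OF U(1) x] acc_adjoin[OF reg U(1,3) x] U(2)
      by (intro exI[of _ "{a \<odot>\<^bsub>M\<^esub> x \<oplus>\<^bsub>M\<^esub> u | a u. a \<in> carrier A \<and> u \<in> U}"]) blast
  qed
  then obtain U where U: "submodule U A M" "S \<subseteq> U" "acc {N. submodule N A M \<and> N \<subseteq> U}" by blast
  have "U = carrier M" by (rule S(3)) (use U in auto)
  then show ?thesis
    by (intro acc_subset[OF U(3)]) (use submodule_subset in blast)
qed

end

section \<open>Homomorphisms and dual bases\<close>

lemma regular_module_simps [simp]:
  "carrier (regular_module A) = carrier A" "\<zero>\<^bsub>regular_module A\<^esub> = \<zero>\<^bsub>A\<^esub>"
  "x \<oplus>\<^bsub>regular_module A\<^esub> y = x \<oplus>\<^bsub>A\<^esub> y" "x \<odot>\<^bsub>regular_module A\<^esub> y = x \<otimes>\<^bsub>A\<^esub> y"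
  by (simp_all add: regular_module_def)

context left_module
begin

lemma submodule_minus:
  assumes N: "submodule N A M" and xy: "x \<in> N" "y \<in> N"
  shows "\<ominus>\<^bsub>M\<lparr>carrier := N\<rparr>\<^esub> x = \<ominus>\<^bsub>M\<^esub> x" "x \<ominus>\<^bsub>M\<lparr>carrier := N\<rparr>\<^esub> y = x \<ominus>\<^bsub>M\<^esub> y"
proof -
  interpret N: left_module A "M\<lparr>carrier := N\<rparr>" by (rule submodule_left_module[OF N])
  have *: "\<ominus>\<^bsub>M\<lparr>carrier := N\<rparr>\<^esub> z = \<ominus>\<^bsub>M\<^esub> z" if "z \<in> N" for z
    by (rule N.M.minus_equality)
      (use that submodule_closed[OF N that] submodule_neg[OF N that] in \<open>auto simp: M.l_neg\<close>)
  then show "\<ominus>\<^bsub>M\<lparr>carrier := N\<rparr>\<^esub> x = \<ominus>\<^bsub>M\<^esub> x" "x \<ominus>\<^bsub>M\<lparr>carrier := N\<rparr>\<^esub> y = x \<ominus>\<^bsub>M\<^esub> y"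
    using xy by (simp_all add: a_minus_def)
qed

lemma submodule_finsum_eq:
  assumes N: "submodule N A M" and "finite S" "\<And>i. i \<in> S \<Longrightarrow> v i \<in> N"
  shows "(\<Oplus>\<^bsub>M\<lparr>carrier := N\<rparr>\<^esub>i\<in>S. v i) = (\<Oplus>\<^bsub>M\<^esub>i\<in>S. v i)"
proof -
  interpret N: left_module A "M\<lparr>carrier := N\<rparr>" by (rule submodule_left_module[OF N])
  show ?thesis
    using assms(2,3)
  proof (induction S)
    case (insert i S)
    have "v \<in> S \<rightarrow> carrier (M\<lparr>carrier := N\<rparr>)" "v i \<in> carrier (M\<lparr>carrier := N\<rparr>)"
      "v \<in> S \<rightarrow> carrier M" "v i \<in> carrier M"
      using insert.prems submodule_closed[OF N] by auto
    then show ?case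
      using insert by (simp add: N.M.finsum_insert M.finsum_insert del: Pi_split_insert_domain)
  qed simp
qed

lemma submodule_submodule:
  assumes N: "submodule N A M"
  shows "submodule U A (M\<lparr>carrier := N\<rparr>) \<longleftrightarrow> submodule U A M \<and> U \<subseteq> N"
proof -
  interpret N: left_module A "M\<lparr>carrier := N\<rparr>" by (rule submodule_left_module[OF N])
  show ?thesis
  proof (intro iffI conjI)
    assume U: "submodule U A (M\<lparr>carrier := N\<rparr>)"
    show UN: "U \<subseteq> N" using N.submodule_subset[OF U] by simp
    show "submodule U A M"
      using N.submodule_zero[OF U] N.submodule_add[OF U] N.submodule_smult[OF U] UN
        submodule_subset[OF N] by (intro submoduleI) auto
  next
    assume U: "submodule U A M \<and> U \<subseteq> N"
    then show "submodule U A (M\<lparr>carrier := N\<rparr>)"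
      by (intro N.submoduleI) (auto intro: submodule_zero submodule_add submodule_smult)
  qed
qed

end

context ring
begin

lemma regular_minus [simp]:
  assumes "x \<in> carrier R" shows "\<ominus>\<^bsub>regular_module R\<^esub> x = \<ominus> x"
proof -
  interpret M: left_module R "regular_module R" by (rule regular_left_module)
  show ?thesis by (rule M.M.minus_equality) (use assms in \<open>auto simp: l_neg\<close>)
qed

lemma regular_diff [simp]:
  assumes "y \<in> carrier R" shows "x \<ominus>\<^bsub>regular_module R\<^esub> y = x \<ominus> y"
  using assms by (simp add: a_minus_def)

lemma regular_finsum [simp]:
  assumes "finite S" "\<And>i. i \<in> S \<Longrightarrow> v i \<in> carrier R"
  shows "(\<Oplus>\<^bsub>regular_module R\<^esub>i\<in>S. v i) = (\<Oplus>i\<in>S. v i)"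
proof -
  interpret M: left_module R "regular_module R" by (rule regular_left_module)
  show ?thesis
    using assms
  proof (induction S)
    case (insert i S)
    have "v \<in> S \<rightarrow> carrier (regular_module R)" "v \<in> S \<rightarrow> carrier R" "v i \<in> carrier R"
      using insert.prems by auto
    then show ?case
      using insert by (simp add: M.M.finsum_insert finsum_insert del: Pi_split_insert_domain)
  qed simp
qed

end

lemma mod_hom_diff:
  assumes "left_module A M" "left_module A N" "f \<in> mod_hom A M N" "x \<in> carrier M" "y \<in> carrier M"
  shows "f (x \<ominus>\<^bsub>M\<^esub> y) = f x \<ominus>\<^bsub>N\<^esub> f y"
proof -
  interpret M: left_module A M by fact
  interpret N: left_module A N by fact
  note f = mod_homD[OF assms(3)]
  have "f (\<ominus>\<^bsub>M\<^esub> y) \<oplus>\<^bsub>N\<^esub> f y = \<zero>\<^bsub>N\<^esub>"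
    using assms(4,5) f(2)[of "\<ominus>\<^bsub>M\<^esub> y" y, symmetric] mod_hom_zero[OF assms(1-3)] by (simp add: M.M.l_neg)
  then have "f (\<ominus>\<^bsub>M\<^esub> y) = \<ominus>\<^bsub>N\<^esub> f y"
    using assms(4,5) f(1) N.M.minus_equality by simp
  then show ?thesis using assms(4,5) f by (simp add: a_minus_def)
qed

lemma mod_hom_sub:
  assumes "left_module A M" "left_module A N" "f \<in> mod_hom A M N" "g \<in> mod_hom A M N"
  shows "(\<lambda>x\<in>carrier M. f x \<ominus>\<^bsub>N\<^esub> g x) \<in> mod_hom A M N"
proof -
  interpret M: left_module A M by fact
  interpret N: left_module A N by fact
  note f = mod_homD[OF assms(3)] and g = mod_homD[OF assms(4)]
  show ?thesis
    by (rule mod_homI)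
      (use f g in \<open>auto simp: N.lsmult_diff_r a_minus_def N.M.minus_add N.M.a_ac N.lsmult_r_distr N.lsmult_minus_r\<close>)
qed

lemma submodule_vimage:
  assumes "left_module A M" "left_module A N" "f \<in> mod_hom A M N" "submodule U A N"
  shows "submodule {x \<in> carrier M. f x \<in> U} A M"
proof -
  interpret M: left_module A M by fact
  interpret N: left_module A N by fact
  note f = mod_homD[OF assms(3)]
  show ?thesis
    by (rule M.submoduleI)
      (use f mod_hom_zero[OF assms(1-3)] N.submodule_zero[OF assms(4)] N.submodule_add[OF assms(4)]
        N.submodule_smult[OF assms(4)] in auto)
qed

lemma submodule_mod_ker:
  assumes "left_module A M" "left_module A N" "f \<in> mod_hom A M N"
  shows "submodule (mod_ker M N f) A M"
proof -
  interpret N: left_module A N by fact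
  show ?thesis using submodule_vimage[OF assms N.submodule_trivial] by (simp add: mod_ker_def)
qed

text \<open>Such data exist exactly for finitely generated projective modules. In contrast to the
  lifting property, they involve only \<open>M\<close> and the regular module, so they pass to
  summands without any quantification over test modules of some fixed element type.\<close>

definition dual_basis ::
  "('a, 'b) ring_scheme \<Rightarrow> ('a, 'm) module \<Rightarrow> nat \<Rightarrow> (nat \<Rightarrow> 'm) \<Rightarrow> (nat \<Rightarrow> 'm \<Rightarrow> 'a) \<Rightarrow> bool" where
  "dual_basis A M n u s \<longleftrightarrow>
    (\<forall>i<n. u i \<in> carrier M \<and> s i \<in> mod_hom A M (regular_module A)) \<and>
    (\<forall>x\<in>carrier M. x = (\<Oplus>\<^bsub>M\<^esub>i\<in>{..<n}. s i x \<odot>\<^bsub>M\<^esub> u i))"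

text \<open>Any choice of values \<open>v i\<close> gives a homomorphism. It need not send the
  \<open>i\<close>-th generator of a dual basis to \<open>v i\<close>, since the generators may
  satisfy relations.\<close>

lemma coordinate_hom:
  assumes M: "left_module A M" and N: "left_module A N"
    and s: "\<And>i. i < n \<Longrightarrow> s i \<in> mod_hom A M (regular_module A)"
    and v: "\<And>i. i < n \<Longrightarrow> v i \<in> carrier N"
  shows "(\<lambda>x\<in>carrier M. \<Oplus>\<^bsub>N\<^esub>i\<in>{..<n::nat}. s i x \<odot>\<^bsub>N\<^esub> v i) \<in> mod_hom A M N"
    (is "?f \<in> _")
proof -
  interpret M: left_module A M by fact
  interpret N: left_module A N by fact
  have sc: "s i x \<in> carrier A" if "i < n" "x \<in> carrier M" for i x
    using mod_homD(1)[OF s[OF that(1)] that(2)] by simp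
  have cl: "(\<lambda>i. s i x \<odot>\<^bsub>N\<^esub> v i) \<in> {..<n} \<rightarrow> carrier N" if "x \<in> carrier M" for x
    using sc v that by auto
  show ?thesis
  proof (rule mod_homI)
    fix x assume x: "x \<in> carrier M"
    then show "?f x \<in> carrier N"
      using N.M.finsum_closed[OF cl] by simp
  next
    fix x y assume x: "x \<in> carrier M" and y: "y \<in> carrier M"
    have "(\<Oplus>\<^bsub>N\<^esub>i\<in>{..<n}. s i (x \<oplus>\<^bsub>M\<^esub> y) \<odot>\<^bsub>N\<^esub> v i) =
        (\<Oplus>\<^bsub>N\<^esub>i\<in>{..<n}. s i x \<odot>\<^bsub>N\<^esub> v i \<oplus>\<^bsub>N\<^esub> s i y \<odot>\<^bsub>N\<^esub> v i)"
      by (rule N.M.add.finprod_cong')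
        (use x y sc v mod_homD(2)[OF s] in \<open>auto simp: N.lsmult_l_distr\<close>)
    also have "\<dots> = (\<Oplus>\<^bsub>N\<^esub>i\<in>{..<n}. s i x \<odot>\<^bsub>N\<^esub> v i) \<oplus>\<^bsub>N\<^esub> (\<Oplus>\<^bsub>N\<^esub>i\<in>{..<n}. s i y \<odot>\<^bsub>N\<^esub> v i)"
      by (rule N.M.finsum_addf) (use cl x y in auto)
    finally show "?f (x \<oplus>\<^bsub>M\<^esub> y) =
        ?f x \<oplus>\<^bsub>N\<^esub>
        ?f y"
      using x y by simp
  next
    fix a x assume a: "a \<in> carrier A" and x: "x \<in> carrier M"
    have "(\<Oplus>\<^bsub>N\<^esub>i\<in>{..<n}. s i (a \<odot>\<^bsub>M\<^esub> x) \<odot>\<^bsub>N\<^esub> v i) =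
        (\<Oplus>\<^bsub>N\<^esub>i\<in>{..<n}. a \<odot>\<^bsub>N\<^esub> (s i x \<odot>\<^bsub>N\<^esub> v i))"
      by (rule N.M.add.finprod_cong')
        (use a x sc v mod_homD(3)[OF s] in \<open>auto simp: N.lsmult_assoc\<close>)
    also have "\<dots> = a \<odot>\<^bsub>N\<^esub> (\<Oplus>\<^bsub>N\<^esub>i\<in>{..<n}. s i x \<odot>\<^bsub>N\<^esub> v i)"
      by (rule N.lsmult_finsum[symmetric]) (use a x sc v in auto)
    finally show "?f (a \<odot>\<^bsub>M\<^esub> x) =
        a \<odot>\<^bsub>N\<^esub> ?f x"
      using a x by simp
  qed simp
qed

lemma dual_basis_hom_eq:
  assumes M: "left_module A M" and N: "left_module A N" and b: "dual_basis A M n u s"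
    and h: "h \<in> mod_hom A M N" and x: "x \<in> carrier M"
  shows "h x = (\<Oplus>\<^bsub>N\<^esub>i\<in>{..<n}. s i x \<odot>\<^bsub>N\<^esub> h (u i))"
proof -
  interpret M: left_module A M by fact
  interpret N: left_module A N by fact
  have sc: "s i x \<in> carrier A" "u i \<in> carrier M" if "i < n" for i
    using b that mod_homD(1)[of "s i" A M "regular_module A" x] x by (auto simp: dual_basis_def)
  have "h x = h (\<Oplus>\<^bsub>M\<^esub>i\<in>{..<n}. s i x \<odot>\<^bsub>M\<^esub> u i)"
    using b x by (simp add: dual_basis_def)
  also have "\<dots> = (\<Oplus>\<^bsub>N\<^esub>i\<in>{..<n}. h (s i x \<odot>\<^bsub>M\<^esub> u i))"
    by (rule mod_hom_finsum[OF M N h]) (use sc in auto)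
  also have "\<dots> = (\<Oplus>\<^bsub>N\<^esub>i\<in>{..<n}. s i x \<odot>\<^bsub>N\<^esub> h (u i))"
    by (rule N.M.add.finprod_cong') (use sc mod_homD[OF h] in auto)
  finally show ?thesis .
qed

section \<open>Splitting off direct summands contained in a submodule\<close>

context left_module
begin

text \<open>A summand contained in \<open>K\<close> is the kernel of an idempotent \<open>g\<close>
  with all \<open>x - g x\<close> in \<open>K\<close>, and \<open>g\<close> is chosen with maximal
  kernel. The last conclusion then says that the complement, the image of \<open>g\<close>, has no
  nonzero summand inside \<open>K\<close>.\<close>

lemma split_off_maximal_summand:
  assumes acc: "acc {N. submodule N A M}" and K: "submodule K A M"
  obtains g where "g \<in> mod_hom A M M"
    and "\<And>x. x \<in> carrier M \<Longrightarrow> g (g x) = g x"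
    and "\<And>x. x \<in> carrier M \<Longrightarrow> x \<ominus>\<^bsub>M\<^esub> g x \<in> K"
    and "\<And>h x. h \<in> mod_hom A M M \<Longrightarrow> (\<And>x. x \<in> carrier M \<Longrightarrow> h (h x) = h x) \<Longrightarrow>
      (\<And>x. x \<in> carrier M \<Longrightarrow> g (h x) = h x) \<Longrightarrow> (\<And>x. x \<in> carrier M \<Longrightarrow> h x \<in> K) \<Longrightarrow>
      x \<in> carrier M \<Longrightarrow> h x = \<zero>\<^bsub>M\<^esub>"
proof -
  have M: "left_module A M" by (rule left_module_axioms)
  define G where "G = {g \<in> mod_hom A M M. \<forall>x\<in>carrier M. g (g x) = g x \<and> x \<ominus>\<^bsub>M\<^esub> g x \<in> K}"
  let ?T = "mod_ker M M ` G"
  have T: "?T \<subseteq> {N. submodule N A M}"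
    using submodule_mod_ker[OF M M] by (auto simp: G_def)
  have "(\<lambda>x\<in>carrier M. x) \<in> G"
    using submodule_zero[OF K] by (auto simp: G_def a_minus_def M.r_neg intro!: mod_homI)
  then have "mod_ker M M (\<lambda>x\<in>carrier M. x) \<in> ?T" by blast
  then show thesis
  proof (rule acc_maximal[OF acc T])
    fix Y assume Y: "Y \<in> ?T" and max: "\<And>Z. Z \<in> ?T \<Longrightarrow> Y \<subseteq> Z \<Longrightarrow> Z = Y"
    obtain g where gG: "g \<in> G" and Yg: "Y = mod_ker M M g" using Y by blast
    have g: "g \<in> mod_hom A M M" and gg: "\<And>x. x \<in> carrier M \<Longrightarrow> g (g x) = g x"
      and gK: "\<And>x. x \<in> carrier M \<Longrightarrow> x \<ominus>\<^bsub>M\<^esub> g x \<in> K" using gG by (auto simp: G_def)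
    note [simp] = mod_homD(1)[OF g] gg
    have *: "h x = \<zero>\<^bsub>M\<^esub>" if h: "h \<in> mod_hom A M M" "\<And>x. x \<in> carrier M \<Longrightarrow> h (h x) = h x"
      "\<And>x. x \<in> carrier M \<Longrightarrow> g (h x) = h x" "\<And>x. x \<in> carrier M \<Longrightarrow> h x \<in> K"
      and x: "x \<in> carrier M" for h x
    proof -
      note [simp] = mod_homD(1)[OF h(1)] h(2,3)
      \<comment> \<open>The map \<open>g - h g\<close> splits off the image of \<open>h\<close> as
        well: it is idempotent because \<open>g\<close> fixes its values and \<open>h\<close> kills
        them, and its kernel contains both the kernel of \<open>g\<close> and the image of
        \<open>h\<close>.\<close>
      define f where "f = (\<lambda>x\<in>carrier M. g x \<ominus>\<^bsub>M\<^esub> h (g x))"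
      have f: "f y = g y \<ominus>\<^bsub>M\<^esub> h (g y)" if "y \<in> carrier M" for y using that by (simp add: f_def)
      have "compose (carrier M) h g \<in> mod_hom A M M" by (rule mod_hom_compose[OF M g h(1)])
      from mod_hom_sub[OF M M g this] have fhom: "f \<in> mod_hom A M M"
        unfolding f_def by (simp add: compose_def cong: restrict_cong)
      have "f \<in> G"
        unfolding G_def
      proof (intro CollectI conjI ballI fhom)
        fix y assume y: "y \<in> carrier M"
        have "g (f y) = f y" using y by (simp add: f mod_hom_diff[OF M M g])
        moreover have "h (f y) = \<zero>\<^bsub>M\<^esub>"
          using y by (simp add: f mod_hom_diff[OF M M h(1)]) (simp add: a_minus_def M.r_neg)
        moreover have "f y \<in> carrier M" using y by (simp add: f)
        ultimately show "f (f y) = f y" using f[of "f y"] by (simp add: a_minus_def)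
        have "y \<ominus>\<^bsub>M\<^esub> f y = (y \<ominus>\<^bsub>M\<^esub> g y) \<oplus>\<^bsub>M\<^esub> h (g y)"
          using y by (simp add: f a_minus_def M.minus_add M.a_ac)
        then show "y \<ominus>\<^bsub>M\<^esub> f y \<in> K" using submodule_add[OF K gK[OF y] h(4)] y by simp
      qed
      moreover have "mod_ker M M g \<subseteq> mod_ker M M f"
        using mod_hom_zero[OF M M h(1)] by (auto simp: mod_ker_def f a_minus_def)
      ultimately have "mod_ker M M f = mod_ker M M g" using max Yg by blast
      moreover have "h x \<in> mod_ker M M f"
        using x by (simp add: mod_ker_def f a_minus_def M.r_neg)
      ultimately show "h x = \<zero>\<^bsub>M\<^esub>" using x by (simp add: mod_ker_def)
    qed
    show thesis by (rule that[OF g gg gK], assumption, assumption, fact *)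
  qed
qed

end

text \<open>
  Modulo the ideal \<open>I\<close>, the left ideal generated by the idempotent \<open>e\<close> is a projective cover of
  \<open>A / N\<close>: every element of \<open>A e\<close> outside \<open>N\<close> generates \<open>A e\<close>.
\<close>

definition local_lift :: "('a, 'b) ring_scheme \<Rightarrow> 'a set \<Rightarrow> 'a set \<Rightarrow> bool" where
  "local_lift A I N \<longleftrightarrow> (\<exists>e\<in>carrier A. e \<otimes>\<^bsub>A\<^esub> e \<ominus>\<^bsub>A\<^esub> e \<in> I \<and> \<one>\<^bsub>A\<^esub> \<ominus>\<^bsub>A\<^esub> e \<in> N \<and>
    (\<forall>x\<in>carrier A. x \<otimes>\<^bsub>A\<^esub> e \<notin> N \<longrightarrow> (\<exists>y\<in>carrier A. y \<otimes>\<^bsub>A\<^esub> (x \<otimes>\<^bsub>A\<^esub> e) \<ominus>\<^bsub>A\<^esub> e \<in> I)))"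

context left_module
begin

lemma smult_hom:
  assumes "v \<in> carrier M" shows "(\<lambda>a\<in>carrier A. a \<odot>\<^bsub>M\<^esub> v) \<in> mod_hom A (regular_module A) M"
  by (rule mod_homI) (use assms in \<open>auto simp: lsmult_l_distr lsmult_assoc\<close>)

text \<open>Via \<open>a \<mapsto> a x\<close>, the quotient of \<open>A\<close> by this left ideal
  is isomorphic to \<open>M / N\<close>. Thus each simple quotient of \<open>M\<close> becomes a
  simple quotient of \<open>A\<close>, the only kind that \<open>local_lift\<close> speaks
  about.\<close>

lemma submodule_annihilator_mod:
  assumes N: "maximal_submodule A M N" and x: "x \<in> carrier M" "x \<notin> N"
  shows "maximal_submodule A (regular_module A) {a \<in> carrier A. a \<odot>\<^bsub>M\<^esub> x \<in> N}"
    (is "maximal_submodule A _ ?N")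
proof -
  interpret R: left_module A "regular_module A" by (rule A.regular_left_module)
  have sN: "submodule N A M" using N by (simp add: maximal_submodule_def)
  have "submodule {a \<in> carrier (regular_module A). (\<lambda>a\<in>carrier A. a \<odot>\<^bsub>M\<^esub> x) a \<in> N} A (regular_module A)"
    by (rule submodule_vimage[OF R.left_module_axioms left_module_axioms smult_hom[OF x(1)] sN])
  moreover have "{a \<in> carrier (regular_module A). (\<lambda>a\<in>carrier A. a \<odot>\<^bsub>M\<^esub> x) a \<in> N} = ?N" by auto
  ultimately have sub: "submodule ?N A (regular_module A)" by simp
  have one: "\<one> \<notin> ?N" using x by simp
  have "V = carrier A" if V: "submodule V A (regular_module A)" "?N \<subseteq> V" "V \<noteq> ?N" for V
  proof -
    note V' = R.submodule_closed[OF V(1)]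
    obtain b where b: "b \<in> V" "b \<notin> ?N" using V(2,3) by blast
    have bA: "b \<in> carrier A" using V'[OF b(1)] by simp
    then have "b \<odot>\<^bsub>M\<^esub> x \<in> carrier M" "b \<odot>\<^bsub>M\<^esub> x \<notin> N" using b(2) x by auto
    then obtain a n where an: "a \<in> carrier A" "n \<in> N" "x = a \<odot>\<^bsub>M\<^esub> (b \<odot>\<^bsub>M\<^esub> x) \<oplus>\<^bsub>M\<^esub> n"
      using maximal_submodule_reach[OF N _ _ x(1)] by metis
    have ab: "a \<otimes> b \<in> V" using R.submodule_smult[OF V(1) an(1) b(1)] by simp
    have n: "n \<in> carrier M" using submodule_closed[OF sN an(2)] .
    have "(\<one> \<ominus> a \<otimes> b) \<odot>\<^bsub>M\<^esub> x = x \<ominus>\<^bsub>M\<^esub> a \<odot>\<^bsub>M\<^esub> (b \<odot>\<^bsub>M\<^esub> x)"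
      using an(1) bA x by (simp add: lsmult_diff_l lsmult_assoc)
    also have "\<dots> = n"
    proof -
      have c: "a \<odot>\<^bsub>M\<^esub> (b \<odot>\<^bsub>M\<^esub> x) \<in> carrier M" using an(1) bA x by simp
      have "x \<ominus>\<^bsub>M\<^esub> a \<odot>\<^bsub>M\<^esub> (b \<odot>\<^bsub>M\<^esub> x) = (a \<odot>\<^bsub>M\<^esub> (b \<odot>\<^bsub>M\<^esub> x) \<oplus>\<^bsub>M\<^esub> n) \<ominus>\<^bsub>M\<^esub> a \<odot>\<^bsub>M\<^esub> (b \<odot>\<^bsub>M\<^esub> x)"
        using an(3) by simp
      then show ?thesis using c n by (simp add: a_minus_def M.a_ac M.r_neg M.r_neg1 M.r_neg2)
    qed
    finally have "\<one> \<ominus> a \<otimes> b \<in> ?N" using an(1,2) bA by simp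
    then have "(\<one> \<ominus> a \<otimes> b) \<oplus> a \<otimes> b \<in> V"
      using R.submodule_add[OF V(1) _ ab] V(2) by auto
    moreover have "(\<one> \<ominus> a \<otimes> b) \<oplus> a \<otimes> b = \<one>"
      using an(1) bA by (simp add: a_minus_def A.a_assoc A.l_neg)
    ultimately have "\<one> \<in> V" by simp
    then have "c \<in> V" if "c \<in> carrier A" for c using R.submodule_smult[OF V(1) that] that by fastforce
    then show ?thesis using V' by auto
  qed
  then show ?thesis using sub one unfolding maximal_submodule_def by auto
qed

lemma superfluous_kernel_summand:
  assumes acc: "acc {N. submodule N A M}" and b: "dual_basis A M n u s" and K: "submodule K A M"
    and lift: "\<And>N x. maximal_submodule A M N \<Longrightarrow> \<not> K \<subseteq> N \<Longrightarrow> x \<in> carrier M \<Longrightarrow> x \<notin> N \<Longrightarrow>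
      local_lift A {\<zero>} {a \<in> carrier A. a \<odot>\<^bsub>M\<^esub> x \<in> N}"
  obtains g where "g \<in> mod_hom A M M"
    and "\<And>x. x \<in> carrier M \<Longrightarrow> g (g x) = g x"
    and "\<And>x. x \<in> carrier M \<Longrightarrow> x \<ominus>\<^bsub>M\<^esub> g x \<in> K"
    and "\<And>U x. submodule U A M \<Longrightarrow>
      (\<And>x. x \<in> carrier M \<Longrightarrow> \<exists>v\<in>U. g v = v \<and> g x \<ominus>\<^bsub>M\<^esub> v \<in> K) \<Longrightarrow> x \<in> carrier M \<Longrightarrow> g x \<in> U"
proof -
  interpret R: left_module A "regular_module A" by (rule A.regular_left_module)
  note M = left_module_axioms and RM = R.left_module_axioms
  obtain g where g: "g \<in> mod_hom A M M"
    and gg: "\<And>x. x \<in> carrier M \<Longrightarrow> g (g x) = g x"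
    and gK: "\<And>x. x \<in> carrier M \<Longrightarrow> x \<ominus>\<^bsub>M\<^esub> g x \<in> K"
    and min: "\<And>h x. h \<in> mod_hom A M M \<Longrightarrow> (\<And>x. x \<in> carrier M \<Longrightarrow> h (h x) = h x) \<Longrightarrow>
      (\<And>x. x \<in> carrier M \<Longrightarrow> g (h x) = h x) \<Longrightarrow> (\<And>x. x \<in> carrier M \<Longrightarrow> h x \<in> K) \<Longrightarrow>
      x \<in> carrier M \<Longrightarrow> h x = \<zero>\<^bsub>M\<^esub>"
    using split_off_maximal_summand[OF acc K] by blast
  note gc = mod_homD(1)[OF g]
  have *: "g x \<in> U" if U: "submodule U A M"
    and H: "\<And>x. x \<in> carrier M \<Longrightarrow> \<exists>v\<in>U. g v = v \<and> g x \<ominus>\<^bsub>M\<^esub> v \<in> K" and x: "x \<in> carrier M" for U x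
  proof (rule ccontr)
    assume "g x \<notin> U"
    \<comment> \<open>This preimage contains the kernel of \<open>g\<close>, so a maximal submodule
      above it is determined by its part in the image of \<open>g\<close>.\<close>
    let ?U = "{w \<in> carrier M. g w \<in> U}"
    have "?U \<noteq> carrier M" using \<open>g x \<notin> U\<close> x by blast
    then obtain N where N: "maximal_submodule A M N" and UN: "?U \<subseteq> N"
      by (rule maximal_submodule_exists[OF acc submodule_vimage[OF M M g U]])
    have sN: "submodule N A M" and Nne: "N \<noteq> carrier M" using N by (auto simp: maximal_submodule_def)
    \<comment> \<open>Otherwise each \<open>w\<close> is the sum of \<open>w - g w\<close>,
      \<open>g w - v\<close> and \<open>v\<close>, all of which lie in \<open>N\<close>.\<close>
    have "\<exists>z\<in>K. g z = z \<and> z \<notin> N"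
    proof (rule ccontr)
      assume no: "\<not> ?thesis"
      have "w \<in> N" if w: "w \<in> carrier M" for w
      proof -
        obtain v where v: "v \<in> U" "g v = v" "g w \<ominus>\<^bsub>M\<^esub> v \<in> K" using H[OF w] by blast
        have vM: "v \<in> carrier M" using submodule_closed[OF U v(1)] .
        have "g (g w \<ominus>\<^bsub>M\<^esub> v) = g w \<ominus>\<^bsub>M\<^esub> v"
          using mod_hom_diff[OF M M g gc[OF w] vM] gg[OF w] v(2) by simp
        then have 1: "g w \<ominus>\<^bsub>M\<^esub> v \<in> N" using no v(3) by blast
        have 2: "v \<in> N" using UN v vM by auto
        have "g (w \<ominus>\<^bsub>M\<^esub> g w) = \<zero>\<^bsub>M\<^esub>"
          using mod_hom_diff[OF M M g w gc[OF w]] gg[OF w] gc[OF w] by (simp add: a_minus_def M.r_neg)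
        then have 3: "w \<ominus>\<^bsub>M\<^esub> g w \<in> N" using UN w gc[OF w] submodule_zero[OF U] by auto
        have "(w \<ominus>\<^bsub>M\<^esub> g w) \<oplus>\<^bsub>M\<^esub> ((g w \<ominus>\<^bsub>M\<^esub> v) \<oplus>\<^bsub>M\<^esub> v) = w"
          using w vM gc[OF w] by (simp add: a_minus_def M.a_assoc M.l_neg M.r_neg1)
        then show "w \<in> N" using submodule_add[OF sN 3 submodule_add[OF sN 1 2]] by simp
      qed
      then show False using Nne submodule_subset[OF sN] by blast
    qed
    then obtain z where z: "z \<in> K" "g z = z" "z \<notin> N" by blast
    have zM: "z \<in> carrier M" using submodule_closed[OF K z(1)] .
    have "local_lift A {\<zero>} {a \<in> carrier A. a \<odot>\<^bsub>M\<^esub> z \<in> N}"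
      using lift[OF N _ zM z(3)] z by blast
    then obtain e where e: "e \<in> carrier A" "e \<otimes> e \<ominus> e \<in> {\<zero>}" "(\<one> \<ominus> e) \<odot>\<^bsub>M\<^esub> z \<in> N"
      and eloc: "\<And>x. x \<in> carrier A \<Longrightarrow> (x \<otimes> e) \<odot>\<^bsub>M\<^esub> z \<notin> N \<Longrightarrow>
        \<exists>y\<in>carrier A. y \<otimes> (x \<otimes> e) \<ominus> e \<in> {\<zero>}"
      unfolding local_lift_def by auto
    have ee: "e \<otimes> e = e" using e(1,2) by (simp add: A.r_right_minus_eq)
    have "\<forall>i. \<exists>a m. i < n \<longrightarrow> a \<in> carrier A \<and> m \<in> N \<and> u i = a \<odot>\<^bsub>M\<^esub> z \<oplus>\<^bsub>M\<^esub> m"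
      using b maximal_submodule_reach[OF N zM z(3)] unfolding dual_basis_def by metis
    then obtain c m where cm: "\<And>i. i < n \<Longrightarrow> c i \<in> carrier A" "\<And>i. i < n \<Longrightarrow> m i \<in> N"
      "\<And>i. i < n \<Longrightarrow> u i = c i \<odot>\<^bsub>M\<^esub> z \<oplus>\<^bsub>M\<^esub> m i" by metis
    have s: "s i \<in> mod_hom A M (regular_module A)" if "i < n" for i
      using b that by (simp add: dual_basis_def)
    have sc: "s i y \<in> carrier A" if "i < n" "y \<in> carrier M" for i y
      using mod_homD(1)[OF s[OF that(1)] that(2)] by simp
    \<comment> \<open>\<open>h\<close> lifts the projection from \<open>M\<close> to
      \<open>M / N\<close> through \<open>a \<mapsto> a z\<close>: modulo \<open>N\<close>, each
      \<open>y\<close> agrees with \<open>h y\<close> times \<open>z\<close>. The coefficients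
      \<open>c i\<close> express the generators \<open>u i\<close> in this way.\<close>
    define h where "h = (\<lambda>x\<in>carrier M. \<Oplus>\<^bsub>regular_module A\<^esub>i\<in>{..<n}. s i x \<odot>\<^bsub>regular_module A\<^esub> c i)"
    have h: "h \<in> mod_hom A M (regular_module A)"
      unfolding h_def by (rule coordinate_hom[OF M RM s]) (use cm in auto)
    have hc: "h y \<in> carrier A" if "y \<in> carrier M" for y using mod_homD(1)[OF h that] by simp
    have hz: "\<exists>m\<in>N. y = h y \<odot>\<^bsub>M\<^esub> z \<oplus>\<^bsub>M\<^esub> m" if y: "y \<in> carrier M" for y
    proof
      let ?m = "\<Oplus>\<^bsub>M\<^esub>i\<in>{..<n}. s i y \<odot>\<^bsub>M\<^esub> m i"
      show "?m \<in> N" by (rule submodule_finsum[OF sN]) (use submodule_smult[OF sN] sc[OF _ y] cm in auto)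
      have mM: "m i \<in> carrier M" if "i < n" for i using submodule_closed[OF sN cm(2)[OF that]] .
      have "y = (\<Oplus>\<^bsub>M\<^esub>i\<in>{..<n}. s i y \<odot>\<^bsub>M\<^esub> u i)" using b y by (simp add: dual_basis_def)
      also have "\<dots> = (\<Oplus>\<^bsub>M\<^esub>i\<in>{..<n}. s i y \<odot>\<^bsub>M\<^esub> (c i \<odot>\<^bsub>M\<^esub> z) \<oplus>\<^bsub>M\<^esub> s i y \<odot>\<^bsub>M\<^esub> m i)"
        by (rule M.add.finprod_cong') (use sc[OF _ y] cm mM zM in \<open>auto simp: lsmult_r_distr\<close>)
      also have "\<dots> = (\<Oplus>\<^bsub>M\<^esub>i\<in>{..<n}. s i y \<odot>\<^bsub>M\<^esub> (c i \<odot>\<^bsub>M\<^esub> z)) \<oplus>\<^bsub>M\<^esub> ?m"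
        by (rule M.finsum_addf) (use sc[OF _ y] cm mM zM in auto)
      also have "(\<Oplus>\<^bsub>M\<^esub>i\<in>{..<n}. s i y \<odot>\<^bsub>M\<^esub> (c i \<odot>\<^bsub>M\<^esub> z)) = (\<lambda>a\<in>carrier A. a \<odot>\<^bsub>M\<^esub> z) (h y)"
      proof -
        have "(\<lambda>a\<in>carrier A. a \<odot>\<^bsub>M\<^esub> z) (\<Oplus>\<^bsub>regular_module A\<^esub>i\<in>{..<n}. s i y \<otimes> c i) =
            (\<Oplus>\<^bsub>M\<^esub>i\<in>{..<n}. (\<lambda>a\<in>carrier A. a \<odot>\<^bsub>M\<^esub> z) (s i y \<otimes> c i))"
          by (rule mod_hom_finsum[OF RM M smult_hom[OF zM]]) (use sc[OF _ y] cm in auto)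
        also have "\<dots> = (\<Oplus>\<^bsub>M\<^esub>i\<in>{..<n}. s i y \<odot>\<^bsub>M\<^esub> (c i \<odot>\<^bsub>M\<^esub> z))"
          by (rule M.add.finprod_cong') (use sc[OF _ y] cm zM in \<open>auto simp: lsmult_assoc\<close>)
        finally show ?thesis using y by (simp add: h_def)
      qed
      finally show "y = h y \<odot>\<^bsub>M\<^esub> z \<oplus>\<^bsub>M\<^esub> ?m" using hc[OF y] by simp
    qed
    \<comment> \<open>Passing to \<open>e z\<close> keeps the element in \<open>K\<close> and in the
      image of \<open>g\<close>, and outside \<open>N\<close> because \<open>(1 - e) z\<close> lies
      in \<open>N\<close>. Now locality of \<open>A e\<close> can be applied to the coefficient of
      this element.\<close>
    define z' where "z' = e \<odot>\<^bsub>M\<^esub> z"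
    have z'M: "z' \<in> carrier M" using e zM by (simp add: z'_def)
    have z'K: "z' \<in> K" using submodule_smult[OF K e(1) z(1)] by (simp add: z'_def)
    have gz': "g z' = z'" using mod_homD(3)[OF g e(1) zM] z(2) by (simp add: z'_def)
    have z'N: "z' \<notin> N"
    proof
      assume "z' \<in> N"
      then have "(\<one> \<ominus> e) \<odot>\<^bsub>M\<^esub> z \<oplus>\<^bsub>M\<^esub> z' \<in> N" using submodule_add[OF sN e(3)] by blast
      moreover have "(\<one> \<ominus> e) \<odot>\<^bsub>M\<^esub> z \<oplus>\<^bsub>M\<^esub> z' = z"
        using e(1) zM by (simp add: z'_def lsmult_diff_l) (simp add: a_minus_def M.a_assoc M.l_neg)
      ultimately show False using z(3) by simp
    qed
    define a where "a = h z'"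
    have a: "a \<in> carrier A" using hc[OF z'M] by (simp add: a_def)
    have "(a \<otimes> e) \<odot>\<^bsub>M\<^esub> z \<notin> N"
    proof
      assume "(a \<otimes> e) \<odot>\<^bsub>M\<^esub> z \<in> N"
      then have "a \<odot>\<^bsub>M\<^esub> ((\<one> \<ominus> e) \<odot>\<^bsub>M\<^esub> z) \<oplus>\<^bsub>M\<^esub> (a \<otimes> e) \<odot>\<^bsub>M\<^esub> z \<in> N"
        using submodule_add[OF sN submodule_smult[OF sN a e(3)]] by blast
      moreover have "a \<odot>\<^bsub>M\<^esub> ((\<one> \<ominus> e) \<odot>\<^bsub>M\<^esub> z) \<oplus>\<^bsub>M\<^esub> (a \<otimes> e) \<odot>\<^bsub>M\<^esub> z = a \<odot>\<^bsub>M\<^esub> z"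
        using a e(1) zM
        by (simp add: lsmult_diff_l lsmult_diff_r lsmult_assoc) (simp add: a_minus_def M.a_assoc M.l_neg)
      moreover obtain m' where "m' \<in> N" "z' = a \<odot>\<^bsub>M\<^esub> z \<oplus>\<^bsub>M\<^esub> m'" using hz[OF z'M] by (auto simp: a_def)
      ultimately show False using z'N submodule_add[OF sN] by metis
    qed
    from eloc[OF a this] obtain y where y: "y \<in> carrier A" "y \<otimes> (a \<otimes> e) \<ominus> e \<in> {\<zero>}" by blast
    then have yae: "y \<otimes> (a \<otimes> e) = e" using a e(1) by (simp add: A.r_right_minus_eq)
    \<comment> \<open>The factor \<open>y\<close> normalises \<open>h w e = e\<close>. Therefore
      \<open>a e \<mapsto> a e w\<close> embeds \<open>A e\<close> in \<open>M\<close> with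
      retraction \<open>v \<mapsto> h v e\<close>, and \<open>p\<close> is the resulting idempotent,
      with image \<open>A e w\<close> inside \<open>K\<close>.\<close>
    define w where "w = y \<odot>\<^bsub>M\<^esub> z'"
    have wM: "w \<in> carrier M" using y z'M by (simp add: w_def)
    have wK: "w \<in> K" using submodule_smult[OF K y(1) z'K] by (simp add: w_def)
    have gw: "g w = w" using mod_homD(3)[OF g y(1) z'M] gz' by (simp add: w_def)
    have hw: "h w \<otimes> e = e"
      using mod_homD(3)[OF h y(1) z'M] yae y(1) a e(1) by (simp add: w_def a_def[symmetric] A.m_assoc)
    define p where "p = compose (carrier M) (\<lambda>a\<in>carrier A. a \<odot>\<^bsub>M\<^esub> (e \<odot>\<^bsub>M\<^esub> w)) h"
    have p: "p v = (h v \<otimes> e) \<odot>\<^bsub>M\<^esub> w" if "v \<in> carrier M" for v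
      using that hc[OF that] e(1) wM by (simp add: p_def compose_def lsmult_assoc)
    have pp: "p (p v) = p v" if v: "v \<in> carrier M" for v
    proof -
      have "(h (p v)) \<otimes> e = ((h v \<otimes> e) \<otimes> h w) \<otimes> e"
        using p[OF v] mod_homD(3)[OF h _ wM, of "h v \<otimes> e"] hc[OF v] e(1) by simp
      also have "\<dots> = h v \<otimes> e" using hw hc[OF v] hc[OF wM] e(1) ee by (simp add: A.m_assoc)
      finally show ?thesis using p[OF v] p[of "p v"] hc[OF v] e(1) wM by simp
    qed
    have "p w = \<zero>\<^bsub>M\<^esub>"
    proof (rule min[OF _ pp])
      show "p \<in> mod_hom A M M"
        unfolding p_def by (rule mod_hom_compose[OF M h]) (rule smult_hom, use e wM in simp)
      show "g (p v) = p v" if v: "v \<in> carrier M" for v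
        using p[OF v] mod_homD(3)[OF g _ wM, of "h v \<otimes> e"] hc[OF v] e(1) gw by simp
      show "p v \<in> K" if v: "v \<in> carrier M" for v
        using p[OF v] submodule_smult[OF K _ wK] hc[OF v] e(1) by simp
    qed (use wM in auto)
    \<comment> \<open>Applying \<open>h\<close> to \<open>e w = 0\<close> gives
      \<open>e = e e = e (h w e) = 0\<close>, and then \<open>z' = e z\<close> would lie in
      \<open>N\<close>.\<close>
    then have "e \<odot>\<^bsub>M\<^esub> w = \<zero>\<^bsub>M\<^esub>" using p[OF wM] hw by simp
    then have "e \<otimes> h w = \<zero>"
      using mod_homD(3)[OF h e(1) wM] mod_hom_zero[OF M RM h] by simp
    then have "e \<otimes> (h w \<otimes> e) = \<zero>"
      using e(1) hc[OF wM] by (simp add: A.m_assoc[symmetric])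
    then have "e = \<zero>" using hw ee by simp
    then show False using z'N submodule_zero[OF sN] zM by (simp add: z'_def)
  qed
  show thesis by (rule that[OF g gg gK], assumption, assumption, fact *)
qed

end

section \<open>Lifting simple modules along a heredity ideal\<close>

abbreviation left_ideal_mod :: "('a, 'b) ring_scheme \<Rightarrow> 'a set \<Rightarrow> ('a, 'a) module" where
  "left_ideal_mod A L \<equiv> (regular_module A)\<lparr>carrier := L\<rparr>"

abbreviation maximal_left_ideal :: "('a, 'b) ring_scheme \<Rightarrow> 'a set \<Rightarrow> bool" where
  "maximal_left_ideal A \<equiv> maximal_submodule A (regular_module A)"

context ring
begin

lemma left_ideal_diff:
  assumes "submodule L R (regular_module R)" "x \<in> L" "y \<in> L"
  shows "x \<ominus>\<^bsub>left_ideal_mod R L\<^esub> y = x \<ominus> y"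
proof -
  interpret M: left_module R "regular_module R" by (rule regular_left_module)
  show ?thesis using M.submodule_minus(2)[OF assms] M.submodule_closed[OF assms(1,3)] by simp
qed

lemma left_ideal_finsum:
  assumes "submodule L R (regular_module R)" "finite S" "\<And>i. i \<in> S \<Longrightarrow> v i \<in> L"
  shows "(\<Oplus>\<^bsub>left_ideal_mod R L\<^esub>i\<in>S. v i) = (\<Oplus>i\<in>S. v i)"
proof -
  interpret M: left_module R "regular_module R" by (rule regular_left_module)
  have "v i \<in> carrier R" if "i \<in> S" for i
    using M.submodule_closed[OF assms(1) assms(3)[OF that]] by simp
  then show ?thesis using M.submodule_finsum_eq[OF assms] assms(2) by simp
qed

end

text \<open>The hypotheses make the image of \<open>g\<close> a projective cover of
  \<open>L / (L \<inter> N)\<close>, which is \<open>A / N\<close> because \<open>L + N = A\<close>.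
  This image is a summand of \<open>L\<close> but perhaps not of \<open>A\<close>; the task is to
  replace it by an isomorphic left ideal \<open>A e\<close>.\<close>

lemma local_lift_of_summand:
  fixes A (structure)
  assumes A: "ring A" and L: "submodule L A (regular_module A)" and N: "maximal_left_ideal A N"
    and LN: "\<not> L \<subseteq> N" and b: "dual_basis A (left_ideal_mod A L) n u s"
    and g: "g \<in> mod_hom A (left_ideal_mod A L) (left_ideal_mod A L)"
    and gg: "\<And>x. x \<in> L \<Longrightarrow> g (g x) = g x"
    and gN: "\<And>x. x \<in> L \<Longrightarrow> x \<ominus> g x \<in> N"
    and sup: "\<And>U x. submodule U A (left_ideal_mod A L) \<Longrightarrow>
      (\<And>x. x \<in> L \<Longrightarrow> \<exists>v\<in>U. g v = v \<and> g x \<ominus> v \<in> N) \<Longrightarrow> x \<in> L \<Longrightarrow> g x \<in> U"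
  shows "local_lift A {\<zero>} N"
proof -
  let ?M = "left_ideal_mod A L"
  interpret A: ring A by fact
  interpret R: left_module A "regular_module A" by (rule A.regular_left_module)
  interpret L: left_module A "?M" by (rule R.submodule_left_module[OF L])
  note RM = R.left_module_axioms and LM = L.left_module_axioms
  have sN: "submodule N A (regular_module A)" using N by (simp add: maximal_submodule_def)
  have LA: "x \<in> carrier A" if "x \<in> L" for x using R.submodule_closed[OF L that] by simp
  have NA: "x \<in> carrier A" if "x \<in> N" for x using R.submodule_closed[OF sN that] by simp
  have gL: "g x \<in> L" if "x \<in> L" for x using mod_homD(1)[OF g, of x] that by simp
  have gsm: "g (a \<otimes> x) = a \<otimes> g x" if "a \<in> carrier A" "x \<in> L" for a x
    using mod_homD(3)[OF g, of a x] that by simp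
  have Lsm: "a \<otimes> x \<in> L" if "a \<in> carrier A" "x \<in> L" for a x
    using R.submodule_smult[OF L that] by simp
  have Nsm: "a \<otimes> x \<in> N" if "a \<in> carrier A" "x \<in> N" for a x
    using R.submodule_smult[OF sN that] by simp
  have Nadd: "x \<oplus> y \<in> N" if "x \<in> N" "y \<in> N" for x y
    using R.submodule_add[OF sN that] by simp
  have reach: "\<exists>a\<in>carrier A. \<exists>n\<in>N. y = a \<otimes> x \<oplus> n"
    if "x \<in> carrier A" "x \<notin> N" "y \<in> carrier A" for x y
    by (rule R.maximal_submodule_reach[OF N, of x y]) (use that in auto)
  have gen: "\<exists>a\<in>carrier A. g x = a \<otimes> p" if p: "p \<in> L" "g p = p" "p \<notin> N" and x: "x \<in> L" for p x
  proof -
    let ?U = "{a \<otimes> p | a. a \<in> carrier A}"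
    have U: "submodule ?U A (?M)"
    proof (rule L.submoduleI)
      show "?U \<subseteq> carrier (?M)" using Lsm p by auto
      show "\<zero>\<^bsub>?M\<^esub> \<in> ?U"
        using LA p by (auto intro!: exI[of _ "\<zero>"])
    next
      fix v w assume "v \<in> ?U" "w \<in> ?U"
      then obtain a b where "a \<in> carrier A" "b \<in> carrier A" "v = a \<otimes> p" "w = b \<otimes> p" by blast
      then show "v \<oplus>\<^bsub>?M\<^esub> w \<in> ?U"
        using LA p by (auto intro!: exI[of _ "a \<oplus> b"] simp: A.l_distr)
    next
      fix c v assume "c \<in> carrier A" "v \<in> ?U"
      then obtain a where "a \<in> carrier A" "v = a \<otimes> p" by blast
      then show "c \<odot>\<^bsub>?M\<^esub> v \<in> ?U"
        using LA p \<open>c \<in> carrier A\<close> by (auto intro!: exI[of _ "c \<otimes> a"] simp: A.m_assoc)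
    qed
    have "\<exists>v\<in>?U. g v = v \<and> g y \<ominus> v \<in> N" if y: "y \<in> L" for y
    proof -
      obtain a m where a: "a \<in> carrier A" "m \<in> N" "g y = a \<otimes> p \<oplus> m"
        using reach[OF LA[OF p(1)] p(3) LA[OF gL[OF y]]] by blast
      have "g y \<ominus> a \<otimes> p = m"
        using a LA[OF p(1)] NA by (simp add: a_minus_def A.a_ac A.r_neg A.r_neg1 A.r_neg2)
      then show ?thesis using a p gsm by (intro bexI[of _ "a \<otimes> p"]) auto
    qed
    then show ?thesis using sup[OF U _ x] by blast
  qed
  obtain x0 where x0: "x0 \<in> L" "x0 \<notin> N" using LN by blast
  have gx0: "g x0 \<notin> N"
  proof
    assume "g x0 \<in> N"
    then have "(x0 \<ominus> g x0) \<oplus> g x0 \<in> N" using Nadd gN x0 by blast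
    then show False using x0 LA gL by (simp add: a_minus_def A.a_assoc A.l_neg)
  qed
  \<comment> \<open>The summand is cyclic, generated by some \<open>p\<close> congruent to \<open>1\<close> modulo \<open>N\<close>, and \<open>e = h p\<close> for a
    section \<open>h\<close> of \<open>a \<mapsto> a p\<close>.\<close>
  obtain d n0 where d: "d \<in> carrier A" "n0 \<in> N" "\<one> = d \<otimes> g x0 \<oplus> n0"
    using reach[OF LA[OF gL[OF x0(1)]] gx0 A.one_closed] by blast
  define p where "p = d \<otimes> g x0"
  have one: "\<one> = p \<oplus> n0" using d by (simp add: p_def)
  have pL: "p \<in> L" and gp: "g p = p" using d x0 gL gsm gg Lsm by (auto simp: p_def)
  have one_N: "\<one> \<notin> N"
  proof
    assume "\<one> \<in> N"
    then have "a \<in> N" if "a \<in> carrier A" for a using Nsm[OF that, of "\<one>"] that by simp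
    then show False using N NA by (auto simp: maximal_submodule_def)
  qed
  have pN: "p \<notin> N" using one one_N Nadd d by auto
  have pA: "p \<in> carrier A" and n0A: "n0 \<in> carrier A" using pL LA d NA by auto
  have uL: "u i \<in> L" if "i < n" for i using b that by (simp add: dual_basis_def)
  have "\<forall>i. \<exists>a. i < n \<longrightarrow> a \<in> carrier A \<and> g (u i) = a \<otimes> p"
    using gen[OF pL gp pN] uL by blast
  then obtain c where c: "\<And>i. i < n \<Longrightarrow> c i \<in> carrier A" "\<And>i. i < n \<Longrightarrow> g (u i) = c i \<otimes> p" by metis
  have s: "s i \<in> mod_hom A (?M) (regular_module A)" if "i < n" for i
    using b that by (simp add: dual_basis_def)
  have sc: "s i y \<in> carrier A" if "i < n" "y \<in> L" for i y
    using mod_homD(1)[OF s[OF that(1)], of y] that(2) by simp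
  define h where "h = (\<lambda>x\<in>carrier (?M).
    \<Oplus>\<^bsub>regular_module A\<^esub>i\<in>{..<n}. s i x \<odot>\<^bsub>regular_module A\<^esub> c i)"
  have h: "h \<in> mod_hom A (?M) (regular_module A)"
    unfolding h_def by (rule coordinate_hom[OF LM RM s]) (use c in auto)
  have hA: "h x \<in> carrier A" if "x \<in> L" for x using mod_homD(1)[OF h, of x] that by simp
  have hsm: "h (a \<otimes> x) = a \<otimes> h x" if "a \<in> carrier A" "x \<in> L" for a x
    using mod_homD(3)[OF h, of a x] that by simp
  have hp: "h x \<otimes> p = g x" if x: "x \<in> L" for x
  proof -
    have "h x \<otimes> p = (\<Oplus>i\<in>{..<n}. s i x \<otimes> c i) \<otimes> p"
      using A.regular_finsum[of "{..<n}" "\<lambda>i. s i x \<otimes> c i"] x sc[OF _ x] c by (simp add: h_def)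
    also have "\<dots> = (\<Oplus>i\<in>{..<n}. (s i x \<otimes> c i) \<otimes> p)"
      by (rule A.finsum_ldistr) (use sc[OF _ x] c pA in auto)
    also have "\<dots> = (\<Oplus>i\<in>{..<n}. s i x \<otimes> g (u i))"
      by (rule A.add.finprod_cong') (use sc[OF _ x] c pA in \<open>auto simp: A.m_assoc\<close>)
    also have "\<dots> = (\<Oplus>\<^bsub>?M\<^esub>i\<in>{..<n}. s i x \<odot>\<^bsub>?M\<^esub> g (u i))"
      using A.left_ideal_finsum[OF L, of "{..<n}" "\<lambda>i. s i x \<otimes> g (u i)"] Lsm[OF sc[OF _ x] gL] b
      by (simp add: dual_basis_def)
    also have "\<dots> = g x" using dual_basis_hom_eq[OF LM LM b g, of x] x by simp
    finally show ?thesis .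
  qed
  define e where "e = h p"
  have eA: "e \<in> carrier A" using hA pL by (simp add: e_def)
  have ep: "e \<otimes> p = p" using hp[OF pL] gp by (simp add: e_def)
  have ee: "e \<otimes> e = e" using hsm[OF eA pL] ep by (simp add: e_def)
  show ?thesis
    unfolding local_lift_def
  proof (rule bexI[OF _ eA], intro conjI ballI impI)
    show "e \<otimes> e \<ominus> e \<in> {\<zero>}" using ee eA by (simp add: a_minus_def A.r_neg)
    have "\<one> \<ominus> e = (\<one> \<ominus> e) \<otimes> (p \<oplus> n0)" using eA one[symmetric] by simp
    also have "\<dots> = (\<one> \<ominus> e) \<otimes> n0"
      using eA pA n0A ep by (simp add: A.r_distr a_minus_def A.l_distr A.l_minus A.r_neg)
    also have "\<dots> \<in> N" using Nsm[OF _ d(2)] eA by simp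
    finally show "\<one> \<ominus> e \<in> N" .
    fix x assume x: "x \<in> carrier A" "x \<otimes> e \<notin> N"
    \<comment> \<open>From \<open>e p = p\<close> and \<open>1 = p + n0\<close> follows
      \<open>x e = x p + x e n0\<close>, so \<open>x p\<close> in \<open>N\<close> would put
      \<open>x e\<close> in \<open>N\<close>. A relation \<open>p = y x p\<close> is then carried to
      \<open>e = y x e\<close> by \<open>h\<close>.\<close>
    have "x \<otimes> p \<notin> N"
    proof
      assume "x \<otimes> p \<in> N"
      then have "x \<otimes> p \<oplus> (x \<otimes> e) \<otimes> n0 \<in> N" using Nadd Nsm d(2) x(1) eA by simp
      also have "x \<otimes> p \<oplus> (x \<otimes> e) \<otimes> n0 = (x \<otimes> e) \<otimes> (p \<oplus> n0)"
        using x(1) eA pA n0A ep by (simp add: A.r_distr A.m_assoc)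
      also have "\<dots> = x \<otimes> e" using x(1) eA one[symmetric] by simp
      finally show False using x(2) by simp
    qed
    moreover have "x \<otimes> p \<in> L" "g (x \<otimes> p) = x \<otimes> p" using Lsm gsm x(1) pL gp by auto
    ultimately obtain y where y: "y \<in> carrier A" "p = y \<otimes> (x \<otimes> p)"
      using gen[of "x \<otimes> p" p] pL gp by auto
    have "e = h (y \<otimes> (x \<otimes> p))" using y(2) e_def by simp
    also have "\<dots> = y \<otimes> (x \<otimes> e)" using hsm y(1) x(1) pL Lsm by (simp add: e_def)
    finally show "\<exists>y\<in>carrier A. y \<otimes> (x \<otimes> e) \<ominus> e \<in> {\<zero>}"
      using y(1) eA x(1) by (intro bexI[of _ y]) (simp_all add: a_minus_def A.r_neg)
  qed
qed

text \<open>The question is which covers must be split off from \<open>L = A f + J\<close>. If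
  \<open>J\<close> kills \<open>L / N'\<close>, then \<open>J = J J\<close> lies in
  \<open>N'\<close>; but \<open>L\<close> modulo \<open>J\<close> is generated by \<open>f\<close>
  and has \<open>L \<inter> N\<close> as its only maximal submodule above \<open>J\<close>. So every
  maximal \<open>N'\<close> not containing \<open>L \<inter> N\<close> gives a simple module not
  killed by \<open>J\<close>, where \<open>lift\<close> is available.\<close>

lemma local_lift_containing:
  fixes A (structure)
  assumes A: "ring A" and acc: "acc {U. submodule U A (regular_module A)}"
    and J: "ideal J A" "J \<cdot> J = J" and b: "dual_basis A (left_ideal_mod A J) n u s"
    and lift: "\<And>N. maximal_left_ideal A N \<Longrightarrow> \<not> J \<subseteq> N \<Longrightarrow> local_lift A {\<zero>} N"
    and N: "maximal_left_ideal A N" "J \<subseteq> N" and f: "local_lift A J N"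
  shows "local_lift A {\<zero>} N"
proof -
  let ?J = "left_ideal_mod A J"
  interpret A: ring A by fact
  interpret J: ideal J A by fact
  interpret R: left_module A "regular_module A" by (rule A.regular_left_module)
  have sN: "submodule N A (regular_module A)" using N by (simp add: maximal_submodule_def)
  have NA: "x \<in> carrier A" if "x \<in> N" for x using R.submodule_closed[OF sN that] by simp
  have JA: "x \<in> carrier A" if "x \<in> J" for x using that J.Icarr by blast
  have sJ: "submodule J A (regular_module A)"
    by (rule R.submoduleI) (use JA J.I_l_closed in auto)
  obtain f where fA: "f \<in> carrier A" and ff: "f \<otimes> f \<ominus> f \<in> J" and fN: "\<one> \<ominus> f \<in> N"
    and floc: "\<And>x. x \<in> carrier A \<Longrightarrow> x \<otimes> f \<notin> N \<Longrightarrow>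
      \<exists>y\<in>carrier A. y \<otimes> (x \<otimes> f) \<ominus> f \<in> J"
    using f unfolding local_lift_def by auto
  define L where "L = {a \<otimes> f \<oplus> j | a j. a \<in> carrier A \<and> j \<in> J}"
  let ?M = "left_ideal_mod A L"
  have L: "submodule L A (regular_module A)" and JL: "J \<subseteq> L" and fL: "f \<in> L"
    using R.submodule_adjoin[OF sJ, of f] fA by (simp_all add: L_def)
  interpret L: left_module A "?M" by (rule R.submodule_left_module[OF L])
  interpret JM: left_module A "?J" by (rule R.submodule_left_module[OF sJ])
  note LM = L.left_module_axioms
  have LA: "x \<in> carrier A" if "x \<in> L" for x using R.submodule_closed[OF L that] by simp
  have f1A: "\<one> \<ominus> f \<in> carrier A" using fA by simp
  have ff1: "f \<otimes> (\<one> \<ominus> f) \<in> J"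
  proof -
    have "f \<otimes> (\<one> \<ominus> f) = \<ominus> (f \<otimes> f \<ominus> f)"
      using fA by (simp add: a_minus_def A.r_distr A.r_minus A.minus_add A.a_ac)
    then show ?thesis using ff by simp
  qed
  have xf1: "x \<otimes> (\<one> \<ominus> f) \<in> J" if "x \<in> L" for x
  proof -
    obtain a j where aj: "a \<in> carrier A" "j \<in> J" "x = a \<otimes> f \<oplus> j"
      using \<open>x \<in> L\<close> by (auto simp: L_def)
    then have "x \<otimes> (\<one> \<ominus> f) = a \<otimes> (f \<otimes> (\<one> \<ominus> f)) \<oplus> j \<otimes> (\<one> \<ominus> f)"
      using fA f1A JA by (simp add: A.l_distr A.m_assoc)
    then show ?thesis using aj ff1 f1A by (simp add: J.I_l_closed J.I_r_closed)
  qed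
  define r where "r = (\<lambda>x\<in>L. x \<otimes> (\<one> \<ominus> f))"
  have r: "r \<in> mod_hom A (?M) (?J)"
    by (rule mod_homI) (use xf1 LA f1A L.lsmult_closed L.M.a_closed in \<open>auto simp: r_def A.l_distr A.m_assoc\<close>)
  have s: "s i \<in> mod_hom A (?J) (regular_module A)" and u: "u i \<in> J" if "i < n" for i
    using b that by (auto simp: dual_basis_def)
  \<comment> \<open>The identity \<open>x = x f + x (1 - f)\<close> is read as a dual basis:
    coordinate \<open>x\<close> itself at \<open>f\<close>, and at the \<open>u i\<close> the
    coordinates of \<open>x (1 - f)\<close> in \<open>J\<close>. Index \<open>n\<close> is the one
    for \<open>f\<close>.\<close>
  define u' where "u' i = (if i < n then u i else f)" for i
  define s' where "s' i = (if i < n then compose L (s i) r else (\<lambda>x\<in>L. x))" for i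
  have b': "dual_basis A (?M) (Suc n) u' s'"
    unfolding dual_basis_def
  proof (intro conjI allI impI ballI)
    fix i assume "i < Suc n"
    show "u' i \<in> carrier (?M)" using u JL fL by (auto simp: u'_def)
    have "(\<lambda>x\<in>L. x) \<in> mod_hom A (?M) (regular_module A)"
      by (rule mod_homI) (use LA L.lsmult_closed L.M.a_closed in auto)
    then show "s' i \<in> mod_hom A (?M) (regular_module A)"
      using mod_hom_compose[OF LM r s] by (auto simp: s'_def)
  next
    fix x assume "x \<in> carrier (?M)"
    then have x: "x \<in> L" by simp
    have rx: "r x \<in> J" using xf1[OF x] x by (simp add: r_def)
    have sA: "s i (r x) \<in> carrier A" if "i < n" for i
      using mod_homD(1)[OF s[OF that], of "r x"] rx by simp
    have su: "s' i x \<otimes> u' i \<in> L" if "i < Suc n" for i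
      using that sA u x fL subsetD[OF JL] R.submodule_smult[OF L] LA by (auto simp: s'_def u'_def compose_def)
    have "(\<Oplus>\<^bsub>?M\<^esub>i\<in>{..<Suc n}. s' i x \<odot>\<^bsub>?M\<^esub> u' i) =
        (\<Oplus>i\<in>{..<Suc n}. s' i x \<otimes> u' i)"
      using A.left_ideal_finsum[OF L, of "{..<Suc n}" "\<lambda>i. s' i x \<otimes> u' i"] su by simp
    also have "\<dots> = s' n x \<otimes> u' n \<oplus> (\<Oplus>i\<in>{..<n}. s' i x \<otimes> u' i)"
      using su LA by (simp add: lessThan_Suc A.finsum_insert Pi_def)
    also have "(\<Oplus>i\<in>{..<n}. s' i x \<otimes> u' i) = (\<Oplus>i\<in>{..<n}. s i (r x) \<otimes> u i)"
      by (rule A.add.finprod_cong') (use sA u JA x in \<open>auto simp: s'_def u'_def compose_def\<close>)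
    also have "\<dots> = (\<Oplus>\<^bsub>?J\<^esub>i\<in>{..<n}. s i (r x) \<odot>\<^bsub>?J\<^esub> u i)"
      using A.left_ideal_finsum[OF sJ, of "{..<n}" "\<lambda>i. s i (r x) \<otimes> u i"] sA u J.I_l_closed by simp
    also have "\<dots> = r x" using b rx by (simp add: dual_basis_def)
    also have "s' n x \<otimes> u' n \<oplus> r x = x"
    proof -
      have "x \<otimes> f \<oplus> x \<otimes> (\<one> \<ominus> f) = x \<otimes> (f \<oplus> (\<one> \<ominus> f))"
        using LA[OF x] fA f1A by (simp add: A.r_distr)
      also have "f \<oplus> (\<one> \<ominus> f) = \<one>"
        using fA f1A by (subst A.a_comm) (simp_all add: a_minus_def A.a_assoc A.l_neg)
      finally show ?thesis using x LA by (simp add: s'_def u'_def r_def)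
    qed
    finally show "x = (\<Oplus>\<^bsub>?M\<^esub>i\<in>{..<Suc n}. s' i x \<odot>\<^bsub>?M\<^esub> u' i)" ..
  qed
  have one_N: "\<one> \<notin> N"
  proof
    assume "\<one> \<in> N"
    then have "a \<in> N" if "a \<in> carrier A" for a using R.submodule_smult[OF sN that, of "\<one>"] that by simp
    then show False using N NA by (auto simp: maximal_submodule_def)
  qed
  have f_N: "f \<notin> N"
  proof
    assume "f \<in> N"
    then have "(\<one> \<ominus> f) \<oplus> f \<in> N" using R.submodule_add[OF sN fN] by simp
    then show False using one_N fA by (simp add: a_minus_def A.a_assoc A.l_neg)
  qed
  have K: "submodule (L \<inter> N) A (?M)"
    using R.submodule_submodule[OF L] R.submodule_Int[OF L sN] by blast
  have accL: "acc {U. submodule U A (?M)}"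
    by (rule acc_subset[OF acc]) (use R.submodule_submodule[OF L] in blast)
  have liftL: "local_lift A {\<zero>} {a \<in> carrier A. a \<odot>\<^bsub>?M\<^esub> x \<in> N'}"
    if N': "maximal_submodule A (?M) N'" and KN': "\<not> L \<inter> N \<subseteq> N'"
      and x: "x \<in> carrier (?M)" "x \<notin> N'" for N' x
  proof (rule lift[OF L.submodule_annihilator_mod[OF N' x]])
    have sN': "submodule N' A (?M)" and N'L: "N' \<noteq> L"
      using N' by (auto simp: maximal_submodule_def)
    have N'sub: "N' \<subseteq> L" using L.submodule_subset[OF sN'] by simp
    have xA: "x \<in> carrier A" using x LA by simp
    show "\<not> J \<subseteq> {a \<in> carrier A. a \<odot>\<^bsub>?M\<^esub> x \<in> N'}"
    proof
      assume "J \<subseteq> {a \<in> carrier A. a \<odot>\<^bsub>?M\<^esub> x \<in> N'}"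
      then have Jx: "j \<otimes> x \<in> N'" if "j \<in> J" for j using that by auto
      \<comment> \<open>Idempotence of \<open>J\<close> enters here: for \<open>j = a x + m\<close>,
        the product \<open>i j\<close> is \<open>(i a) x + i m\<close>, where \<open>i a\<close>
        lies in \<open>J\<close> and \<open>m\<close> in \<open>N'\<close>.\<close>
      have JN': "j \<in> N'" if "j \<in> J \<cdot> J" for j
        using that
      proof (induction rule: ideal_prod.induct)
        case (prod i j)
        have "j \<in> carrier (?M)" using prod JL by auto
        then obtain a m where am: "a \<in> carrier A" "m \<in> N'" "j = a \<otimes> x \<oplus> m"
          using L.maximal_submodule_reach[OF N' x] by auto
        have mA: "m \<in> carrier A" using am N'sub LA by blast
        have "i \<otimes> j = (i \<otimes> a) \<otimes> x \<oplus> i \<otimes> m"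
          using am JA[OF prod(1)] xA mA by (simp add: A.r_distr A.m_assoc)
        moreover have "(i \<otimes> a) \<otimes> x \<in> N'" using Jx J.I_r_closed prod am by blast
        moreover have "i \<otimes> m \<in> N'" using L.submodule_smult[OF sN' _ am(2)] JA[OF prod(1)] by simp
        ultimately show ?case using L.submodule_add[OF sN'] by simp
      next
        case (sum s1 s2)
        then show ?case using L.submodule_add[OF sN'] by simp
      qed
      then have JN': "J \<subseteq> N'" using J(2) by blast
      \<comment> \<open>An element of \<open>L\<close> outside \<open>N\<close> generates
        \<open>f\<close> modulo \<open>J\<close>. Since \<open>N'\<close> already contains
        \<open>J\<close>, such an element in \<open>N'\<close> would force
        \<open>N' = L\<close>.\<close>
      have "N' \<subseteq> N"
      proof (rule ccontr)
        assume "\<not> N' \<subseteq> N"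
        then obtain z where z: "z \<in> N'" "z \<notin> N" by blast
        then obtain a j where aj: "a \<in> carrier A" "j \<in> J" "z = a \<otimes> f \<oplus> j"
          using N'sub by (auto simp: L_def)
        have "a \<otimes> f \<notin> N"
          using z aj N(2) R.submodule_add[OF sN, of "a \<otimes> f" j] by auto
        then obtain y where y: "y \<in> carrier A" "y \<otimes> (a \<otimes> f) \<ominus> f \<in> J"
          using floc aj by blast
        have jA: "j \<in> carrier A" using JA aj by blast
        have yz: "y \<otimes> z \<in> N'" using L.submodule_smult[OF sN' y(1) z(1)] by simp
        have "y \<otimes> j \<oplus> (y \<otimes> (a \<otimes> f) \<ominus> f) \<in> J" (is "?j \<in> J")
          using y aj J.I_l_closed by simp
        then have nj: "\<ominus> ?j \<in> N'" using JN' by auto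
        have "y \<otimes> z \<oplus> (\<ominus> ?j) = f"
        proof -
          define v where "v = y \<otimes> (a \<otimes> f)"
          define w where "w = y \<otimes> j"
          have vw: "v \<in> carrier A" "w \<in> carrier A" using y aj fA jA by (auto simp: v_def w_def)
          have "y \<otimes> z = v \<oplus> w"
            using y aj fA jA by (simp add: v_def w_def A.r_distr)
          moreover have "(v \<oplus> w) \<oplus> (\<ominus> (w \<oplus> (v \<ominus> f))) = f"
            using vw fA by (simp add: a_minus_def A.minus_add A.a_ac A.r_neg A.r_neg1 A.r_neg2)
          ultimately show ?thesis by (simp add: v_def w_def)
        qed
        then have fN': "f \<in> N'" using L.submodule_add[OF sN' yz nj] by simp
        have "L \<subseteq> N'"
        proof
          fix v assume "v \<in> L"
          then obtain a j where aj: "a \<in> carrier A" "j \<in> J" "v = a \<otimes> f \<oplus> j" by (auto simp: L_def)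
          have "a \<otimes> f \<in> N'" using L.submodule_smult[OF sN' aj(1) fN'] by simp
          then show "v \<in> N'" using L.submodule_add[OF sN', of "a \<otimes> f" j] JN' aj by auto
        qed
        then show False using N'L N'sub by blast
      qed
      then have "N' \<subseteq> L \<inter> N" using N'sub by blast
      then have "L \<inter> N = N' \<or> L \<inter> N = L"
        using N' K unfolding maximal_submodule_def by auto
      then show False using KN' fL f_N by blast
    qed
  qed
  obtain g where g: "g \<in> mod_hom A (?M) (?M)"
    and gg: "\<And>x. x \<in> carrier (?M) \<Longrightarrow> g (g x) = g x"
    and gK: "\<And>x. x \<in> carrier (?M) \<Longrightarrow> x \<ominus>\<^bsub>?M\<^esub> g x \<in> L \<inter> N"
    and sup: "\<And>U x. submodule U A (?M) \<Longrightarrow>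
      (\<And>x. x \<in> carrier (?M) \<Longrightarrow>
        \<exists>v\<in>U. g v = v \<and> g x \<ominus>\<^bsub>?M\<^esub> v \<in> L \<inter> N) \<Longrightarrow>
      x \<in> carrier (?M) \<Longrightarrow> g x \<in> U"
    using L.superfluous_kernel_summand[OF accL b' K liftL] by blast
  have gL: "g x \<in> L" if "x \<in> L" for x using mod_homD(1)[OF g, of x] that by simp
  show ?thesis
  proof (rule local_lift_of_summand[OF A L N(1) _ b' g])
    show "\<not> L \<subseteq> N" using fL f_N by blast
    show "g (g x) = g x" if "x \<in> L" for x using gg[of x] that by simp
    show "x \<ominus> g x \<in> N" if "x \<in> L" for x
      using gK[of x] that A.left_ideal_diff[OF L that gL[OF that]] by simp
    fix U x assume U: "submodule U A (?M)"
      and H: "\<And>x. x \<in> L \<Longrightarrow> \<exists>v\<in>U. g v = v \<and> g x \<ominus> v \<in> N" and x: "x \<in> L"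
    show "g x \<in> U"
    proof (rule sup[OF U])
      fix y assume "y \<in> carrier (?M)"
      then have y: "y \<in> L" by simp
      then obtain v where v: "v \<in> U" "g v = v" "g y \<ominus> v \<in> N" using H by blast
      have vL: "v \<in> L" using L.submodule_closed[OF U v(1)] by simp
      have "g y \<ominus>\<^bsub>?M\<^esub> v \<in> L"
        using L.M.minus_closed[of "g y" v] gL[OF y] vL by simp
      then show "\<exists>v\<in>U. g v = v \<and> g y \<ominus>\<^bsub>?M\<^esub> v \<in> L \<inter> N"
        using v A.left_ideal_diff[OF L gL[OF y] vL] by (intro bexI[of _ v]) auto
    qed (use x in simp)
  qed
qed

section \<open>Left ideals over the base ring and the case of a heredity ideal outside the maximal
  left ideal\<close>

lemma nc_algebra_left_module:
  fixes R :: "('r, 's) ring_scheme" and A :: "('r, 'a) module"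
  assumes "nc_algebra R A" shows "left_module R A"
proof -
  interpret nc_algebra R A by fact
  show ?thesis
    by (intro left_module.intro left_module_axioms.intro)
      (auto simp: R.ring_axioms M.abelian_group_axioms smult_l_distr smult_r_distr smult_assoc1)
qed

text \<open>Left ideals thereby inherit the chain condition for \<open>R\<close>-submodules of
  \<open>A\<close>, and a left ideal can be enlarged to a maximal \<open>R\<close>-submodule when
  Nakayama's argument is run.\<close>

lemma left_ideal_base_submodule:
  fixes R :: "('r, 's) ring_scheme" and A :: "('r, 'a) module" (structure)
  assumes alg: "nc_algebra R A" and U: "submodule U A (regular_module A)"
  shows "submodule U R A"
proof -
  interpret A: ring A using alg by (simp add: nc_algebra_def)
  interpret alg: nc_algebra R A by fact
  interpret RA: left_module R A by (rule nc_algebra_left_module[OF alg])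
  interpret reg: left_module A "regular_module A" by (rule A.regular_left_module)
  show ?thesis
  proof (rule RA.submoduleI)
    have UA: "x \<in> carrier A" if "x \<in> U" for x using reg.submodule_closed[OF U that] by simp
    then show "U \<subseteq> carrier A" by blast
    show "\<zero> \<in> U" using reg.submodule_zero[OF U] by simp
    show "x \<oplus> y \<in> U" if "x \<in> U" "y \<in> U" for x y using reg.submodule_add[OF U that] by simp
    fix r x assume r: "r \<in> carrier R" and x: "x \<in> U"
    have "(r \<odot> \<one>) \<otimes> x \<in> U" using reg.submodule_smult[OF U _ x] r by simp
    then show "r \<odot> x \<in> U" using r UA[OF x] by (simp add: alg.smult_mult_l)
  qed
qed

text \<open>
  The elements \<open>c i j\<close> behave like matrix units: the endomorphism ring of \<open>J\<close> is a corner of a matrix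
  ring over \<open>R\<close>.  An endomorphism \<open>d\<close> with values in \<open>J \<inter> N\<close> has entries \<open>r j k\<close> in \<open>R\<close>.  If one of them
  is a unit, then \<open>d\<close> yields a nonzero idempotent with image in \<open>J \<inter> N\<close>; if none is, then Nakayama's
  lemma applies.
\<close>

lemma local_lift_not_containing:
  fixes R :: "('r, 's) ring_scheme" and A :: "('r, 'a) module" (structure)
  assumes alg: "nc_algebra R A"
    and loc: "\<And>t r. t \<in> carrier R \<Longrightarrow> t \<notin> Units R \<Longrightarrow> r \<in> carrier R \<Longrightarrow> \<one>\<^bsub>R\<^esub> \<ominus>\<^bsub>R\<^esub> r \<otimes>\<^bsub>R\<^esub> t \<in> Units R"
    and acc: "acc {U. submodule U R A}"
    and J: "submodule J A (regular_module A)" and b: "dual_basis A (left_ideal_mod A J) n u s"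
    and c: "\<And>i j. i < m \<Longrightarrow> j < m \<Longrightarrow> c i j \<in> mod_hom A (left_ideal_mod A J) (left_ideal_mod A J)"
    and csum: "\<And>x. x \<in> J \<Longrightarrow> x = (\<Oplus>i\<in>{..<m::nat}. c i i x)"
    and cmult: "\<And>a j k. a \<in> mod_hom A (left_ideal_mod A J) (left_ideal_mod A J) \<Longrightarrow> j < m \<Longrightarrow> k < m \<Longrightarrow>
      \<exists>r\<in>carrier R. \<forall>i<m. \<forall>l<m. \<forall>x\<in>J. c i j (a (c k l x)) = r \<odot> c i l x"
    and N: "maximal_left_ideal A N" and JN: "\<not> J \<subseteq> N"
  shows "local_lift A {\<zero>} N"
proof -
  let ?M = "left_ideal_mod A J"
  interpret R: cring R using alg by (simp add: nc_algebra_def module_def)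
  interpret A: ring A using alg by (simp add: nc_algebra_def)
  interpret alg: nc_algebra R A by fact
  interpret RA: left_module R A by (rule nc_algebra_left_module[OF alg])
  interpret reg: left_module A "regular_module A" by (rule A.regular_left_module)
  interpret J: left_module A "?M" by (rule reg.submodule_left_module[OF J])
  note JM = J.left_module_axioms
  have sN: "submodule N A (regular_module A)" using N by (simp add: maximal_submodule_def)
  note base = left_ideal_base_submodule[OF alg]
  have RJ: "submodule J R A" by (rule base[OF J])
  interpret JR: left_module R "A\<lparr>carrier := J\<rparr>" by (rule RA.submodule_left_module[OF RJ])
  have JA: "x \<in> carrier A" if "x \<in> J" for x using reg.submodule_closed[OF J that] by simp
  have rJ: "r \<odot> x \<in> J" if "r \<in> carrier R" "x \<in> J" for r x using RA.submodule_smult[OF RJ that] .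
  have rlin: "q (r \<odot> x) = r \<odot> q x"
    if q: "q \<in> mod_hom A (?M) (?M)" and r: "r \<in> carrier R" and x: "x \<in> J"
    for q r x
  proof -
    have qx: "q x \<in> J" using mod_homD(1)[OF q, of x] x by simp
    have "q ((r \<odot> \<one>) \<otimes> x) = (r \<odot> \<one>) \<otimes> q x"
      using mod_homD(3)[OF q, of "r \<odot> \<one>" x] r x by simp
    then show ?thesis using r JA[OF x] JA[OF qx] by (simp add: alg.smult_mult_l)
  qed
  have scale: "(\<lambda>x\<in>J. r \<odot> x) \<in> mod_hom A (?M) (?M)"
    if "r \<in> carrier R" for r
    by (rule mod_homI)
      (use rJ that JA J.lsmult_closed J.M.a_closed in \<open>auto simp: alg.smult_r_distr alg.smult_mult_r\<close>)
  have accJ: "acc {U. submodule U A (?M)}"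
    by (rule acc_subset[OF acc]) (use reg.submodule_submodule[OF J] base in blast)
  have K: "submodule (J \<inter> N) A (?M)"
    using reg.submodule_submodule[OF J] reg.submodule_Int[OF J sN] by blast
  obtain g where g: "g \<in> mod_hom A (?M) (?M)"
    and gg': "\<And>x. x \<in> carrier (?M) \<Longrightarrow> g (g x) = g x"
    and gK': "\<And>x. x \<in> carrier (?M) \<Longrightarrow> x \<ominus>\<^bsub>?M\<^esub> g x \<in> J \<inter> N"
    and min: "\<And>h x. h \<in> mod_hom A (?M) (?M) \<Longrightarrow>
      (\<And>x. x \<in> carrier (?M) \<Longrightarrow> h (h x) = h x) \<Longrightarrow>
      (\<And>x. x \<in> carrier (?M) \<Longrightarrow> g (h x) = h x) \<Longrightarrow>
      (\<And>x. x \<in> carrier (?M) \<Longrightarrow> h x \<in> J \<inter> N) \<Longrightarrow>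
      x \<in> carrier (?M) \<Longrightarrow> h x = \<zero>\<^bsub>?M\<^esub>"
    using J.split_off_maximal_summand[OF accJ K] by blast
  have gJ: "g x \<in> J" if "x \<in> J" for x using mod_homD(1)[OF g, of x] that by simp
  have gg: "g (g x) = g x" if "x \<in> J" for x using gg'[of x] that by simp
  have gN: "x \<ominus> g x \<in> N" if "x \<in> J" for x
    using gK'[of x] that A.left_ideal_diff[OF J that gJ[OF that]] by simp
  have cJ: "c i j x \<in> J" if "i < m" "j < m" "x \<in> J" for i j x
    using mod_homD(1)[OF c[OF that(1,2)], of x] that by simp
  show ?thesis
  proof (rule local_lift_of_summand[OF A.ring_axioms J N JN b g gg gN])
    fix U x assume U: "submodule U A (?M)"
      and H: "\<And>x. x \<in> J \<Longrightarrow> \<exists>v\<in>U. g v = v \<and> g x \<ominus> v \<in> N" and x: "x \<in> J"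
    show "g x \<in> U"
    proof (rule ccontr)
      assume gxU: "g x \<notin> U"
      have UJ: "v \<in> J" if "v \<in> U" for v using J.submodule_closed[OF U that] by simp
      have uJ: "u i \<in> J" and s: "s i \<in> mod_hom A (?M) (regular_module A)" if "i < n" for i
        using b that by (auto simp: dual_basis_def)
      have sA: "s i y \<in> carrier A" if "i < n" "y \<in> J" for i y
        using mod_homD(1)[OF s[OF that(1)], of y] that(2) by simp
      have "\<forall>i. \<exists>v. i < n \<longrightarrow> v \<in> U \<and> g v = v \<and> g (u i) \<ominus> v \<in> N" using H uJ by blast
      then obtain v where v: "\<And>i. i < n \<Longrightarrow> v i \<in> U" "\<And>i. i < n \<Longrightarrow> g (v i) = v i"
        "\<And>i. i < n \<Longrightarrow> g (u i) \<ominus> v i \<in> N" by metis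
      have vJ: "v i \<in> J" if "i < n" for i using UJ[OF v(1)[OF that]] .
      define w where "w i = g (u i) \<ominus>\<^bsub>?M\<^esub> v i" for i
      have wJ: "w i \<in> J" if "i < n" for i
        using J.M.minus_closed[of "g (u i)" "v i"] gJ[OF uJ[OF that]] vJ[OF that] by (simp add: w_def)
      have wN: "w i \<in> J \<inter> N" if "i < n" for i
        using wJ[OF that] v(3)[OF that] A.left_ideal_diff[OF J gJ[OF uJ[OF that]] vJ[OF that]]
        by (simp add: w_def)
      have gw: "g (w i) = w i" if "i < n" for i
        using mod_hom_diff[OF JM JM g, of "g (u i)" "v i"] gJ[OF uJ[OF that]] vJ[OF that]
          gg[OF uJ[OF that]] v(2)[OF that] by (simp add: w_def)
      have vw: "v i \<oplus> w i = g (u i)" if "i < n" for i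
      proof -
        have "w i = g (u i) \<ominus> v i"
          using A.left_ideal_diff[OF J gJ[OF uJ[OF that]] vJ[OF that]] by (simp add: w_def)
        moreover have "(g (u i) \<ominus> v i) \<oplus> v i = g (u i)"
          using JA[OF gJ[OF uJ[OF that]]] JA[OF vJ[OF that]] by (simp add: a_minus_def A.a_assoc A.l_neg)
        ultimately show ?thesis using A.a_comm[OF JA[OF vJ[OF that]] JA[OF wJ[OF that]]] by simp
      qed
      \<comment> \<open>On generators, \<open>g (u i)\<close> is \<open>v i + w i\<close> with
        \<open>v i\<close> in \<open>U\<close> and \<open>w i\<close> in
        \<open>J \<inter> N\<close>. The dual basis extends this to a decomposition
        \<open>g = a + d\<close> into endomorphisms with values in the image of
        \<open>g\<close>.\<close>
      define a where "a = (\<lambda>x\<in>carrier (?M).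
        \<Oplus>\<^bsub>?M\<^esub>i\<in>{..<n}. s i x \<odot>\<^bsub>?M\<^esub> v i)"
      define d where "d = (\<lambda>x\<in>carrier (?M).
        \<Oplus>\<^bsub>?M\<^esub>i\<in>{..<n}. s i x \<odot>\<^bsub>?M\<^esub> w i)"
      have a: "a \<in> mod_hom A (?M) (?M)"
        unfolding a_def by (rule coordinate_hom[OF JM JM s]) (use vJ in auto)
      have d: "d \<in> mod_hom A (?M) (?M)"
        unfolding d_def by (rule coordinate_hom[OF JM JM s]) (use wJ in auto)
      have aJ: "a y \<in> J" and dJ: "d y \<in> J" if "y \<in> J" for y
        using mod_homD(1)[OF a, of y] mod_homD(1)[OF d, of y] that by auto
      have gsum: "g (\<Oplus>\<^bsub>?M\<^esub>i\<in>{..<n}. s i y \<odot>\<^bsub>?M\<^esub> z i) =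
          (\<Oplus>\<^bsub>?M\<^esub>i\<in>{..<n}. s i y \<odot>\<^bsub>?M\<^esub> z i)"
        if z: "\<And>i. i < n \<Longrightarrow> z i \<in> J" "\<And>i. i < n \<Longrightarrow> g (z i) = z i" and y: "y \<in> J" for z y
      proof -
        have sz: "s i y \<odot>\<^bsub>?M\<^esub> z i \<in> carrier (?M)" if "i < n" for i
          by (rule J.lsmult_closed) (use sA[OF that y] z(1)[OF that] in auto)
        have "g (\<Oplus>\<^bsub>?M\<^esub>i\<in>{..<n}. s i y \<odot>\<^bsub>?M\<^esub> z i) =
          (\<Oplus>\<^bsub>?M\<^esub>i\<in>{..<n}. g (s i y \<odot>\<^bsub>?M\<^esub> z i))"
          by (rule mod_hom_finsum[OF JM JM g]) (use sz in auto)
        also have "\<dots> = (\<Oplus>\<^bsub>?M\<^esub>i\<in>{..<n}. s i y \<odot>\<^bsub>?M\<^esub> z i)"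
          by (rule J.M.add.finprod_cong') (use sz sA[OF _ y] z mod_homD(3)[OF g] in auto)
        finally show ?thesis .
      qed
      have ga: "g (a y) = a y" and gd: "g (d y) = d y" if "y \<in> J" for y
        using gsum[OF vJ v(2) that] gsum[OF wJ gw that] that by (simp_all add: a_def d_def)
      have aU: "a y \<in> U" if y: "y \<in> J" for y
        using J.submodule_finsum[OF U, of "{..<n}" "\<lambda>i. s i y \<odot>\<^bsub>?M\<^esub> v i"]
          J.submodule_smult[OF U sA[OF _ y] v(1)] y by (simp add: a_def)
      have dN: "d y \<in> J \<inter> N" if y: "y \<in> J" for y
        using J.submodule_finsum[OF K, of "{..<n}" "\<lambda>i. s i y \<odot>\<^bsub>?M\<^esub> w i"]
          J.submodule_smult[OF K sA[OF _ y] wN] y by (simp add: d_def)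
      have gad: "g y = a y \<oplus> d y" if y: "y \<in> J" for y
      proof -
        have sm: "s i y \<odot>\<^bsub>?M\<^esub> z \<in> J" if "i < n" "z \<in> J" for i z
          using J.lsmult_closed[of "s i y" z] sA[OF that(1) y] that(2) by simp
        have "g y = (\<Oplus>\<^bsub>?M\<^esub>i\<in>{..<n}. s i y \<odot>\<^bsub>?M\<^esub> g (u i))"
          by (rule dual_basis_hom_eq[OF JM JM b g]) (use y in simp)
        also have "\<dots> = (\<Oplus>\<^bsub>?M\<^esub>i\<in>{..<n}. s i y \<odot>\<^bsub>?M\<^esub> v i
            \<oplus>\<^bsub>?M\<^esub> s i y \<odot>\<^bsub>?M\<^esub> w i)"
        proof (rule J.M.add.finprod_cong')
          fix i assume "i \<in> {..<n}"
          then have i: "i < n" by simp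
          show "s i y \<odot>\<^bsub>?M\<^esub> g (u i) = s i y \<odot>\<^bsub>?M\<^esub> v i
            \<oplus>\<^bsub>?M\<^esub> s i y \<odot>\<^bsub>?M\<^esub> w i"
            using vw[OF i, symmetric] J.lsmult_r_distr[of "s i y" "v i" "w i"] sA[OF i y] vJ[OF i] wJ[OF i] by simp
        qed (use sm vJ wJ J.M.a_closed in auto)
        also have "\<dots> = (\<Oplus>\<^bsub>?M\<^esub>i\<in>{..<n}. s i y \<odot>\<^bsub>?M\<^esub> v i)
            \<oplus>\<^bsub>?M\<^esub> (\<Oplus>\<^bsub>?M\<^esub>i\<in>{..<n}. s i y \<odot>\<^bsub>?M\<^esub> w i)"
          by (rule J.M.finsum_addf) (use sm vJ wJ in auto)
        finally show ?thesis using y by (simp add: a_def d_def)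
      qed
      have "\<forall>j k. \<exists>r. j < m \<and> k < m \<longrightarrow> r \<in> carrier R \<and>
          (\<forall>i<m. \<forall>l<m. \<forall>x\<in>J. c i j (d (c k l x)) = r \<odot> c i l x)"
        using cmult[OF d] by blast
      then obtain r where r: "\<And>j k. j < m \<Longrightarrow> k < m \<Longrightarrow> r j k \<in> carrier R"
        "\<And>i j k l x. i < m \<Longrightarrow> j < m \<Longrightarrow> k < m \<Longrightarrow> l < m \<Longrightarrow> x \<in> J \<Longrightarrow>
          c i j (d (c k l x)) = r j k \<odot> c i l x" by metis
      have nonunit: "r j k \<notin> Units R" if jk: "j < m" "k < m" for j k
      proof
        assume unit: "r j k \<in> Units R"
        define q where "q = inv\<^bsub>R\<^esub> (r j k)"
        have q: "q \<in> carrier R" "r j k \<otimes>\<^bsub>R\<^esub> q = \<one>\<^bsub>R\<^esub>" "q \<otimes>\<^bsub>R\<^esub> r j k = \<one>\<^bsub>R\<^esub>"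
          using unit by (auto simp: q_def)
        note rjk = r(1)[OF jk]
        \<comment> \<open>Since \<open>c k j \<circ> d \<circ> c k j\<close> equals
          \<open>r j k\<close> times \<open>c k j\<close>, the map \<open>d \<circ> c k j\<close>
          divided by the unit \<open>r j k\<close> is idempotent. Its values lie in
          \<open>J \<inter> N\<close> and are fixed by \<open>g\<close>, so it must vanish.\<close>
        define h where "h = compose J d (compose J (c k j) (\<lambda>x\<in>J. q \<odot> x))"
        have hy: "h y = d (c k j (q \<odot> y))" if "y \<in> J" for y
          using that by (simp add: h_def compose_def)
        have hJ: "h y \<in> J" if "y \<in> J" for y using hy[OF that] dJ cJ jk rJ q that by simp
        have "h \<in> mod_hom A (?M) (?M)"
          using mod_hom_compose[OF JM mod_hom_compose[OF JM scale[OF q(1)] c[OF jk(2,1)]] d]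
          by (simp add: h_def)
        moreover have "h (h y) = h y" if y: "y \<in> J" for y
        proof -
          have yq: "q \<odot> y \<in> J" using rJ q y by simp
          have "c k j (q \<odot> h y) = q \<odot> (r j k \<odot> c k j (q \<odot> y))"
            using rlin[OF c[OF jk(2,1)] q(1) hJ[OF y]] r(2)[OF jk(2,1,2,1) yq] hy[OF y] by simp
          also have "\<dots> = c k j (q \<odot> y)"
            using q rjk JA[OF cJ[OF jk(2,1) yq]] by (simp add: alg.smult_assoc1[symmetric])
          finally show ?thesis using hy[OF y] hy[OF hJ[OF y]] by simp
        qed
        moreover have "g (h y) = h y" "h y \<in> J \<inter> N" if y: "y \<in> J" for y
          using hy[OF y] gd dN cJ[OF jk(2,1)] rJ q y by auto
        ultimately have h0: "h y = \<zero>" if "y \<in> J" for y using min[of h y] that by simp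
        have d0: "d (c k j y) = \<zero>" if y: "y \<in> J" for y
        proof -
          have "q \<odot> (r j k \<odot> y) = y"
            using q rjk JA[OF y] by (simp add: alg.smult_assoc1[symmetric])
          then show ?thesis using h0[OF rJ[OF rjk y]] hy[OF rJ[OF rjk y]] by simp
        qed
        have cancel: "y = \<zero>" if "r j k \<odot> y = \<zero>" "y \<in> carrier A" for y
        proof -
          have "y = q \<odot> (r j k \<odot> y)" using q rjk that(2) by (simp add: alg.smult_assoc1[symmetric])
          then show ?thesis using that(1) q by simp
        qed
        have zero: "z \<zero> = \<zero>" if "z \<in> mod_hom A (?M) (?M)" for z
          using mod_hom_zero[OF JM JM that] by simp
        \<comment> \<open>Once \<open>d \<circ> c k j\<close> vanishes, cancelling the unit
          \<open>r j k\<close> removes first the \<open>c i j\<close> and then all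
          \<open>c i l\<close>. Their diagonal sum is the identity, so \<open>J\<close> would be
          zero and contained in \<open>N\<close>.\<close>
        have c1: "c i j y = \<zero>" if "i < m" "y \<in> J" for i y
          using r(2)[OF that(1) jk jk(1) that(2)] d0[OF that(2)] zero[OF c[OF that(1) jk(1)]]
            cancel[of "c i j y"] JA[OF cJ[OF that(1) jk(1) that(2)]] by simp
        have c2: "c i l y = \<zero>" if "i < m" "l < m" "y \<in> J" for i l y
          using r(2)[OF that(1) jk that(2,3)] c1[OF that(1) dJ[OF cJ[OF jk(2) that(2,3)]]]
            cancel[of "c i l y"] JA[OF cJ[OF that]] by simp
        have "y = \<zero>" if y: "y \<in> J" for y
        proof -
          have "(\<Oplus>i\<in>{..<m}. c i i y) = (\<Oplus>i\<in>{..<m}. \<zero>)"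
            by (rule A.add.finprod_cong') (use c2 y in auto)
          then show ?thesis using csum[OF y] A.finsum_zero[of "{..<m}"] by simp
        qed
        then show False using JN reg.submodule_zero[OF sN] by auto
      qed
      let ?W = "{z \<in> J. g z \<in> U}"
      have W: "submodule ?W A (?M)"
        using submodule_vimage[OF JM JM g U] by simp
      then have WR: "submodule ?W R (A\<lparr>carrier := J\<rparr>)"
        using base reg.submodule_submodule[OF J] RA.submodule_submodule[OF RJ] by blast
      have accR: "acc {V. submodule V R (A\<lparr>carrier := J\<rparr>)}"
        by (rule acc_subset[OF acc]) (use RA.submodule_submodule[OF RJ] in blast)
      have "?W \<noteq> carrier (A\<lparr>carrier := J\<rparr>)" using gxU x by auto
      \<comment> \<open>\<open>V\<close> is maximal among \<open>R\<close>-submodules only. Then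
        \<open>J / V\<close> is a simple \<open>R\<close>-module, killed by every nonunit of
        \<open>R\<close> because \<open>1 - p t\<close> is a unit; this is the form of Nakayama's
        lemma used here.\<close>
      then obtain V where V: "maximal_submodule R (A\<lparr>carrier := J\<rparr>) V" and WV: "?W \<subseteq> V"
        by (rule JR.maximal_submodule_exists[OF accR WR])
      have sV: "submodule V R (A\<lparr>carrier := J\<rparr>)" using V by (simp add: maximal_submodule_def)
      have sV': "submodule V R A" and VJ: "V \<subseteq> J" using sV RA.submodule_submodule[OF RJ] by auto
      have rV: "t \<odot> y \<in> V" if t: "t \<in> carrier R" "t \<notin> Units R" and y: "y \<in> J" for t y
      proof (rule ccontr)
        assume no: "t \<odot> y \<notin> V"
        obtain p z where pz: "p \<in> carrier R" "z \<in> V" "y = p \<odot> (t \<odot> y) \<oplus> z"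
          by (rule JR.maximal_submodule_reach[OF V, of "t \<odot> y" y]) (use no rJ t y in auto)
        have zA: "z \<in> carrier A" using pz VJ JA by blast
        have yA: "y \<in> carrier A" using JA[OF y] .
        define q where "q = \<one>\<^bsub>R\<^esub> \<ominus>\<^bsub>R\<^esub> p \<otimes>\<^bsub>R\<^esub> t"
        have q: "q \<in> Units R" unfolding q_def by (rule loc[OF t pz(1)])
        have "q \<odot> y = y \<ominus> p \<odot> (t \<odot> y)"
          using pz(1) t yA by (simp add: q_def RA.lsmult_diff_l alg.smult_assoc1)
        also have "\<dots> = z"
        proof -
          define y' where "y' = p \<odot> (t \<odot> y)"
          have "y' \<in> carrier A" using pz t yA by (simp add: y'_def)
          moreover from this have "y = z \<oplus> y'" using pz(3) zA A.a_comm by (simp add: y'_def)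
          ultimately have "y \<ominus> y' = z"
            using zA by (simp add: a_minus_def A.a_assoc A.r_neg)
          then show ?thesis by (simp add: y'_def)
        qed
        finally have "inv\<^bsub>R\<^esub> q \<odot> (q \<odot> y) \<in> V"
          using RA.submodule_smult[OF sV' _ pz(2)] q by simp
        moreover have "inv\<^bsub>R\<^esub> q \<odot> (q \<odot> y) = y"
          using q yA R.Units_closed[OF q] by (simp add: alg.smult_assoc1[symmetric])
        ultimately have "y \<in> V" by simp
        then show False using no RA.submodule_smult[OF sV' t(1)] by blast
      qed
      \<comment> \<open>Decomposing \<open>y\<close> as the sum of the \<open>c k k y\<close> turns
        \<open>c i i (d y)\<close> into the sum of the \<open>r i k\<close> times
        \<open>c i k y\<close>, and all these coefficients are nonunits.\<close>
      have dV: "d y \<in> V" if y: "y \<in> J" for y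
      proof -
        have cdV: "c i i (d y) \<in> V" if i: "i < m" for i
        proof -
          have hom: "compose J (c i i) d \<in> mod_hom A (?M) (?M)"
            using mod_hom_compose[OF JM d c[OF i i]] by simp
          have "y = (\<Oplus>\<^bsub>?M\<^esub>k\<in>{..<m}. c k k y)"
            using csum[OF y] A.left_ideal_finsum[OF J, of "{..<m}" "\<lambda>k. c k k y"] cJ y by simp
          then have "compose J (c i i) d y = compose J (c i i) d (\<Oplus>\<^bsub>?M\<^esub>k\<in>{..<m}. c k k y)" by simp
          also have "\<dots> = (\<Oplus>\<^bsub>?M\<^esub>k\<in>{..<m}. compose J (c i i) d (c k k y))"
            by (rule mod_hom_finsum[OF JM JM hom]) (use cJ y in auto)
          also have "\<dots> = (\<Oplus>k\<in>{..<m}. compose J (c i i) d (c k k y))"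
            by (rule A.left_ideal_finsum[OF J]) (use cJ dJ i y in \<open>auto simp: compose_def\<close>)
          also have "\<dots> \<in> V"
          proof (rule RA.submodule_finsum[OF sV'])
            fix k assume "k \<in> {..<m}"
            then have k: "k < m" by simp
            have "compose J (c i i) d (c k k y) = r i k \<odot> c i k y"
              using r(2)[OF i i k k y] cJ[OF k k y] by (simp add: compose_def)
            then show "compose J (c i i) d (c k k y) \<in> V"
              using rV[OF r(1)[OF i k] nonunit[OF i k] cJ[OF i k y]] by simp
          qed simp
          finally show ?thesis using y by (simp add: compose_def)
        qed
        have "(\<Oplus>i\<in>{..<m}. c i i (d y)) \<in> V"
          by (rule RA.submodule_finsum[OF sV']) (use cdV in auto)
        then show ?thesis using csum[OF dJ[OF y]] by simp
      qed
      \<comment> \<open>Here \<open>y\<close> is the sum of \<open>y - g y\<close> and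
        \<open>a y\<close>, both in \<open>?W\<close>, and of \<open>d y\<close>. Hence
        \<open>V\<close> would be all of \<open>J\<close>.\<close>
      have "y \<in> V" if y: "y \<in> J" for y
      proof -
        have "a y \<in> V" using WV aJ[OF y] ga[OF y] aU[OF y] by auto
        then have gV: "g y \<in> V" using gad[OF y] dV[OF y] RA.submodule_add[OF sV'] by simp
        have yg: "y \<ominus>\<^bsub>?M\<^esub> g y \<in> J"
          using J.M.minus_closed[of y "g y"] y gJ[OF y] by simp
        have "g (y \<ominus>\<^bsub>?M\<^esub> g y) = \<zero>\<^bsub>?M\<^esub>"
          using mod_hom_diff[OF JM JM g, of y "g y"] y gJ[OF y] gg[OF y]
            J.M.r_neg[of "g y"] by (simp add: a_minus_def)
        then have "y \<ominus>\<^bsub>?M\<^esub> g y \<in> V"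
          using WV yg J.submodule_zero[OF U] by auto
        then have "(y \<ominus> g y) \<oplus> g y \<in> V"
          using A.left_ideal_diff[OF J y gJ[OF y]] gV RA.submodule_add[OF sV'] by simp
        moreover have "(y \<ominus> g y) \<oplus> g y = y"
          using JA[OF y] JA[OF gJ[OF y]] by (simp add: a_minus_def A.a_assoc A.l_neg)
        ultimately show ?thesis by simp
      qed
      then show False using V VJ by (auto simp: maximal_submodule_def)
    qed
  qed
qed

section \<open>Morita equivalence\<close>

lemma mod_hom_ext:
  assumes "f \<in> mod_hom A M N" "g \<in> mod_hom A M N" "\<And>x. x \<in> carrier M \<Longrightarrow> f x = g x"
  shows "f = g"
  by (rule extensionalityI[OF mod_homD(4)[OF assms(1)] mod_homD(4)[OF assms(2)] assms(3)])

lemma mod_id_hom: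
  assumes "left_module A M" shows "mod_id M \<in> mod_hom A M M"
proof -
  interpret left_module A M by fact
  show ?thesis by (rule mod_homI) (auto simp: mod_id_def)
qed

lemma mod_hom_inverse:
  assumes M: "left_module A M" and f: "f \<in> mod_hom A M N" and bij: "bij_betw f (carrier M) (carrier N)"
  shows "(\<lambda>y\<in>carrier N. inv_into (carrier M) f y) \<in> mod_hom A N M"
proof -
  interpret M: left_module A M by fact
  have inj: "inj_on f (carrier M)" and im: "f ` carrier M = carrier N"
    using bij by (auto simp: bij_betw_def)
  have c: "inv_into (carrier M) f y \<in> carrier M" and r: "f (inv_into (carrier M) f y) = y"
    if "y \<in> carrier N" for y
    using that im by (auto intro: inv_into_into f_inv_into_f)
  have eq: "inv_into (carrier M) f y = x" if "x \<in> carrier M" "f x = y" for x y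
    using that inv_into_f_f[OF inj] by auto
  show ?thesis
  proof (rule mod_homI)
    fix x y assume x: "x \<in> carrier N" and y: "y \<in> carrier N"
    have *: "f (inv_into (carrier M) f x \<oplus>\<^bsub>M\<^esub> inv_into (carrier M) f y) = x \<oplus>\<^bsub>N\<^esub> y"
      using mod_homD(2)[OF f c[OF x] c[OF y]] r x y by simp
    have "x \<oplus>\<^bsub>N\<^esub> y \<in> carrier N"
      using mod_homD(1)[OF f M.M.a_closed[OF c[OF x] c[OF y]]] unfolding * .
    then show "(\<lambda>y\<in>carrier N. inv_into (carrier M) f y) (x \<oplus>\<^bsub>N\<^esub> y) =
      (\<lambda>y\<in>carrier N. inv_into (carrier M) f y) x \<oplus>\<^bsub>M\<^esub> (\<lambda>y\<in>carrier N. inv_into (carrier M) f y) y"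
      using eq[OF M.M.a_closed[OF c[OF x] c[OF y]] *] x y by simp
  next
    fix a x assume a: "a \<in> carrier A" and x: "x \<in> carrier N"
    have *: "f (a \<odot>\<^bsub>M\<^esub> inv_into (carrier M) f x) = a \<odot>\<^bsub>N\<^esub> x"
      using mod_homD(3)[OF f a c[OF x]] r x by simp
    have "a \<odot>\<^bsub>N\<^esub> x \<in> carrier N"
      using mod_homD(1)[OF f M.lsmult_closed[OF a c[OF x]]] unfolding * .
    then show "(\<lambda>y\<in>carrier N. inv_into (carrier M) f y) (a \<odot>\<^bsub>N\<^esub> x) =
      a \<odot>\<^bsub>M\<^esub> (\<lambda>y\<in>carrier N. inv_into (carrier M) f y) x"
      using eq[OF M.lsmult_closed[OF a c[OF x]] *] x by simp
  qed (use c in auto)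
qed

text \<open>The functors of a Morita equivalence act only on modules with elements in one fixed
  type, so regular modules are copied into it along an injection \<open>ins\<close>, of which
  \<open>inv_into UNIV ins\<close> is a left inverse.\<close>

definition transport_module :: "('m \<Rightarrow> 'n) \<Rightarrow> ('a, 'm) module \<Rightarrow> ('a, 'n) module" where
  "transport_module ins M =
    \<lparr>carrier = ins ` carrier M, monoid.mult = undefined, one = undefined, ring.zero = ins \<zero>\<^bsub>M\<^esub>,
     ring.add = (\<lambda>u v. ins (inv_into UNIV ins u \<oplus>\<^bsub>M\<^esub> inv_into UNIV ins v)), smult = (\<lambda>a u. ins (a \<odot>\<^bsub>M\<^esub> inv_into UNIV ins u))\<rparr>"

lemma transport_module_simps [simp]:
  "carrier (transport_module ins M) = ins ` carrier M" "\<zero>\<^bsub>transport_module ins M\<^esub> = ins \<zero>\<^bsub>M\<^esub>"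
  "u \<oplus>\<^bsub>transport_module ins M\<^esub> v = ins (inv_into UNIV ins u \<oplus>\<^bsub>M\<^esub> inv_into UNIV ins v)"
  "a \<odot>\<^bsub>transport_module ins M\<^esub> u = ins (a \<odot>\<^bsub>M\<^esub> inv_into UNIV ins u)"
  by (simp_all add: transport_module_def)

lemma transport_left_module:
  assumes "left_module A M" "inj ins"
  shows "left_module A (transport_module ins M)"
proof -
  interpret left_module A M by fact
  note [simp] = inv_f_f[OF assms(2)]
  have "abelian_group (transport_module ins M)"
  proof (rule abelian_groupI)
    fix u assume "u \<in> carrier (transport_module ins M)"
    then obtain x where "x \<in> carrier M" "u = ins x" by auto
    then show "\<exists>v\<in>carrier (transport_module ins M). v \<oplus>\<^bsub>transport_module ins M\<^esub> u = \<zero>\<^bsub>transport_module ins M\<^esub>"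
      by (intro bexI[of _ "ins (\<ominus>\<^bsub>M\<^esub> x)"]) (auto simp: M.l_neg)
  qed (auto simp: M.a_ac)
  then show ?thesis
    by (intro left_module.intro left_module_axioms.intro A.ring_axioms)
      (auto simp: lsmult_l_distr lsmult_r_distr lsmult_assoc)
qed

section \<open>Equivalences of module categories are full and faithful\<close>

lemma nat_iso_to_idD:
  assumes "nat_iso_to_id B Fo Fm \<eta>"
  shows "\<And>M. left_module B M \<Longrightarrow> \<eta> M \<in> mod_hom B (Fo M) M"
    and "\<And>M. left_module B M \<Longrightarrow> bij_betw (\<eta> M) (carrier (Fo M)) (carrier M)"
    and "\<And>M N f. left_module B M \<Longrightarrow> left_module B N \<Longrightarrow> f \<in> mod_hom B M N \<Longrightarrow>
      compose (carrier (Fo M)) (\<eta> N) (Fm M N f) = compose (carrier (Fo M)) f (\<eta> M)"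
  using assms unfolding nat_iso_to_id_def by simp_all

text \<open>Naturality recovers \<open>f \<circ> \<eta> M\<close> from the image of
  \<open>f\<close>, and \<open>\<eta> M\<close> is onto. For a composite functor this yields
  faithfulness of its first factor.\<close>

lemma nat_iso_faithful:
  assumes iso: "nat_iso_to_id B Fo Fm \<eta>" and MN: "left_module B M" "left_module B N"
    and f: "f \<in> mod_hom B M N" and g: "g \<in> mod_hom B M N" and eq: "Fm M N f = Fm M N g"
  shows "f = g"
proof (rule mod_hom_ext[OF f g])
  have 1: "compose (carrier (Fo M)) f (\<eta> M) = compose (carrier (Fo M)) g (\<eta> M)"
    using nat_iso_to_idD(3)[OF iso MN f] nat_iso_to_idD(3)[OF iso MN g] eq by simp
  fix x assume x: "x \<in> carrier M"
  obtain y where "y \<in> carrier (Fo M)" "\<eta> M y = x"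
    using bij_betw_imp_surj_on[OF nat_iso_to_idD(2)[OF iso MN(1)]] x by (metis imageE)
  then show "f x = g x" using fun_cong[OF 1, of y] by (simp add: compose_def)
qed

lemma linear_functorD:
  assumes "linear_functor R B C Fo Fm"
  shows "\<And>M. left_module B M \<Longrightarrow> left_module C (Fo M)"
    and "\<And>M N f. left_module B M \<Longrightarrow> left_module B N \<Longrightarrow> f \<in> mod_hom B M N \<Longrightarrow>
      Fm M N f \<in> mod_hom C (Fo M) (Fo N)"
    and "\<And>M. left_module B M \<Longrightarrow> Fm M M (mod_id M) = mod_id (Fo M)"
    and "\<And>L M N f g. left_module B L \<Longrightarrow> left_module B M \<Longrightarrow> left_module B N \<Longrightarrow>
      f \<in> mod_hom B L M \<Longrightarrow> g \<in> mod_hom B M N \<Longrightarrow>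
      Fm L N (compose (carrier L) g f) = compose (carrier (Fo L)) (Fm M N g) (Fm L M f)"
    and "\<And>M N f r. left_module B M \<Longrightarrow> left_module B N \<Longrightarrow> f \<in> mod_hom B M N \<Longrightarrow> r \<in> carrier R \<Longrightarrow>
      Fm M N (hom_smult B M N r f) = hom_smult C (Fo M) (Fo N) r (Fm M N f)"
  using assms unfolding linear_functor_def by simp_all

text \<open>The preimage of \<open>k\<close> is the inverse of \<open>\<eta> M\<close> followed by
  \<open>Gm (Fo M) (Fo N) k\<close> and \<open>\<eta> N\<close>. Naturality and injectivity of
  \<open>\<eta> N\<close> show that its image and \<open>k\<close> agree after \<open>Gm\<close>,
  which is faithful by \<open>\<epsilon>\<close>.\<close>

lemma nat_iso_full:
  assumes F: "linear_functor R B C Fo Fm" and G: "linear_functor R C B Go Gm"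
    and \<eta>: "nat_iso_to_id B (Go \<circ> Fo) (\<lambda>M N f. Gm (Fo M) (Fo N) (Fm M N f)) \<eta>"
    and \<epsilon>: "nat_iso_to_id C (Fo \<circ> Go) (\<lambda>M N f. Fm (Go M) (Go N) (Gm M N f)) \<epsilon>"
    and MN: "left_module B M" "left_module B N" and k: "k \<in> mod_hom C (Fo M) (Fo N)"
  obtains f where "f \<in> mod_hom B M N" "Fm M N f = k"
proof -
  note FM = linear_functorD(1)[OF F MN(1)] and FN = linear_functorD(1)[OF F MN(2)]
  note GFM = linear_functorD(1)[OF G FM]
  have \<eta>M: "\<eta> M \<in> mod_hom B (Go (Fo M)) M" "bij_betw (\<eta> M) (carrier (Go (Fo M))) (carrier M)"
    and \<eta>N: "\<eta> N \<in> mod_hom B (Go (Fo N)) N" "bij_betw (\<eta> N) (carrier (Go (Fo N))) (carrier N)"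
    using nat_iso_to_idD(1,2)[OF \<eta>] MN by auto
  define i where "i = (\<lambda>y\<in>carrier M. inv_into (carrier (Go (Fo M))) (\<eta> M) y)"
  have i: "i \<in> mod_hom B M (Go (Fo M))"
    unfolding i_def by (rule mod_hom_inverse[OF GFM \<eta>M])
  have Gk: "Gm (Fo M) (Fo N) k \<in> mod_hom B (Go (Fo M)) (Go (Fo N))"
    by (rule linear_functorD(2)[OF G FM FN k])
  define f where "f = compose (carrier M) (\<eta> N) (compose (carrier M) (Gm (Fo M) (Fo N) k) i)"
  have f: "f \<in> mod_hom B M N"
    unfolding f_def by (rule mod_hom_compose[OF MN(1) mod_hom_compose[OF MN(1) i Gk] \<eta>N(1)])
  note Ff = linear_functorD(2)[OF F MN f]
  note GFf = linear_functorD(2)[OF G FM FN Ff]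
  have "Gm (Fo M) (Fo N) (Fm M N f) = Gm (Fo M) (Fo N) k"
  proof (rule mod_hom_ext[OF GFf Gk])
    fix x assume x: "x \<in> carrier (Go (Fo M))"
    have "compose (carrier (Go (Fo M))) (\<eta> N) (Gm (Fo M) (Fo N) (Fm M N f)) x =
        compose (carrier (Go (Fo M))) f (\<eta> M) x"
      using nat_iso_to_idD(3)[OF \<eta> MN f] by simp
    then have "\<eta> N (Gm (Fo M) (Fo N) (Fm M N f) x) = f (\<eta> M x)" using x by (simp add: compose_def)
    also have "\<dots> = \<eta> N (Gm (Fo M) (Fo N) k x)"
      using mod_homD(1)[OF \<eta>M(1) x] inv_into_f_f[of "\<eta> M" "carrier (Go (Fo M))" x] x \<eta>M(2)
      by (simp add: f_def i_def compose_def bij_betw_def)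
    finally show "Gm (Fo M) (Fo N) (Fm M N f) x = Gm (Fo M) (Fo N) k x"
      using \<eta>N(2) mod_homD(1)[OF GFf x] mod_homD(1)[OF Gk x] by (auto simp: bij_betw_def dest: inj_onD)
  qed
  then have "Fm M N f = k"
    by (intro nat_iso_faithful[OF \<epsilon> FM FN Ff k]) simp
  then show thesis using that f by blast
qed

lemma (in ring) regular_ring: "ring (regular_module R)"
proof -
  interpret M: left_module R "regular_module R" by (rule regular_left_module)
  have "monoid (regular_module R)"
    by (rule monoidI) (auto simp: regular_module_def m_assoc)
  then show ?thesis
    by (intro ringI M.M.abelian_group_axioms) (auto simp: regular_module_def l_distr r_distr)
qed

lemma left_module_regular_ring:
  assumes "ring R" shows "left_module (regular_module R) M \<longleftrightarrow> left_module R M"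
proof -
  interpret ring R by fact
  have [simp]: "\<one>\<^bsub>regular_module R\<^esub> = \<one>\<^bsub>R\<^esub>" "a \<otimes>\<^bsub>regular_module R\<^esub> b = a \<otimes>\<^bsub>R\<^esub> b" for a b
    by (simp_all add: regular_module_def)
  show ?thesis
    using regular_ring ring_axioms
    by (auto simp: left_module_def left_module_axioms_def)
qed

lemma mod_hom_regular_ring: "mod_hom (regular_module R) M N = mod_hom R M N"
  by (simp add: mod_hom_def)

text \<open>The trace of \<open>W\<close> in \<open>M\<close> from Morita theory; \<open>W\<close>
  is a generator when it is always everything. Adding one value at a time makes finite sums
  accessible by induction.\<close>

inductive_set trace :: "('b, 'x) ring_scheme \<Rightarrow> ('b, 'w) module \<Rightarrow> ('b, 'm) module \<Rightarrow> 'm set"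
  for B W M where
  zero: "\<zero>\<^bsub>M\<^esub> \<in> trace B W M"
| add: "t \<in> trace B W M \<Longrightarrow> \<phi> \<in> mod_hom B W M \<Longrightarrow> w \<in> carrier W \<Longrightarrow> t \<oplus>\<^bsub>M\<^esub> \<phi> w \<in> trace B W M"

lemma trace_submodule:
  assumes W: "left_module B W" and M: "left_module B M"
  shows "submodule (trace B W M) B M"
proof -
  interpret W: left_module B W by fact
  interpret M: left_module B M by fact
  have c: "t \<in> carrier M" if "t \<in> trace B W M" for t
    using that by induction (auto dest: mod_homD(1))
  show ?thesis
  proof (rule M.submoduleI)
    fix s t assume s: "s \<in> trace B W M" and "t \<in> trace B W M"
    from this(2) show "s \<oplus>\<^bsub>M\<^esub> t \<in> trace B W M"
    proof induction
      case (add t \<phi> w)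
      have "s \<oplus>\<^bsub>M\<^esub> (t \<oplus>\<^bsub>M\<^esub> \<phi> w) = (s \<oplus>\<^bsub>M\<^esub> t) \<oplus>\<^bsub>M\<^esub> \<phi> w"
        using c[OF s] c[OF add(1)] mod_homD(1)[OF add(2,3)] by (simp add: M.M.a_assoc)
      then show ?case using trace.add[OF add.IH add(2,3)] by simp
    qed (use s c in simp)
  next
    fix b t assume b: "b \<in> carrier B" and "t \<in> trace B W M"
    from this(2) show "b \<odot>\<^bsub>M\<^esub> t \<in> trace B W M"
    proof induction
      case (add t \<phi> w)
      have "b \<odot>\<^bsub>M\<^esub> (t \<oplus>\<^bsub>M\<^esub> \<phi> w) = b \<odot>\<^bsub>M\<^esub> t \<oplus>\<^bsub>M\<^esub> \<phi> (b \<odot>\<^bsub>W\<^esub> w)"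
        using b c[OF add(1)] mod_homD(1,3)[OF add(2)] add(3) by (simp add: M.lsmult_r_distr)
      then show ?case using trace.add[OF add.IH add(2) W.lsmult_closed[OF b add(3)]] by simp
    qed (use b trace.zero in simp)
  qed (use c trace.zero in auto)
qed

text \<open>The module \<open>W\<close> corresponds to the regular \<open>R\<close>-module \<open>R'\<close> under the equivalence.\<close>

lemma morita_generator:
  fixes R :: "('r, 's) ring_scheme" and B :: "('r, 'b) module"
  assumes R: "cring R" and B: "ring B"
    and central: "\<And>r b. r \<in> carrier R \<Longrightarrow> b \<in> carrier B \<Longrightarrow>
      r \<odot>\<^bsub>B\<^esub> \<one>\<^bsub>B\<^esub> \<in> carrier B \<and> b \<otimes>\<^bsub>B\<^esub> (r \<odot>\<^bsub>B\<^esub> \<one>\<^bsub>B\<^esub>) = (r \<odot>\<^bsub>B\<^esub> \<one>\<^bsub>B\<^esub>) \<otimes>\<^bsub>B\<^esub> b"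
    and eq: "morita_equivalent R B (regular_module R)"
  obtains W :: "('b, nat \<Rightarrow> 'b + 'r) module" where "left_module B W"
    and "\<And>f. f \<in> mod_hom B W W \<Longrightarrow>
      \<exists>r\<in>carrier R. \<forall>w\<in>carrier W. f w = (r \<odot>\<^bsub>B\<^esub> \<one>\<^bsub>B\<^esub>) \<odot>\<^bsub>W\<^esub> w"
    and "\<And>M :: ('b, nat \<Rightarrow> 'b + 'r) module. left_module B M \<Longrightarrow> trace B W M = carrier M"
proof -
  interpret R: cring R by fact
  interpret B: ring B by fact
  let ?C = "regular_module R"
  have lmC: "left_module ?C M \<longleftrightarrow> left_module R M" for M :: "('r, nat \<Rightarrow> 'b + 'r) module"
    by (rule left_module_regular_ring[OF R.ring_axioms])
  obtain Fo :: "('b, nat \<Rightarrow> 'b + 'r) module \<Rightarrow> ('r, nat \<Rightarrow> 'b + 'r) module" and Fm Go Gm \<eta> \<epsilon> where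
    F: "linear_functor R B ?C Fo Fm" and G: "linear_functor R ?C B Go Gm"
    and \<eta>: "nat_iso_to_id B (Go \<circ> Fo) (\<lambda>M N f. Gm (Fo M) (Fo N) (Fm M N f)) \<eta>"
    and \<epsilon>: "nat_iso_to_id ?C (Fo \<circ> Go) (\<lambda>M N f. Fm (Go M) (Go N) (Gm M N f)) \<epsilon>"
    using eq unfolding morita_equivalent_def by (elim exE conjE) (rule that)
  note full = nat_iso_full[OF F, OF G, OF \<eta>, OF \<epsilon>]
  note F1 = linear_functorD(1)[OF F] and F2 = linear_functorD(2)[OF F]
    and F3 = linear_functorD(3)[OF F] and F4 = linear_functorD(4)[OF F] and F5 = linear_functorD(5)[OF F]
  have faithful: "f = g" if "left_module B M" "left_module B N" "f \<in> mod_hom B M N" "g \<in> mod_hom B M N"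
    "Fm M N f = Fm M N g" for M N f g
    by (rule nat_iso_faithful[OF \<eta>, OF that(1-4)]) (simp add: that(5))
  define ins :: "'r \<Rightarrow> nat \<Rightarrow> 'b + 'r" where "ins r = (\<lambda>_. Inr r)" for r
  have ins: "inj ins" by (rule injI) (auto simp: ins_def fun_eq_iff)
  note [simp] = inv_f_f[OF ins]
  define R' where "R' = transport_module ins (regular_module R)"
  have R': "left_module ?C R'"
    unfolding lmC R'_def by (rule transport_left_module[OF R.regular_left_module ins])
  define W where "W = Go R'"
  have W: "left_module B W" unfolding W_def by (rule linear_functorD(1)[OF G R'])
  define V where "V = Fo W"
  have V: "left_module ?C V" unfolding V_def by (rule F1[OF W])
  interpret V: left_module R V using V by (simp add: lmC)
  have \<epsilon>': "\<epsilon> R' \<in> mod_hom R V R'" "bij_betw (\<epsilon> R') (carrier V) (carrier R')"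
    using nat_iso_to_idD(1,2)[OF \<epsilon> R'] by (auto simp: V_def W_def mod_hom_regular_ring)
  have "ins \<one>\<^bsub>R\<^esub> \<in> carrier R'" by (simp add: R'_def)
  then obtain \<gamma> where \<gamma>: "\<gamma> \<in> carrier V" "\<epsilon> R' \<gamma> = ins \<one>\<^bsub>R\<^esub>"
    using bij_betw_imp_surj_on[OF \<epsilon>'(2)] by (metis imageE)
  \<comment> \<open>\<open>\<gamma>\<close> corresponds to the unit of \<open>R\<close>, so
    \<open>V\<close> is free of rank one on it and a homomorphism out of \<open>V\<close> is
    determined by its value at \<open>\<gamma>\<close>.\<close>
  have gen: "\<exists>r\<in>carrier R. y = r \<odot>\<^bsub>V\<^esub> \<gamma>" if y: "y \<in> carrier V" for y
  proof -
    have "\<epsilon> R' y \<in> carrier R'" using mod_homD(1)[OF \<epsilon>'(1) y] .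
    then obtain r where r: "r \<in> carrier R" "\<epsilon> R' y = ins r" by (auto simp: R'_def)
    have "\<epsilon> R' (r \<odot>\<^bsub>V\<^esub> \<gamma>) = \<epsilon> R' y"
      using mod_homD(3)[OF \<epsilon>'(1) r(1) \<gamma>(1)] r \<gamma>(2) by (simp add: R'_def)
    then have "r \<odot>\<^bsub>V\<^esub> \<gamma> = y" using \<epsilon>'(2) y r(1) \<gamma>(1) by (auto simp: bij_betw_def dest: inj_onD)
    then show ?thesis using r by blast
  qed
  have hom_eq: "f = g" if f: "f \<in> mod_hom R V Y" and g: "g \<in> mod_hom R V Y" and eq: "f \<gamma> = g \<gamma>"
    for f g and Y :: "('r, nat \<Rightarrow> 'b + 'r) module"
  proof (rule mod_hom_ext[OF f g])
    fix y assume "y \<in> carrier V"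
    then obtain r where "r \<in> carrier R" "y = r \<odot>\<^bsub>V\<^esub> \<gamma>" using gen by blast
    then show "f y = g y" using mod_homD(3)[OF f _ \<gamma>(1)] mod_homD(3)[OF g _ \<gamma>(1)] eq by simp
  qed
  \<comment> \<open>Fullness turns the homomorphism from \<open>V\<close> that sends
    \<open>\<gamma>\<close> to \<open>v\<close> into a homomorphism from \<open>W\<close>. Together
    with \<open>hom_eq\<close> and faithfulness,
    \<open>\<phi> \<mapsto> Fm W M \<phi> \<gamma>\<close> identifies the homomorphisms from
    \<open>W\<close> to \<open>M\<close> with the elements of \<open>Fo M\<close>.\<close>
  have lift: "\<exists>\<phi>\<in>mod_hom B W M. Fm W M \<phi> \<gamma> = v" if M: "left_module B M" and v: "v \<in> carrier (Fo M)" for M v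
  proof -
    have FM: "left_module R (Fo M)" using F1[OF M] by (simp add: lmC)
    interpret FM: left_module R "Fo M" by fact
    define \<rho> where "\<rho> = (\<lambda>u\<in>carrier R'. inv_into UNIV ins u \<odot>\<^bsub>Fo M\<^esub> v)"
    have \<rho>: "\<rho> \<in> mod_hom R R' (Fo M)"
      by (rule mod_homI) (use v in \<open>auto simp: \<rho>_def R'_def FM.lsmult_l_distr FM.lsmult_assoc\<close>)
    have "compose (carrier V) \<rho> (\<epsilon> R') \<in> mod_hom ?C (Fo W) (Fo M)"
      using mod_hom_compose[OF V.left_module_axioms \<epsilon>'(1) \<rho>] by (simp add: mod_hom_regular_ring V_def)
    then obtain \<phi> where \<phi>: "\<phi> \<in> mod_hom B W M" "Fm W M \<phi> = compose (carrier V) \<rho> (\<epsilon> R')"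
      by (rule full[OF W M])
    then have "Fm W M \<phi> \<gamma> = v" using \<gamma> v by (simp add: compose_def \<rho>_def R'_def)
    then show ?thesis using \<phi>(1) by blast
  qed
  interpret W: left_module B W by (rule W)
  have endo: "\<exists>r\<in>carrier R. \<forall>w\<in>carrier W. f w = (r \<odot>\<^bsub>B\<^esub> \<one>\<^bsub>B\<^esub>) \<odot>\<^bsub>W\<^esub> w"
    if f: "f \<in> mod_hom B W W" for f
  proof -
    have Ff: "Fm W W f \<in> mod_hom R V V" using F2[OF W W f] by (simp add: V_def mod_hom_regular_ring)
    obtain r where r: "r \<in> carrier R" "Fm W W f \<gamma> = r \<odot>\<^bsub>V\<^esub> \<gamma>"
      using gen[OF mod_homD(1)[OF Ff \<gamma>(1)]] by blast
    have idW: "mod_id W \<in> mod_hom B W W" by (rule mod_id_hom[OF W])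
    have c: "r \<odot>\<^bsub>B\<^esub> \<one>\<^bsub>B\<^esub> \<in> carrier B" using central[OF r(1) B.one_closed] by blast
    have sm: "hom_smult B W W r (mod_id W) \<in> mod_hom B W W"
    proof (rule mod_homI)
      fix b w assume "b \<in> carrier B" "w \<in> carrier W"
      then show "hom_smult B W W r (mod_id W) (b \<odot>\<^bsub>W\<^esub> w) = b \<odot>\<^bsub>W\<^esub> hom_smult B W W r (mod_id W) w"
        using central[OF r(1), of b] c
        by (simp add: hom_smult_def base_smult_def mod_id_def W.lsmult_assoc[symmetric])
    qed (use c in \<open>auto simp: hom_smult_def base_smult_def mod_id_def W.lsmult_r_distr\<close>)
    \<comment> \<open>Endomorphisms of \<open>V\<close> are scalars, and linearity of the functor
      makes the scalar \<open>r\<close> on \<open>V\<close> the image of the scalar \<open>r\<close>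
      on \<open>W\<close>.\<close>
    have "Fm W W f = Fm W W (hom_smult B W W r (mod_id W))"
    proof (rule hom_eq[OF Ff])
      show "Fm W W (hom_smult B W W r (mod_id W)) \<in> mod_hom R V V"
        using F2[OF W W sm] by (simp add: V_def mod_hom_regular_ring)
      have "Fm W W (hom_smult B W W r (mod_id W)) = hom_smult ?C V V r (mod_id V)"
        using F5[OF W W idW r(1)] F3[OF W] by (simp add: V_def)
      then show "Fm W W f \<gamma> = Fm W W (hom_smult B W W r (mod_id W)) \<gamma>"
        using r \<gamma>(1) by (simp add: hom_smult_def base_smult_def mod_id_def) (simp add: regular_module_def)
    qed
    then have "f = hom_smult B W W r (mod_id W)" by (rule faithful[OF W W f sm])
    then have "f w = (r \<odot>\<^bsub>B\<^esub> \<one>\<^bsub>B\<^esub>) \<odot>\<^bsub>W\<^esub> w" if "w \<in> carrier W" for w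
      using that by (simp add: hom_smult_def base_smult_def mod_id_def)
    then show ?thesis using r(1) by blast
  qed
  have gen_all: "trace B W M = carrier M" if M: "left_module B M" for M :: "('b, nat \<Rightarrow> 'b + 'r) module"
  proof -
    interpret M: left_module B M by fact
    \<comment> \<open>Every homomorphism from \<open>W\<close> to \<open>M\<close> lands in the
      trace, so the functor sends the inclusion \<open>j\<close> of the trace to a bijection. By
      fullness the inverse comes from a right inverse of \<open>j\<close>, hence \<open>j\<close> is
      onto.\<close>
    let ?T = "M\<lparr>carrier := trace B W M\<rparr>"
    note sT = trace_submodule[OF W M]
    have T: "left_module B ?T" by (rule M.submodule_left_module[OF sT])
    define j where "j = (\<lambda>x\<in>trace B W M. x)"
    have j: "j \<in> mod_hom B ?T M"
      by (rule mod_homI)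
        (use M.submodule_closed[OF sT] M.submodule_add[OF sT] M.submodule_smult[OF sT] in \<open>auto simp: j_def\<close>)
    have WT: "\<phi> \<in> mod_hom B W ?T" if \<phi>: "\<phi> \<in> mod_hom B W M" for \<phi>
    proof -
      have "\<phi> w \<in> trace B W M" if "w \<in> carrier W" for w
        using trace.add[OF trace.zero \<phi> that] mod_homD(1)[OF \<phi> that] by simp
      then show ?thesis by (intro mod_homI) (use mod_homD[OF \<phi>] in auto)
    qed
    have TW: "\<phi> \<in> mod_hom B W M" "compose (carrier W) j \<phi> = \<phi>" if \<phi>: "\<phi> \<in> mod_hom B W ?T" for \<phi>
    proof -
      show \<phi>': "\<phi> \<in> mod_hom B W M"
        by (intro mod_homI) (use mod_homD[OF \<phi>] M.submodule_closed[OF sT] in auto)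
      show "compose (carrier W) j \<phi> = \<phi>"
        by (rule extensionalityI[OF _ mod_homD(4)[OF \<phi>]])
          (use mod_homD(1)[OF \<phi>] in \<open>auto simp: compose_def j_def\<close>)
    qed
    have Fj: "Fm ?T M j \<in> mod_hom R (Fo ?T) (Fo M)" using F2[OF T M j] by (simp add: mod_hom_regular_ring)
    have FT: "left_module R (Fo ?T)" and FM: "left_module R (Fo M)" using F1[OF T] F1[OF M] by (simp_all add: lmC)
    have Fcomp: "Fm W M \<phi> \<gamma> = Fm ?T M j (Fm W ?T \<phi> \<gamma>)" if \<phi>: "\<phi> \<in> mod_hom B W ?T" for \<phi>
      using F4[OF W T M \<phi> j] TW(2)[OF \<phi>] \<gamma>(1) by (simp add: compose_def V_def)
    have "bij_betw (Fm ?T M j) (carrier (Fo ?T)) (carrier (Fo M))"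
      unfolding bij_betw_def
    proof
      show "inj_on (Fm ?T M j) (carrier (Fo ?T))"
      proof (rule inj_onI)
        fix v v' assume v: "v \<in> carrier (Fo ?T)" "v' \<in> carrier (Fo ?T)" and eq: "Fm ?T M j v = Fm ?T M j v'"
        obtain \<phi> where \<phi>: "\<phi> \<in> mod_hom B W ?T" "Fm W ?T \<phi> \<gamma> = v" using lift[OF T v(1)] by blast
        obtain \<phi>' where \<phi>': "\<phi>' \<in> mod_hom B W ?T" "Fm W ?T \<phi>' \<gamma> = v'" using lift[OF T v(2)] by blast
        have "Fm W M \<phi> = Fm W M \<phi>'"
        proof (rule hom_eq)
          show "Fm W M \<phi> \<in> mod_hom R V (Fo M)" "Fm W M \<phi>' \<in> mod_hom R V (Fo M)"
            using F2[OF W M TW(1)[OF \<phi>(1)]] F2[OF W M TW(1)[OF \<phi>'(1)]]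
            by (simp_all add: V_def mod_hom_regular_ring)
          show "Fm W M \<phi> \<gamma> = Fm W M \<phi>' \<gamma>" using Fcomp[OF \<phi>(1)] Fcomp[OF \<phi>'(1)] \<phi>(2) \<phi>'(2) eq by simp
        qed
        then have "\<phi> = \<phi>'" by (rule faithful[OF W M TW(1)[OF \<phi>(1)] TW(1)[OF \<phi>'(1)]])
        then show "v = v'" using \<phi>(2) \<phi>'(2) by simp
      qed
      show "Fm ?T M j ` carrier (Fo ?T) = carrier (Fo M)"
      proof
        show "Fm ?T M j ` carrier (Fo ?T) \<subseteq> carrier (Fo M)" using mod_homD(1)[OF Fj] by blast
        show "carrier (Fo M) \<subseteq> Fm ?T M j ` carrier (Fo ?T)"
        proof
          fix v assume "v \<in> carrier (Fo M)"
          then obtain \<phi> where \<phi>: "\<phi> \<in> mod_hom B W M" "Fm W M \<phi> \<gamma> = v" using lift[OF M] by blast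
          have "Fm W ?T \<phi> \<gamma> \<in> carrier (Fo ?T)"
            using mod_homD(1)[OF F2[OF W T WT[OF \<phi>(1)]], of \<gamma>] \<gamma>(1) by (simp add: V_def)
          then show "v \<in> Fm ?T M j ` carrier (Fo ?T)" using Fcomp[OF WT[OF \<phi>(1)]] \<phi>(2) by blast
        qed
      qed
    qed
    note bij = this
    define \<kappa> where "\<kappa> = (\<lambda>y\<in>carrier (Fo M). inv_into (carrier (Fo ?T)) (Fm ?T M j) y)"
    have "\<kappa> \<in> mod_hom ?C (Fo M) (Fo ?T)"
      unfolding \<kappa>_def mod_hom_regular_ring by (rule mod_hom_inverse[OF FT Fj bij])
    then obtain \<theta> where \<theta>: "\<theta> \<in> mod_hom B M ?T" "Fm M ?T \<theta> = \<kappa>" by (rule full[OF M T])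
    have "Fm M M (compose (carrier M) j \<theta>) = compose (carrier (Fo M)) (Fm ?T M j) \<kappa>"
      using F4[OF M T M \<theta>(1) j] \<theta>(2) by simp
    also have "\<dots> = mod_id (Fo M)"
      using bij by (auto simp: compose_def \<kappa>_def mod_id_def restrict_def fun_eq_iff bij_betw_def f_inv_into_f)
    also have "\<dots> = Fm M M (mod_id M)" using F3[OF M] by simp
    finally have *: "compose (carrier M) j \<theta> = mod_id M"
      by (rule faithful[OF M M mod_hom_compose[OF M \<theta>(1) j] mod_id_hom[OF M]])
    have "x \<in> trace B W M" if x: "x \<in> carrier M" for x
    proof -
      have "\<theta> x \<in> trace B W M" using mod_homD(1)[OF \<theta>(1) x] by simp
      moreover have "\<theta> x = x" using fun_cong[OF *, of x] x \<open>\<theta> x \<in> trace B W M\<close>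
        by (simp add: compose_def j_def mod_id_def)
      ultimately show ?thesis by simp
    qed
    then show ?thesis using M.submodule_subset[OF sT] by blast
  qed
  show thesis by (rule that[OF W]) (fact endo, fact gen_all)
qed

section \<open>The opposite endomorphism ring and its matrix units\<close>

lemma op_end_algebra_simps [simp]:
  "carrier (op_algebra (end_algebra A M)) = mod_hom A M M"
  "f \<otimes>\<^bsub>op_algebra (end_algebra A M)\<^esub> g = compose (carrier M) g f"
  "\<one>\<^bsub>op_algebra (end_algebra A M)\<^esub> = mod_id M"
  "\<zero>\<^bsub>op_algebra (end_algebra A M)\<^esub> = (\<lambda>x\<in>carrier M. \<zero>\<^bsub>M\<^esub>)"
  "f \<oplus>\<^bsub>op_algebra (end_algebra A M)\<^esub> g = hom_add M M f g"
  "r \<odot>\<^bsub>op_algebra (end_algebra A M)\<^esub> f = hom_smult A M M r f"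
  by (simp_all add: op_algebra_def end_algebra_def)

lemma op_end_algebra_ring:
  assumes "left_module A M" shows "ring (op_algebra (end_algebra A M))"
proof -
  interpret left_module A M by fact
  note hc = mod_homD(1)[where M = M and N = M]
  note M' = left_module_axioms
  have add: "hom_add M M f g \<in> mod_hom A M M" if "f \<in> mod_hom A M M" "g \<in> mod_hom A M M" for f g
    by (rule mod_homI)
      (use mod_homD[OF that(1)] mod_homD[OF that(2)] in \<open>auto simp: hom_add_def M.a_ac lsmult_r_distr\<close>)
  have zero: "(\<lambda>x\<in>carrier M. \<zero>\<^bsub>M\<^esub>) \<in> mod_hom A M M"
    by (rule mod_homI) auto
  have uminus: "(\<lambda>x\<in>carrier M. \<ominus>\<^bsub>M\<^esub> f x) \<in> mod_hom A M M" if "f \<in> mod_hom A M M" for f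
    by (rule mod_homI)
      (use mod_homD[OF that] in \<open>auto simp: M.minus_add lsmult_minus_r\<close>)
  note comp = mod_hom_compose[OF M'] and id = mod_id_hom[OF M']
  have ap: "hom_add M M f g x = f x \<oplus>\<^bsub>M\<^esub> g x" "compose (carrier M) g f x = g (f x)" "mod_id M x = x"
    if "x \<in> carrier M" for f g x
    using that by (simp_all add: hom_add_def compose_def mod_id_def)
  let ?E = "op_algebra (end_algebra A M)"
  have "abelian_group ?E"
  proof (rule abelian_groupI)
    fix f g h assume "f \<in> carrier ?E" "g \<in> carrier ?E" "h \<in> carrier ?E"
    then have fgh: "f \<in> mod_hom A M M" "g \<in> mod_hom A M M" "h \<in> mod_hom A M M" by auto
    show "(f \<oplus>\<^bsub>?E\<^esub> g) \<oplus>\<^bsub>?E\<^esub> h = f \<oplus>\<^bsub>?E\<^esub> (g \<oplus>\<^bsub>?E\<^esub> h)"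
      unfolding op_end_algebra_simps
      by (rule mod_hom_ext[OF add[OF add[OF fgh(1,2)] fgh(3)] add[OF fgh(1) add[OF fgh(2,3)]]])
        (use fgh[THEN hc] in \<open>simp add: ap M.a_assoc\<close>)
  next
    fix f g assume "f \<in> carrier ?E" "g \<in> carrier ?E"
    then have fg: "f \<in> mod_hom A M M" "g \<in> mod_hom A M M" by auto
    show "f \<oplus>\<^bsub>?E\<^esub> g = g \<oplus>\<^bsub>?E\<^esub> f"
      unfolding op_end_algebra_simps
      by (rule mod_hom_ext[OF add[OF fg] add[OF fg(2,1)]]) (use fg[THEN hc] in \<open>simp add: ap M.a_comm\<close>)
    show "f \<oplus>\<^bsub>?E\<^esub> g \<in> carrier ?E" using add[OF fg] by simp
  next
    fix f assume "f \<in> carrier ?E"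
    then have f: "f \<in> mod_hom A M M" by auto
    show "\<zero>\<^bsub>?E\<^esub> \<oplus>\<^bsub>?E\<^esub> f = f"
      unfolding op_end_algebra_simps
      by (rule mod_hom_ext[OF add[OF zero f] f]) (use hc[OF f] in \<open>simp add: ap\<close>)
    have "hom_add M M (\<lambda>x\<in>carrier M. \<ominus>\<^bsub>M\<^esub> f x) f = (\<lambda>x\<in>carrier M. \<zero>\<^bsub>M\<^esub>)"
      by (rule mod_hom_ext[OF add[OF uminus[OF f] f] zero]) (use hc[OF f] in \<open>simp add: ap M.l_neg\<close>)
    then show "\<exists>g\<in>carrier ?E. g \<oplus>\<^bsub>?E\<^esub> f = \<zero>\<^bsub>?E\<^esub>"
      using uminus[OF f] by (intro bexI[of _ "\<lambda>x\<in>carrier M. \<ominus>\<^bsub>M\<^esub> f x"]) auto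
  qed (use zero in auto)
  moreover have "Group.monoid ?E"
  proof (rule monoidI)
    fix f g h assume "f \<in> carrier ?E" "g \<in> carrier ?E" "h \<in> carrier ?E"
    then have fgh: "f \<in> mod_hom A M M" "g \<in> mod_hom A M M" "h \<in> mod_hom A M M" by auto
    show "(f \<otimes>\<^bsub>?E\<^esub> g) \<otimes>\<^bsub>?E\<^esub> h = f \<otimes>\<^bsub>?E\<^esub> (g \<otimes>\<^bsub>?E\<^esub> h)"
      unfolding op_end_algebra_simps
      by (rule mod_hom_ext[OF comp[OF comp[OF fgh(1,2)] fgh(3)] comp[OF fgh(1) comp[OF fgh(2,3)]]])
        (use hc[OF fgh(1)] in \<open>simp add: ap\<close>)
  next
    fix f assume "f \<in> carrier ?E"
    then have f: "f \<in> mod_hom A M M" by auto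
    show "\<one>\<^bsub>?E\<^esub> \<otimes>\<^bsub>?E\<^esub> f = f" "f \<otimes>\<^bsub>?E\<^esub> \<one>\<^bsub>?E\<^esub> = f"
      unfolding op_end_algebra_simps
      by (rule mod_hom_ext[OF comp[OF id f] f], simp add: ap)
        (rule mod_hom_ext[OF comp[OF f id] f], use hc[OF f] in \<open>simp add: ap\<close>)
  qed (use comp id in auto)
  ultimately show ?thesis
  proof (rule ringI)
    fix f g h assume "f \<in> carrier ?E" "g \<in> carrier ?E" "h \<in> carrier ?E"
    then have fgh: "f \<in> mod_hom A M M" "g \<in> mod_hom A M M" "h \<in> mod_hom A M M" by auto
    show "(f \<oplus>\<^bsub>?E\<^esub> g) \<otimes>\<^bsub>?E\<^esub> h = f \<otimes>\<^bsub>?E\<^esub> h \<oplus>\<^bsub>?E\<^esub> g \<otimes>\<^bsub>?E\<^esub> h"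
      unfolding op_end_algebra_simps
      by (rule mod_hom_ext[OF comp[OF add[OF fgh(1,2)] fgh(3)] add[OF comp[OF fgh(1,3)] comp[OF fgh(2,3)]]])
        (use fgh[THEN hc] mod_homD(2)[OF fgh(3)] in \<open>simp add: ap\<close>)
    show "h \<otimes>\<^bsub>?E\<^esub> (f \<oplus>\<^bsub>?E\<^esub> g) = h \<otimes>\<^bsub>?E\<^esub> f \<oplus>\<^bsub>?E\<^esub> h \<otimes>\<^bsub>?E\<^esub> g"
      unfolding op_end_algebra_simps
      by (rule mod_hom_ext[OF comp[OF fgh(3) add[OF fgh(1,2)]] add[OF comp[OF fgh(3,1)] comp[OF fgh(3,2)]]])
        (use fgh[THEN hc] in \<open>simp add: ap\<close>)
  qed
qed

text \<open>The generator \<open>W\<close> writes the identity of the endomorphism ring as a finite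
  sum of \<open>\<phi> i (w i)\<close>, with \<open>\<phi> i\<close> from \<open>W\<close> to the
  regular module, and \<open>c i j\<close> is \<open>\<phi> i (w j)\<close>. The scalar
  \<open>r\<close> arises since endomorphisms of \<open>W\<close> are scalars. It takes the place of
  a matrix entry of \<open>a\<close>; the \<open>c i j\<close> need not be orthogonal, so for
  \<open>a\<close> the identity it need not be a Kronecker delta.\<close>

lemma end_matrix_units:
  fixes R :: "('r, 's) ring_scheme" and A :: "('r, 'a) module" and M :: "('a, 'm) module"
  assumes alg: "nc_algebra R A" and M: "left_module A M"
    and eq: "morita_equivalent R (op_algebra (end_algebra A M)) (regular_module R)"
  obtains m :: nat and c where
    "\<And>i j. i < m \<Longrightarrow> j < m \<Longrightarrow> c i j \<in> mod_hom A M M"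
    and "\<And>x. x \<in> carrier M \<Longrightarrow> x = (\<Oplus>\<^bsub>M\<^esub>i\<in>{..<m}. c i i x)"
    and "\<And>a j k. a \<in> mod_hom A M M \<Longrightarrow> j < m \<Longrightarrow> k < m \<Longrightarrow>
      \<exists>r\<in>carrier R. \<forall>i<m. \<forall>l<m. \<forall>x\<in>carrier M. c i j (a (c k l x)) = base_smult A M r (c i l x)"
proof -
  interpret R: cring R using alg by (simp add: nc_algebra_def module_def)
  interpret A: ring A using alg by (simp add: nc_algebra_def)
  interpret alg: nc_algebra R A by fact
  interpret M: left_module A M by fact
  let ?E = "op_algebra (end_algebra A M)"
  interpret E: ring ?E by (rule op_end_algebra_ring[OF M])
  interpret ER: left_module ?E "regular_module ?E" by (rule E.regular_left_module)
  have rone: "r \<odot>\<^bsub>A\<^esub> \<one>\<^bsub>A\<^esub> \<in> carrier A" if "r \<in> carrier R" for r using that by simp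
  have sc: "hom_smult A M M r (mod_id M) x = (r \<odot>\<^bsub>A\<^esub> \<one>\<^bsub>A\<^esub>) \<odot>\<^bsub>M\<^esub> x" if "x \<in> carrier M" for r x
    using that by (simp add: hom_smult_def base_smult_def mod_id_def)
  have smh: "hom_smult A M M r (mod_id M) \<in> mod_hom A M M" if r: "r \<in> carrier R" for r
  proof (rule mod_homI)
    fix a x assume a: "a \<in> carrier A" and x: "x \<in> carrier M"
    have "(r \<odot>\<^bsub>A\<^esub> \<one>\<^bsub>A\<^esub>) \<otimes>\<^bsub>A\<^esub> a = a \<otimes>\<^bsub>A\<^esub> (r \<odot>\<^bsub>A\<^esub> \<one>\<^bsub>A\<^esub>)"
      using r a by (simp add: alg.smult_mult_l alg.smult_mult_r)
    then have "(r \<odot>\<^bsub>A\<^esub> \<one>\<^bsub>A\<^esub>) \<odot>\<^bsub>M\<^esub> (a \<odot>\<^bsub>M\<^esub> x) = a \<odot>\<^bsub>M\<^esub> ((r \<odot>\<^bsub>A\<^esub> \<one>\<^bsub>A\<^esub>) \<odot>\<^bsub>M\<^esub> x)"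
      using M.lsmult_assoc[OF rone[OF r] a x] M.lsmult_assoc[OF a rone[OF r] x] by simp
    then show "hom_smult A M M r (mod_id M) (a \<odot>\<^bsub>M\<^esub> x) = a \<odot>\<^bsub>M\<^esub> hom_smult A M M r (mod_id M) x"
      using a x by (simp add: sc)
  qed (use rone[OF r] in \<open>auto simp: sc M.lsmult_r_distr\<close>, simp add: hom_smult_def)
  have central: "r \<odot>\<^bsub>?E\<^esub> \<one>\<^bsub>?E\<^esub> \<in> carrier ?E \<and>
      b \<otimes>\<^bsub>?E\<^esub> (r \<odot>\<^bsub>?E\<^esub> \<one>\<^bsub>?E\<^esub>) = (r \<odot>\<^bsub>?E\<^esub> \<one>\<^bsub>?E\<^esub>) \<otimes>\<^bsub>?E\<^esub> b"
    if r: "r \<in> carrier R" and "b \<in> carrier ?E" for r b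
  proof -
    have b: "b \<in> mod_hom A M M" using that(2) by simp
    have "compose (carrier M) (hom_smult A M M r (mod_id M)) b =
        compose (carrier M) b (hom_smult A M M r (mod_id M))"
      by (rule mod_hom_ext[OF mod_hom_compose[OF M b smh[OF r]] mod_hom_compose[OF M smh[OF r] b]])
        (use mod_homD(1,3)[OF b] rone[OF r] in \<open>simp add: compose_def sc\<close>)
    then show ?thesis using smh[OF r] by simp
  qed
  obtain W :: "('m \<Rightarrow> 'm, nat \<Rightarrow> ('m \<Rightarrow> 'm) + 'r) module" where W: "left_module ?E W"
    and endo: "\<And>f. f \<in> mod_hom ?E W W \<Longrightarrow>
      \<exists>r\<in>carrier R. \<forall>w\<in>carrier W. f w = (r \<odot>\<^bsub>?E\<^esub> \<one>\<^bsub>?E\<^esub>) \<odot>\<^bsub>W\<^esub> w"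
    and gen: "\<And>L :: ('m \<Rightarrow> 'm, nat \<Rightarrow> ('m \<Rightarrow> 'm) + 'r) module. left_module ?E L \<Longrightarrow> trace ?E W L = carrier L"
    using morita_generator[OF R.is_cring E.ring_axioms central eq] by metis
  interpret W: left_module ?E W by (rule W)
  define ins :: "('m \<Rightarrow> 'm) \<Rightarrow> nat \<Rightarrow> ('m \<Rightarrow> 'm) + 'r" where "ins f = (\<lambda>_. Inl f)" for f
  have ins: "inj ins" by (rule injI) (auto simp: ins_def fun_eq_iff)
  note [simp] = inv_f_f[OF ins]
  let ?L = "transport_module ins (regular_module ?E)"
  let ?v = "inv_into UNIV ins"
  have L: "left_module ?E ?L" by (rule transport_left_module[OF ER.left_module_axioms ins])
  have vL: "?v t \<in> mod_hom A M M" if "t \<in> carrier ?L" for t using that by auto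
  \<comment> \<open>Membership in the trace is unfolded into a finite sum that is taken pointwise in
    \<open>M\<close>, so no sums in the endomorphism ring have to be evaluated.\<close>
  have claim: "\<exists>(m::nat) \<phi> w. (\<forall>i<m. \<phi> i \<in> mod_hom ?E W ?L \<and> w i \<in> carrier W) \<and>
      (\<forall>x\<in>carrier M. ?v t x = (\<Oplus>\<^bsub>M\<^esub>i\<in>{..<m}. ?v (\<phi> i (w i)) x))" if "t \<in> trace ?E W ?L" for t
    using that
  proof induction
    case zero
    show ?case by (intro exI[of _ 0]) simp
  next
    case (add t \<psi> z)
    have tL: "t \<in> carrier ?L" using add(1) gen[OF L] by simp
    obtain m :: nat and \<phi> w where IH: "\<And>i. i < m \<Longrightarrow> \<phi> i \<in> mod_hom ?E W ?L" "\<And>i. i < m \<Longrightarrow> w i \<in> carrier W"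
      "\<And>x. x \<in> carrier M \<Longrightarrow> ?v t x = (\<Oplus>\<^bsub>M\<^esub>i\<in>{..<m}. ?v (\<phi> i (w i)) x)"
      using add.IH by blast
    let ?\<phi> = "\<phi>(m := \<psi>)" and ?w = "w(m := z)"
    have \<psi>z: "\<psi> z \<in> carrier ?L" by (rule mod_homD(1)[OF add(2,3)])
    have "?v (t \<oplus>\<^bsub>?L\<^esub> \<psi> z) x = (\<Oplus>\<^bsub>M\<^esub>i\<in>{..<Suc m}. ?v (?\<phi> i (?w i)) x)" if x: "x \<in> carrier M" for x
    proof -
      have cl: "?v (\<phi> i (w i)) x \<in> carrier M" if "i < m" for i
        using mod_homD(1)[OF vL[OF mod_homD(1)[OF IH(1)[OF that] IH(2)[OF that]]] x] .
      have clz: "?v (\<psi> z) x \<in> carrier M" using mod_homD(1)[OF vL[OF \<psi>z] x] .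
      have clt: "?v t x \<in> carrier M" using mod_homD(1)[OF vL[OF tL] x] .
      have "(\<Oplus>\<^bsub>M\<^esub>i\<in>{..<Suc m}. ?v (?\<phi> i (?w i)) x) =
          ?v (\<psi> z) x \<oplus>\<^bsub>M\<^esub> (\<Oplus>\<^bsub>M\<^esub>i\<in>{..<m}. ?v (?\<phi> i (?w i)) x)"
        unfolding lessThan_Suc using cl clz by (subst M.M.finsum_insert) auto
      also have "(\<Oplus>\<^bsub>M\<^esub>i\<in>{..<m}. ?v (?\<phi> i (?w i)) x) = (\<Oplus>\<^bsub>M\<^esub>i\<in>{..<m}. ?v (\<phi> i (w i)) x)"
        by (rule M.M.add.finprod_cong') (use cl in auto)
      also have "\<dots> = ?v t x" using IH(3)[OF x] by simp
      finally show ?thesis using x clz clt by (simp add: hom_add_def M.M.a_comm)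
    qed
    moreover have "?\<phi> i \<in> mod_hom ?E W ?L \<and> ?w i \<in> carrier W" if "i < Suc m" for i
      using that IH(1,2) add(2,3) by (auto simp: less_Suc_eq)
    ultimately show ?case
      by (intro exI[of _ "Suc m"] exI[of _ ?\<phi>] exI[of _ ?w]) blast
  qed
  have "ins (mod_id M) \<in> trace ?E W ?L" unfolding gen[OF L] using mod_id_hom[OF M] by simp
  from claim[OF this] obtain m :: nat and \<phi> w where \<phi>: "\<And>i. i < m \<Longrightarrow> \<phi> i \<in> mod_hom ?E W ?L"
    and w: "\<And>i. i < m \<Longrightarrow> w i \<in> carrier W"
    and sum: "\<And>x. x \<in> carrier M \<Longrightarrow> ?v (ins (mod_id M)) x = (\<Oplus>\<^bsub>M\<^esub>i\<in>{..<m}. ?v (\<phi> i (w i)) x)"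
    by blast
  define c where "c i j = ?v (\<phi> i (w j))" for i j
  have ic: "ins (c i j) = \<phi> i (w j)" if "i < m" "j < m" for i j
    using mod_homD(1)[OF \<phi> w, OF that] by (auto simp: c_def)
  have c: "c i j \<in> mod_hom A M M" if "i < m" "j < m" for i j
    unfolding c_def by (rule vL[OF mod_homD(1)[OF \<phi> w, OF that]])
  have csum: "x = (\<Oplus>\<^bsub>M\<^esub>i\<in>{..<m}. c i i x)" if "x \<in> carrier M" for x
    using sum[OF that] that by (simp add: c_def mod_id_def)
  have cmult: "\<exists>r\<in>carrier R. \<forall>i<m. \<forall>l<m. \<forall>x\<in>carrier M. c i j (a (c k l x)) = base_smult A M r (c i l x)"
    if a: "a \<in> mod_hom A M M" and j: "j < m" and k: "k < m" for a j k
  proof -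
    \<comment> \<open>This endomorphism of \<open>W\<close> is multiplication by some
      \<open>r\<close>; the product formula follows by applying \<open>\<phi> i\<close> to its value
      at \<open>w l\<close>. Scalars from the opposite ring act on the regular module by
      precomposition, so \<open>c i j\<close> ends up outermost.\<close>
    define f where "f = (\<lambda>u\<in>carrier W. compose (carrier M) a (?v (\<phi> k u)) \<odot>\<^bsub>W\<^esub> w j)"
    have pk: "\<phi> k u \<in> carrier ?L" if "u \<in> carrier W" for u by (rule mod_homD(1)[OF \<phi>[OF k] that])
    have av: "compose (carrier M) a (?v t) \<in> carrier ?E" if "t \<in> carrier ?L" for t
      using mod_hom_compose[OF M vL[OF that] a] by simp
    have "f \<in> mod_hom ?E W W"
    proof (rule mod_homI)
      fix u assume u: "u \<in> carrier W"
      show "f u \<in> carrier W" using W.lsmult_closed[OF av[OF pk[OF u]] w[OF j]] u by (simp add: f_def)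
    next
      fix u u' assume u: "u \<in> carrier W" "u' \<in> carrier W"
      have "compose (carrier M) a (?v (\<phi> k (u \<oplus>\<^bsub>W\<^esub> u'))) =
          compose (carrier M) a (?v (\<phi> k u)) \<oplus>\<^bsub>?E\<^esub> compose (carrier M) a (?v (\<phi> k u'))"
        using mod_homD(2)[OF \<phi>[OF k] u] E.l_distr[of "?v (\<phi> k u)" "?v (\<phi> k u')" a] vL[OF pk[OF u(1)]]
          vL[OF pk[OF u(2)]] a by simp
      then show "f (u \<oplus>\<^bsub>W\<^esub> u') = f u \<oplus>\<^bsub>W\<^esub> f u'"
        using W.lsmult_l_distr[OF av[OF pk[OF u(1)]] av[OF pk[OF u(2)]] w[OF j]] u by (simp add: f_def)
    next
      fix e u assume e: "e \<in> carrier ?E" and u: "u \<in> carrier W"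
      have "compose (carrier M) a (?v (\<phi> k (e \<odot>\<^bsub>W\<^esub> u))) = e \<otimes>\<^bsub>?E\<^esub> compose (carrier M) a (?v (\<phi> k u))"
        using mod_homD(3)[OF \<phi>[OF k] e u] E.m_assoc[of e "?v (\<phi> k u)" a] vL[OF pk[OF u]] a e by simp
      then show "f (e \<odot>\<^bsub>W\<^esub> u) = e \<odot>\<^bsub>W\<^esub> f u"
        using W.lsmult_assoc[OF e av[OF pk[OF u]] w[OF j]] W.lsmult_closed[OF e u] u
        by (simp add: f_def del: op_end_algebra_simps)
    qed (simp add: f_def)
    from endo[OF this] obtain r where r: "r \<in> carrier R"
      "\<And>u. u \<in> carrier W \<Longrightarrow> f u = (r \<odot>\<^bsub>?E\<^esub> \<one>\<^bsub>?E\<^esub>) \<odot>\<^bsub>W\<^esub> u" by blast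
    have rE: "r \<odot>\<^bsub>?E\<^esub> \<one>\<^bsub>?E\<^esub> \<in> carrier ?E" using smh[OF r(1)] by simp
    show ?thesis
    proof (intro bexI[OF _ r(1)] allI impI ballI)
      fix i l x assume i: "i < m" and l: "l < m" and x: "x \<in> carrier M"
      have "\<phi> i (f (w l)) = compose (carrier M) a (c k l) \<odot>\<^bsub>?L\<^esub> \<phi> i (w j)"
        using mod_homD(3)[OF \<phi>[OF i] av[OF pk[OF w[OF l]]] w[OF j]] w[OF l] by (simp add: f_def c_def)
      moreover have "\<phi> i (f (w l)) = (r \<odot>\<^bsub>?E\<^esub> \<one>\<^bsub>?E\<^esub>) \<odot>\<^bsub>?L\<^esub> \<phi> i (w l)"
        using mod_homD(3)[OF \<phi>[OF i] rE w[OF l]] r(2)[OF w[OF l]] by simp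
      ultimately have "ins (compose (carrier M) (c i j) (compose (carrier M) a (c k l))) =
          ins (compose (carrier M) (c i l) (hom_smult A M M r (mod_id M)))"
        by (simp add: ic[OF i j, symmetric] ic[OF i l, symmetric])
      then have "compose (carrier M) (c i j) (compose (carrier M) a (c k l)) x =
          compose (carrier M) (c i l) (hom_smult A M M r (mod_id M)) x"
        using ins by (simp add: inj_eq)
      then show "c i j (a (c k l x)) = base_smult A M r (c i l x)"
        using x mod_homD(3)[OF c[OF i l] rone[OF r(1)] x] by (simp add: compose_def sc base_smult_def)
    qed
  qed
  show thesis by (rule that[of m c]) (fact c, fact csum, fact cmult)
qed

section \<open>Local Noetherian rings\<close>

lemma (in cring) ideal_iff_submodule: "submodule I R (regular_module R) \<longleftrightarrow> ideal I R"
proof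
  interpret M: left_module R "regular_module R" by (rule regular_left_module)
  assume I: "submodule I R (regular_module R)"
  have sub: "x \<in> carrier R" if "x \<in> I" for x using M.submodule_closed[OF I that] by simp
  show "ideal I R"
  proof (rule idealI[OF ring_axioms])
    show "subgroup I (add_monoid R)"
    proof (rule subgroup.intro)
      show "I \<subseteq> carrier (add_monoid R)" using sub by auto
      show "x \<otimes>\<^bsub>add_monoid R\<^esub> y \<in> I" if "x \<in> I" "y \<in> I" for x y
        using M.submodule_add[OF I that] by simp
      show "\<one>\<^bsub>add_monoid R\<^esub> \<in> I" using M.submodule_zero[OF I] by simp
      show "inv\<^bsub>add_monoid R\<^esub> x \<in> I" if "x \<in> I" for x
        using M.submodule_neg[OF I that] sub[OF that] by (simp add: a_inv_def[symmetric])
    qed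
    show l: "x \<otimes> a \<in> I" if "a \<in> I" "x \<in> carrier R" for a x
      using M.submodule_smult[OF I that(2,1)] by simp
    show "a \<otimes> x \<in> I" if "a \<in> I" "x \<in> carrier R" for a x
      using l[OF that] m_comm[OF that(2) sub[OF that(1)]] by simp
  qed
next
  interpret M: left_module R "regular_module R" by (rule regular_left_module)
  assume "ideal I R"
  then interpret I: ideal I R .
  show "submodule I R (regular_module R)"
    by (rule M.submoduleI) (use I.Icarr I.I_l_closed in auto)
qed

text \<open>In a Noetherian ring the union of a chain of ideals belongs to the chain; the index
  where it occurs is where the sequence becomes stationary.\<close>

lemma noetherian_acc:
  assumes "cring R" "noetherian_ring R"
  shows "acc {I. submodule I R (regular_module R)}"
  unfolding acc_def
proof (intro allI impI)
  interpret noetherian_ring R by fact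
  interpret cring R by fact
  fix N :: "nat \<Rightarrow> _"
  assume N: "\<forall>k. N k \<in> {I. submodule I R (regular_module R)} \<and> N k \<subseteq> N (Suc k)"
  have mono: "N k \<subseteq> N m" if "k \<le> m" for k m using N lift_Suc_mono_le[of N] that by simp
  have ideal: "ideal (N k) R" for k using N ideal_iff_submodule by blast
  have "range N \<noteq> {}" by simp
  moreover have "subset.chain {I. ideal I R} (range N)"
    unfolding subset_chain_def
  proof (intro conjI ballI)
    show "range N \<subseteq> {I. ideal I R}" using ideal by blast
    fix U V assume "U \<in> range N" "V \<in> range N"
    then obtain k m where "U = N k" "V = N m" by blast
    then show "U \<subseteq> V \<or> V \<subseteq> U" using mono[of k m] mono[of m k] by (cases "k \<le> m") auto
  qed
  ultimately have "\<Union> (range N) \<in> range N" by (rule ideal_chain_is_trivial)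
  then obtain k where k: "\<Union> (range N) = N k" by blast
  have "N m = N k" if "m \<ge> k" for m using mono[OF that] k by blast
  then show "\<exists>k. \<forall>m\<ge>k. N m = N k" by blast
qed

text \<open>If \<open>t\<close> and \<open>1 - r t\<close> were both nonunits, both would lie in the
  unique maximal ideal, and so would \<open>1\<close>. Maximal ideals containing a given nonunit
  come from the chain condition.\<close>

lemma local_ring_unit:
  assumes R: "local_ring R" "noetherian_ring R"
    and t: "t \<in> carrier R" "t \<notin> Units R" and r: "r \<in> carrier R"
  shows "\<one>\<^bsub>R\<^esub> \<ominus>\<^bsub>R\<^esub> r \<otimes>\<^bsub>R\<^esub> t \<in> Units R"
proof (rule ccontr)
  interpret cring R using R by (simp add: local_ring_def)
  interpret M: left_module R "regular_module R" by (rule regular_left_module)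
  assume q: "\<one>\<^bsub>R\<^esub> \<ominus>\<^bsub>R\<^esub> r \<otimes>\<^bsub>R\<^esub> t \<notin> Units R"
  have ex: "\<exists>I. maximalideal I R \<and> x \<in> I" if x: "x \<in> carrier R" "x \<notin> Units R" for x
  proof -
    have P: "ideal (PIdl\<^bsub>R\<^esub> x) R" by (rule cgenideal_ideal[OF x(1)])
    have "\<one>\<^bsub>R\<^esub> \<notin> PIdl\<^bsub>R\<^esub> x"
    proof
      assume "\<one>\<^bsub>R\<^esub> \<in> PIdl\<^bsub>R\<^esub> x"
      then obtain y where "y \<in> carrier R" "\<one>\<^bsub>R\<^esub> = y \<otimes>\<^bsub>R\<^esub> x" by (auto simp: cgenideal_def)
      then have "x \<in> Units R" using x m_comm unfolding Units_def by auto
      then show False using x by simp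
    qed
    then have "PIdl\<^bsub>R\<^esub> x \<noteq> carrier (regular_module R)" by auto
    then obtain N where N: "maximal_submodule R (regular_module R) N" "PIdl\<^bsub>R\<^esub> x \<subseteq> N"
      by (rule M.maximal_submodule_exists[OF noetherian_acc[OF is_cring R(2)] ideal_iff_submodule[THEN iffD2, OF P]])
    then have "ideal N R" by (simp add: maximal_submodule_def ideal_iff_submodule)
    moreover have "J = N \<or> J = carrier R" if "ideal J R" "N \<subseteq> J" for J
      using N(1) that by (simp add: maximal_submodule_def ideal_iff_submodule)
    ultimately have "maximalideal N R"
      using N(1) by (intro maximalidealI) (auto simp: maximal_submodule_def)
    moreover have "x \<in> N" using N(2) cgenideal_self[OF x(1)] by blast
    ultimately show ?thesis by blast
  qed
  have qc: "\<one>\<^bsub>R\<^esub> \<ominus>\<^bsub>R\<^esub> r \<otimes>\<^bsub>R\<^esub> t \<in> carrier R" using r t by simp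
  obtain I where I: "maximalideal I R" "\<one>\<^bsub>R\<^esub> \<ominus>\<^bsub>R\<^esub> r \<otimes>\<^bsub>R\<^esub> t \<in> I" using ex[OF qc q] by blast
  have "t \<in> I" using ex[OF t] I(1) R(1) unfolding local_ring_def by blast
  interpret I: maximalideal I R by (rule I)
  have "(\<one>\<^bsub>R\<^esub> \<ominus>\<^bsub>R\<^esub> r \<otimes>\<^bsub>R\<^esub> t) \<oplus>\<^bsub>R\<^esub> r \<otimes>\<^bsub>R\<^esub> t \<in> I"
    using I(2) I.I_l_closed[OF \<open>t \<in> I\<close> r] I.a_closed by blast
  moreover have "(\<one>\<^bsub>R\<^esub> \<ominus>\<^bsub>R\<^esub> r \<otimes>\<^bsub>R\<^esub> t) \<oplus>\<^bsub>R\<^esub> r \<otimes>\<^bsub>R\<^esub> t = \<one>\<^bsub>R\<^esub>"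
    using r t by (simp add: a_minus_def a_assoc l_neg)
  ultimately show False using I.I_notcarr I.one_imp_carrier by simp
qed

section \<open>Projective modules and dual bases\<close>

text \<open>Adjoining an element to a finitely generated submodule keeps it finitely generated, so a
  maximal one among these is the whole module. This applies to heredity ideals.\<close>

lemma (in left_module) fin_gen_of_acc:
  assumes acc: "acc {N. submodule N A M}" shows "fin_gen_module A M"
proof -
  let ?F = "\<lambda>U. submodule U A M \<and> (\<exists>S\<subseteq>U. finite S \<and> (\<forall>N. submodule N A M \<and> S \<subseteq> N \<longrightarrow> U \<subseteq> N))"
  have "Collect ?F \<subseteq> {N. submodule N A M}" by auto
  moreover have "{\<zero>\<^bsub>M\<^esub>} \<in> Collect ?F"
    using submodule_trivial submodule_zero by (auto intro!: exI[of _ "{}"])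
  ultimately show ?thesis
  proof (rule acc_maximal[OF acc])
    fix Y assume Y: "Y \<in> Collect ?F" and max: "\<And>Z. Z \<in> Collect ?F \<Longrightarrow> Y \<subseteq> Z \<Longrightarrow> Z = Y"
    have sY: "submodule Y A M" using Y by simp
    have "\<exists>S\<subseteq>Y. finite S \<and> (\<forall>N. submodule N A M \<and> S \<subseteq> N \<longrightarrow> Y \<subseteq> N)" using Y by simp
    then obtain S where S: "S \<subseteq> Y" "finite S"
      and S': "\<forall>N. submodule N A M \<and> S \<subseteq> N \<longrightarrow> Y \<subseteq> N" by (elim exE conjE) (rule that)
    have "x \<in> Y" if x: "x \<in> carrier M" for x
    proof -
      let ?V = "{a \<odot>\<^bsub>M\<^esub> x \<oplus>\<^bsub>M\<^esub> n | a n. a \<in> carrier A \<and> n \<in> Y}"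
      note V = submodule_adjoin[OF sY x]
      have "?V \<subseteq> N" if N: "submodule N A M" "insert x S \<subseteq> N" for N
      proof -
        have "Y \<subseteq> N" using S' N by simp
        show ?thesis
        proof
          fix v assume "v \<in> ?V"
          then obtain a m where am: "a \<in> carrier A" "m \<in> Y" "v = a \<odot>\<^bsub>M\<^esub> x \<oplus>\<^bsub>M\<^esub> m" by blast
          have "a \<odot>\<^bsub>M\<^esub> x \<in> N" using submodule_smult[OF N(1) am(1)] N(2) by simp
          moreover have "m \<in> N" using am(2) \<open>Y \<subseteq> N\<close> by (rule subsetD[rotated])
          ultimately show "v \<in> N" unfolding am(3) by (rule submodule_add[OF N(1)])
        qed
      qed
      moreover have "insert x S \<subseteq> ?V" using V(2,3) S(1) by simp
      ultimately have "?F ?V" using V(1) S(2)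
        by (intro conjI exI[of _ "insert x S"]) simp_all
      then have "?V = Y" using max[OF CollectI V(2)] by meson
      then show ?thesis using V(3) by metis
    qed
    then have "Y = carrier M" using submodule_subset[OF sY] by blast
    moreover have "N = carrier M" if "submodule N A M" "S \<subseteq> N" for N
      using S' that calculation submodule_subset[OF that(1)] by blast
    ultimately show ?thesis
      using S(1,2) unfolding fin_gen_module_def by (intro exI[of _ S]) simp
  qed
qed

lemma submodule_image:
  assumes "left_module A M" "left_module A N" "f \<in> mod_hom A M N"
  shows "submodule (f ` carrier M) A N"
proof -
  interpret M: left_module A M by fact
  interpret N: left_module A N by fact
  note f = mod_homD[OF assms(3)]
  show ?thesis
  proof (rule N.submoduleI)
    show "f ` carrier M \<subseteq> carrier N" using f(1) by auto
    show "\<zero>\<^bsub>N\<^esub> \<in> f ` carrier M"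
      by (rule image_eqI[of _ _ "\<zero>\<^bsub>M\<^esub>"]) (simp_all add: mod_hom_zero[OF assms])
    show "x \<oplus>\<^bsub>N\<^esub> y \<in> f ` carrier M" if xy: "x \<in> f ` carrier M" "y \<in> f ` carrier M" for x y
    proof -
      obtain v w where "v \<in> carrier M" "w \<in> carrier M" "x = f v" "y = f w" using xy by auto
      then show ?thesis by (intro image_eqI[of _ _ "v \<oplus>\<^bsub>M\<^esub> w"]) (simp_all add: f(2))
    qed
    show "a \<odot>\<^bsub>N\<^esub> x \<in> f ` carrier M" if a: "a \<in> carrier A" and x: "x \<in> f ` carrier M" for a x
    proof -
      obtain v where "v \<in> carrier M" "x = f v" using x by auto
      then show ?thesis using a by (intro image_eqI[of _ _ "a \<odot>\<^bsub>M\<^esub> v"]) (simp_all add: f(3))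
    qed
  qed
qed

lemma (in left_module) free_module_surjection:
  assumes u: "\<And>i. i \<in> I \<Longrightarrow> u i \<in> carrier M"
    and gen: "\<And>N. submodule N A M \<Longrightarrow> u ` I \<subseteq> N \<Longrightarrow> N = carrier M"
  obtains e where "e \<in> mod_hom A (free_module A I) M" "e ` carrier (free_module A I) = carrier M"
    and "\<And>c. c \<in> carrier (free_module A I) \<Longrightarrow> e c = lin_comb A M u c"
proof -
  let ?F = "free_module A I"
  interpret F: left_module A ?F by (rule free_module_left_module)
  define e where "e = restrict (lin_comb A M u) (carrier ?F)"
  have e: "e \<in> mod_hom A ?F M" unfolding e_def by (rule lin_comb_hom[OF u])
  have "submodule (e ` carrier ?F) A M" by (rule submodule_image[OF F.left_module_axioms left_module_axioms e])
  moreover have "u ` I \<subseteq> e ` carrier ?F"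
  proof
    fix x assume "x \<in> u ` I"
    then obtain j where j: "j \<in> I" "x = u j" by auto
    let ?c = "\<lambda>i. if i = j then \<one>\<^bsub>A\<^esub> else \<zero>\<^bsub>A\<^esub>"
    have "finite {i. ?c i \<noteq> \<zero>\<^bsub>A\<^esub>}" by (rule finite_subset[of _ "{j}"]) auto
    then have c: "?c \<in> carrier ?F" using j by (auto simp: free_module_def)
    have "lin_comb A M u ?c = (\<Oplus>\<^bsub>M\<^esub>i\<in>{j}. ?c i \<odot>\<^bsub>M\<^esub> u i)"
      by (rule lin_comb_eq) (use u j in auto)
    then have "e ?c = x" using c j u by (simp add: e_def)
    then show "x \<in> e ` carrier ?F" using c by blast
  qed
  ultimately have "e ` carrier ?F = carrier M" by (rule gen)
  then show thesis by (rule that[OF e]) (simp add: e_def)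
qed

text \<open>The coordinates of a section of a surjection from a finite free module serve as the
  functionals. The section needs \<open>projective_module_lift\<close>, as this free module has
  elements of type \<open>nat \<Rightarrow> 'a\<close>, not the type in the definition of
  projectivity.\<close>

lemma projective_dual_basis:
  assumes P: "projective_module A P" and fg: "fin_gen_module A P"
  obtains n u s where "dual_basis A P n u s"
proof -
  have lP: "left_module A P" using P by (simp add: projective_module_def)
  interpret P: left_module A P by fact
  obtain S where S: "S \<subseteq> carrier P" "finite S" "\<And>N. submodule N A P \<Longrightarrow> S \<subseteq> N \<Longrightarrow> N = carrier P"
    using fg unfolding fin_gen_module_def by metis
  obtain u :: "nat \<Rightarrow> _" and n where u: "S = u ` {..<n}"
    using finite_imp_nat_seg_image_inj_on[OF S(2)] by (auto simp: lessThan_def)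
  have uP: "u i \<in> carrier P" if "i \<in> {..<n}" for i using S(1) u that by blast
  let ?F = "free_module A {..<n}"
  interpret F: left_module A ?F by (rule P.free_module_left_module)
  obtain e where e: "e \<in> mod_hom A ?F P" and surj: "e ` carrier ?F = carrier P"
    and lin: "\<And>c. c \<in> carrier ?F \<Longrightarrow> e c = lin_comb A P u c"
    by (rule P.free_module_surjection[where I = "{..<n}" and u = u])
      (rule uP, assumption, rule S(3)[unfolded u], assumption+, rule that)
  have eq: "e c = (\<Oplus>\<^bsub>P\<^esub>i\<in>{..<n}. c i \<odot>\<^bsub>P\<^esub> u i)" if c: "c \<in> carrier ?F" for c
    using P.lin_comb_eq[of "{..<n}" c u] P.free_module_carrierD[OF c] uP lin[OF c] by simp
  obtain s where s: "s \<in> mod_hom A P ?F" "compose (carrier P) e s = mod_id P"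
    using projective_module_lift[OF P F.left_module_axioms lP e surj mod_id_hom[OF lP]] by blast
  have "dual_basis A P n u (\<lambda>i. \<lambda>x\<in>carrier P. s x i)"
    unfolding dual_basis_def
  proof (intro conjI allI impI ballI)
    fix i assume "i < n"
    then show "u i \<in> carrier P" using uP by simp
    show "(\<lambda>x\<in>carrier P. s x i) \<in> mod_hom A P (regular_module A)"
    proof (rule mod_homI)
      fix x assume x: "x \<in> carrier P"
      show "(\<lambda>x\<in>carrier P. s x i) x \<in> carrier (regular_module A)"
        using P.free_module_carrierD(2)[OF mod_homD(1)[OF s(1) x]] x by simp
    qed (use mod_homD(2,3)[OF s(1)] in \<open>auto simp: free_module_def\<close>)
  next
    fix x assume x: "x \<in> carrier P"
    have "x = e (s x)" using fun_cong[OF s(2), of x] x by (simp add: compose_def mod_id_def)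
    also have "\<dots> = (\<Oplus>\<^bsub>P\<^esub>i\<in>{..<n}. s x i \<odot>\<^bsub>P\<^esub> u i)" by (rule eq[OF mod_homD(1)[OF s(1) x]])
    finally show "x = (\<Oplus>\<^bsub>P\<^esub>i\<in>{..<n}. (\<lambda>x\<in>carrier P. s x i) x \<odot>\<^bsub>P\<^esub> u i)" using x by simp
  qed
  then show thesis by (rule that)
qed

text \<open>Lifts are chosen for the images of the generators \<open>u i\<close> and combined by
  \<open>coordinate_hom\<close>; two homomorphisms that agree on the generators are equal.\<close>

lemma dual_basis_projective:
  fixes P :: "('a, 'p) module"
  assumes lP: "left_module A P" and b: "dual_basis A P n u s"
  shows "projective_module A P"
  unfolding projective_module_def
proof (intro conjI allI ballI impI lP)
  interpret P: left_module A P by fact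
  fix N :: "('a, 'p \<Rightarrow> 'a) module" and M :: "('a, 'p) module" and g h
  assume g: "g \<in> mod_hom A N M" and h: "h \<in> mod_hom A P M"
    and NM: "left_module A N \<and> left_module A M \<and> g ` carrier N = carrier M"
  interpret N: left_module A N using NM by simp
  interpret M: left_module A M using NM by simp
  have u: "u i \<in> carrier P" and s: "s i \<in> mod_hom A P (regular_module A)" if "i < n" for i
    using b that by (auto simp: dual_basis_def)
  have "\<forall>i. \<exists>v. i < n \<longrightarrow> v \<in> carrier N \<and> g v = h (u i)"
    using NM mod_homD(1)[OF h u] by (metis imageE)
  then obtain v where v: "\<And>i. i < n \<Longrightarrow> v i \<in> carrier N" "\<And>i. i < n \<Longrightarrow> g (v i) = h (u i)" by metis
  define k where "k = (\<lambda>x\<in>carrier P. \<Oplus>\<^bsub>N\<^esub>i\<in>{..<n}. s i x \<odot>\<^bsub>N\<^esub> v i)"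
  have k: "k \<in> mod_hom A P N"
    unfolding k_def by (rule coordinate_hom[OF lP N.left_module_axioms s v(1)])
  have "compose (carrier P) g k = h"
  proof (rule mod_hom_ext[OF mod_hom_compose[OF lP k g] h])
    fix x assume x: "x \<in> carrier P"
    have sx: "s i x \<in> carrier A" if "i < n" for i using mod_homD(1)[OF s[OF that] x] by simp
    have "g (k x) = (\<Oplus>\<^bsub>M\<^esub>i\<in>{..<n}. g (s i x \<odot>\<^bsub>N\<^esub> v i))"
      using mod_hom_finsum[OF N.left_module_axioms M.left_module_axioms g, of "{..<n}" "\<lambda>i. s i x \<odot>\<^bsub>N\<^esub> v i"]
        sx v(1) x by (simp add: k_def)
    also have "\<dots> = (\<Oplus>\<^bsub>M\<^esub>i\<in>{..<n}. s i x \<odot>\<^bsub>M\<^esub> h (u i))"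
      by (rule M.M.add.finprod_cong') (use sx v mod_homD[OF g] mod_homD(1)[OF h u] in auto)
    also have "\<dots> = h x" using dual_basis_hom_eq[OF lP M.left_module_axioms b h x] by simp
    finally show "compose (carrier P) g k x = h x" using x by (simp add: compose_def)
  qed
  then show "\<exists>k\<in>mod_hom A P N. compose (carrier P) g k = h" using k by blast
qed

lemma dual_basis_fin_gen:
  assumes lP: "left_module A P" and b: "dual_basis A P n u s"
  shows "fin_gen_module A P"
proof -
  interpret P: left_module A P by fact
  have u: "u i \<in> carrier P" and s: "s i \<in> mod_hom A P (regular_module A)" if "i < n" for i
    using b that by (auto simp: dual_basis_def)
  have "N = carrier P" if N: "submodule N A P" "u ` {..<n} \<subseteq> N" for N
  proof
    show "carrier P \<subseteq> N"
    proof
      fix x assume x: "x \<in> carrier P"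
      have "(\<Oplus>\<^bsub>P\<^esub>i\<in>{..<n}. s i x \<odot>\<^bsub>P\<^esub> u i) \<in> N"
      proof (rule P.submodule_finsum[OF N(1)])
        fix i assume "i \<in> {..<n}"
        then show "s i x \<odot>\<^bsub>P\<^esub> u i \<in> N"
          using mod_homD(1)[OF s x, of i] N(2) by (intro P.submodule_smult[OF N(1)]) auto
      qed simp
      then show "x \<in> N" using b x by (simp add: dual_basis_def)
    qed
  qed (rule P.submodule_subset[OF N(1)])
  then show ?thesis using u unfolding fin_gen_module_def by (intro exI[of _ "u ` {..<n}"]) auto
qed

lemma (in ring) free_module_dual_basis:
  "dual_basis R (free_module R {..<n}) n (\<lambda>i j. if i = j then \<one> else \<zero>)
    (\<lambda>i. \<lambda>c\<in>carrier (free_module R {..<n}). c i)"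
proof -
  interpret reg: left_module R "regular_module R" by (rule regular_left_module)
  let ?F = "free_module R {..<n}" and ?u = "\<lambda>i j. if i = j then \<one> else \<zero>"
  interpret F: left_module R ?F by (rule reg.free_module_left_module)
  note cD = reg.free_module_carrierD
  have u: "?u i \<in> carrier ?F" if "i < n" for i
  proof -
    have "finite {j. ?u i j \<noteq> \<zero>}" by (rule finite_subset[of _ "{i}"]) auto
    then show ?thesis using that by (auto simp: free_module_def)
  qed
  have s: "(\<lambda>c\<in>carrier ?F. c i) \<in> mod_hom R ?F (regular_module R)" for i
  proof (rule mod_homI)
    fix c d assume c: "c \<in> carrier ?F" and d: "d \<in> carrier ?F"
    have "(c \<oplus>\<^bsub>?F\<^esub> d) i = c i \<oplus> d i" by (simp add: free_module_def)
    then show "(\<lambda>c\<in>carrier ?F. c i) (c \<oplus>\<^bsub>?F\<^esub> d) =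
        (\<lambda>c\<in>carrier ?F. c i) c \<oplus>\<^bsub>regular_module R\<^esub> (\<lambda>c\<in>carrier ?F. c i) d"
      using c d F.M.a_closed[OF c d] by simp
  next
    fix a c assume a: "a \<in> carrier R" and c: "c \<in> carrier ?F"
    have "(a \<odot>\<^bsub>?F\<^esub> c) i = a \<otimes> c i" by (simp add: free_module_def)
    then show "(\<lambda>c\<in>carrier ?F. c i) (a \<odot>\<^bsub>?F\<^esub> c) =
        a \<odot>\<^bsub>regular_module R\<^esub> (\<lambda>c\<in>carrier ?F. c i) c"
      using a c F.lsmult_closed[OF a c] by simp
  qed (use cD(2) in auto)
  have "c = (\<Oplus>\<^bsub>?F\<^esub>i\<in>{..<n}. c i \<odot>\<^bsub>?F\<^esub> ?u i)" if c: "c \<in> carrier ?F" for c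
  proof
    fix j
    have t: "c i \<odot>\<^bsub>?F\<^esub> ?u i \<in> carrier ?F" if "i < n" for i
      by (rule F.lsmult_closed[OF cD(2)[OF c] u[OF that]])
    then have sum: "(\<Oplus>\<^bsub>?F\<^esub>i\<in>{..<n}. c i \<odot>\<^bsub>?F\<^esub> ?u i) \<in> carrier ?F" by (intro F.M.finsum_closed) auto
    have "(\<lambda>c\<in>carrier ?F. c j) (\<Oplus>\<^bsub>?F\<^esub>i\<in>{..<n}. c i \<odot>\<^bsub>?F\<^esub> ?u i) =
        (\<Oplus>\<^bsub>regular_module R\<^esub>i\<in>{..<n}. (\<lambda>c\<in>carrier ?F. c j) (c i \<odot>\<^bsub>?F\<^esub> ?u i))"
      by (rule mod_hom_finsum[OF F.left_module_axioms reg.left_module_axioms s]) (use t in auto)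
    also have "\<dots> = (\<Oplus>i\<in>{..<n}. (\<lambda>c\<in>carrier ?F. c j) (c i \<odot>\<^bsub>?F\<^esub> ?u i))"
      by (rule regular_finsum) (use mod_homD(1)[OF s t] in auto)
    also have "\<dots> = (\<Oplus>i\<in>{..<n}. if j = i then c i else \<zero>)"
    proof (rule add.finprod_cong')
      fix i assume "i \<in> {..<n}"
      then have i: "i < n" by simp
      have "(\<lambda>c\<in>carrier ?F. c j) (c i \<odot>\<^bsub>?F\<^esub> ?u i) = (c i \<odot>\<^bsub>?F\<^esub> ?u i) j" using t[OF i] by simp
      also have "\<dots> = c i \<otimes> ?u i j" by (simp add: free_module_def)
      finally show "(\<lambda>c\<in>carrier ?F. c j) (c i \<odot>\<^bsub>?F\<^esub> ?u i) = (if j = i then c i else \<zero>)"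
        using cD(2)[OF c] by auto
    qed (use cD(2)[OF c] in auto)
    also have "\<dots> = c j"
    proof (cases "j < n")
      case True
      then show ?thesis using finsum_singleton[of j "{..<n}" c] cD(2)[OF c] by auto
    next
      case False
      then have "(\<Oplus>i\<in>{..<n}. if j = i then c i else \<zero>) = (\<Oplus>i\<in>{..<n}. \<zero>)"
        by (intro add.finprod_cong') auto
      then show ?thesis using False cD(3)[OF c, of j] by simp
    qed
    finally show "c j = (\<Oplus>\<^bsub>?F\<^esub>i\<in>{..<n}. c i \<odot>\<^bsub>?F\<^esub> ?u i) j" using sum by simp
  qed
  then show ?thesis unfolding dual_basis_def using u s by auto
qed

text \<open>The idempotent \<open>g\<close> is the identity on its image, so applying it to the
  expansion of an element of the image yields an expansion in the \<open>g (u i)\<close>.\<close>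

lemma summand_dual_basis:
  assumes M: "left_module A M" and b: "dual_basis A M n u s" and g: "g \<in> mod_hom A M M"
    and gg: "\<And>x. x \<in> carrier M \<Longrightarrow> g (g x) = g x"
  shows "submodule (g ` carrier M) A M"
    and "dual_basis A (M\<lparr>carrier := g ` carrier M\<rparr>) n (\<lambda>i. g (u i)) (\<lambda>i. restrict (s i) (g ` carrier M))"
proof -
  interpret M: left_module A M by fact
  note gD = mod_homD[OF g]
  show P: "submodule (g ` carrier M) A M" by (rule submodule_image[OF M M g])
  have u: "u i \<in> carrier M" and s: "s i \<in> mod_hom A M (regular_module A)" if "i < n" for i
    using b that by (auto simp: dual_basis_def)
  have fix_P: "g x = x" "x \<in> carrier M" if "x \<in> g ` carrier M" for x using that gg gD(1) by auto
  show "dual_basis A (M\<lparr>carrier := g ` carrier M\<rparr>) n (\<lambda>i. g (u i)) (\<lambda>i. restrict (s i) (g ` carrier M))"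
    unfolding dual_basis_def
  proof (intro conjI allI impI ballI)
    fix i assume i: "i < n"
    show "g (u i) \<in> carrier (M\<lparr>carrier := g ` carrier M\<rparr>)" using u[OF i] by simp
    show "restrict (s i) (g ` carrier M) \<in> mod_hom A (M\<lparr>carrier := g ` carrier M\<rparr>) (regular_module A)"
      by (rule mod_homI)
        (use mod_homD[OF s[OF i]] fix_P(2) M.submodule_add[OF P] M.submodule_smult[OF P] in auto)
  next
    fix x assume "x \<in> carrier (M\<lparr>carrier := g ` carrier M\<rparr>)"
    then have x: "x \<in> g ` carrier M" by simp
    have sx: "s i x \<in> carrier A" if "i < n" for i using mod_homD(1)[OF s[OF that] fix_P(2)[OF x]] by simp
    have "(\<Oplus>\<^bsub>M\<lparr>carrier := g ` carrier M\<rparr>\<^esub>i\<in>{..<n}. s i x \<odot>\<^bsub>M\<^esub> g (u i)) = (\<Oplus>\<^bsub>M\<^esub>i\<in>{..<n}. s i x \<odot>\<^bsub>M\<^esub> g (u i))"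
      by (rule M.submodule_finsum_eq[OF P]) (use sx u M.submodule_smult[OF P] in auto)
    also have "\<dots> = x" using dual_basis_hom_eq[OF M M b g fix_P(2)[OF x]] fix_P(1)[OF x] by simp
    finally show "x = (\<Oplus>\<^bsub>M\<lparr>carrier := g ` carrier M\<rparr>\<^esub>i\<in>{..<n}.
        restrict (s i) (g ` carrier M) x \<odot>\<^bsub>M\<lparr>carrier := g ` carrier M\<rparr>\<^esub> g (u i))"
      using x by simp
  qed
qed

section \<open>Quotient algebras\<close>

lemma quot_algebra_simps [simp]:
  "carrier (quot_algebra A I) = carrier (A Quot I)" "x \<otimes>\<^bsub>quot_algebra A I\<^esub> y = x \<otimes>\<^bsub>A Quot I\<^esub> y"
  "\<one>\<^bsub>quot_algebra A I\<^esub> = \<one>\<^bsub>A Quot I\<^esub>" "\<zero>\<^bsub>quot_algebra A I\<^esub> = \<zero>\<^bsub>A Quot I\<^esub>"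
  "x \<oplus>\<^bsub>quot_algebra A I\<^esub> y = x \<oplus>\<^bsub>A Quot I\<^esub> y"
  by (simp_all add: quot_algebra_def)

lemma quot_algebra_hom:
  fixes A :: "('r, 'a) module"
  assumes "ideal I A"
  shows "ring_hom_ring A (quot_algebra A I) ((+>\<^bsub>A\<^esub>) I)"
    and "carrier (quot_algebra A I) = (+>\<^bsub>A\<^esub>) I ` carrier A"
    and "\<And>a. a \<in> carrier A \<Longrightarrow> I +>\<^bsub>A\<^esub> a = \<zero>\<^bsub>quot_algebra A I\<^esub> \<longleftrightarrow> a \<in> I"
proof -
  interpret I: ideal I A by fact
  interpret Q: ring "A Quot I" by (rule I.quotient_is_ring)
  let ?B = "quot_algebra A I"
  have "abelian_group ?B"
  proof (rule abelian_groupI)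
    fix x assume "x \<in> carrier ?B"
    then show "\<exists>y\<in>carrier ?B. y \<oplus>\<^bsub>?B\<^esub> x = \<zero>\<^bsub>?B\<^esub>"
      by (intro bexI[of _ "\<ominus>\<^bsub>A Quot I\<^esub> x"]) (auto simp: Q.l_neg)
  qed (auto simp: Q.a_ac)
  moreover have "Group.monoid ?B"
    by (rule monoidI) (auto simp: Q.m_assoc)
  ultimately have B: "ring ?B"
    by (rule ringI) (auto simp: Q.l_distr Q.r_distr)
  show "ring_hom_ring A ?B ((+>\<^bsub>A\<^esub>) I)"
    using I.rcos_ring_hom by (intro ring_hom_ringI2 I.ring_axioms B) (auto simp: ring_hom_def)
  show "carrier ?B = (+>\<^bsub>A\<^esub>) I ` carrier A"
    by (auto simp: FactRing_def A_RCOSETS_def')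
  show "I +>\<^bsub>A\<^esub> a = \<zero>\<^bsub>?B\<^esub> \<longleftrightarrow> a \<in> I" if "a \<in> carrier A" for a
    using I.a_rcos_self[OF that] I.a_rcos_const[of a] by (auto simp: FactRing_def)
qed

lemma quot_algebra_nc_algebra:
  fixes R :: "('r, 's) ring_scheme" and A :: "('r, 'a) module"
  assumes alg: "nc_algebra R A" and I: "ideal I A"
  shows "nc_algebra R (quot_algebra A I)"
    and "\<And>r a. r \<in> carrier R \<Longrightarrow> a \<in> carrier A \<Longrightarrow>
      r \<odot>\<^bsub>quot_algebra A I\<^esub> (I +>\<^bsub>A\<^esub> a) = I +>\<^bsub>A\<^esub> (r \<odot>\<^bsub>A\<^esub> a)"
proof -
  interpret R: cring R using alg by (simp add: nc_algebra_def module_def)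
  interpret A: ring A using alg by (simp add: nc_algebra_def)
  interpret alg: nc_algebra R A by fact
  interpret I: ideal I A by fact
  let ?B = "quot_algebra A I"
  interpret h: ring_hom_ring A ?B "(+>\<^bsub>A\<^esub>) I" by (rule quot_algebra_hom[OF I])
  note surj = quot_algebra_hom(2)[OF I] and ker = quot_algebra_hom(3)[OF I]
  have Ism: "r \<odot>\<^bsub>A\<^esub> a \<in> I" if "r \<in> carrier R" "a \<in> I" for r a
  proof -
    have "(r \<odot>\<^bsub>A\<^esub> \<one>\<^bsub>A\<^esub>) \<otimes>\<^bsub>A\<^esub> a \<in> I" using that I.I_l_closed by simp
    then show ?thesis using that I.Icarr by (simp add: alg.smult_mult_l)
  qed
  show sm: "r \<odot>\<^bsub>?B\<^esub> (I +>\<^bsub>A\<^esub> a) = I +>\<^bsub>A\<^esub> (r \<odot>\<^bsub>A\<^esub> a)"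
    if r: "r \<in> carrier R" and a: "a \<in> carrier A" for r a
  proof -
    \<comment> \<open>The scalar action on a coset is defined as a union over its representatives.
      All cosets in this union coincide because \<open>I\<close> is stable under
      \<open>R\<close>.\<close>
    have *: "I +>\<^bsub>A\<^esub> (r \<odot>\<^bsub>A\<^esub> y) = I +>\<^bsub>A\<^esub> (r \<odot>\<^bsub>A\<^esub> a)" if y: "y \<in> I +>\<^bsub>A\<^esub> a" for y
    proof -
      obtain z where z: "z \<in> I" "y = z \<oplus>\<^bsub>A\<^esub> a" using y by (auto simp: a_r_coset_def')
      have zA: "z \<in> carrier A" using z I.Icarr by blast
      have "I +>\<^bsub>A\<^esub> (r \<odot>\<^bsub>A\<^esub> y) = (I +>\<^bsub>A\<^esub> (r \<odot>\<^bsub>A\<^esub> z)) \<oplus>\<^bsub>?B\<^esub> (I +>\<^bsub>A\<^esub> (r \<odot>\<^bsub>A\<^esub> a))"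
        using z(2) zA r a h.hom_add[of "r \<odot>\<^bsub>A\<^esub> z" "r \<odot>\<^bsub>A\<^esub> a"] by (simp add: alg.smult_r_distr)
      also have "I +>\<^bsub>A\<^esub> (r \<odot>\<^bsub>A\<^esub> z) = \<zero>\<^bsub>?B\<^esub>" using ker[of "r \<odot>\<^bsub>A\<^esub> z"] Ism[OF r z(1)] r zA by simp
      also have "\<zero>\<^bsub>?B\<^esub> \<oplus>\<^bsub>?B\<^esub> (I +>\<^bsub>A\<^esub> (r \<odot>\<^bsub>A\<^esub> a)) = I +>\<^bsub>A\<^esub> (r \<odot>\<^bsub>A\<^esub> a)"
        by (rule h.S.l_zero) (rule h.hom_closed, use r a in simp)
      finally show ?thesis .
    qed
    have "r \<odot>\<^bsub>?B\<^esub> (I +>\<^bsub>A\<^esub> a) = (\<Union>y\<in>I +>\<^bsub>A\<^esub> a. I +>\<^bsub>A\<^esub> (r \<odot>\<^bsub>A\<^esub> y))"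
      by (simp add: quot_algebra_def)
    also have "\<dots> = (\<Union>y\<in>I +>\<^bsub>A\<^esub> a. I +>\<^bsub>A\<^esub> (r \<odot>\<^bsub>A\<^esub> a))" by (rule SUP_cong[OF refl *])
    also have "\<dots> = I +>\<^bsub>A\<^esub> (r \<odot>\<^bsub>A\<^esub> a)" using I.a_rcos_self[OF a] by blast
    finally show ?thesis .
  qed
  have hadd: "(I +>\<^bsub>A\<^esub> a) \<oplus>\<^bsub>?B\<^esub> (I +>\<^bsub>A\<^esub> b) = I +>\<^bsub>A\<^esub> (a \<oplus>\<^bsub>A\<^esub> b)"
    and hmult: "(I +>\<^bsub>A\<^esub> a) \<otimes>\<^bsub>?B\<^esub> (I +>\<^bsub>A\<^esub> b) = I +>\<^bsub>A\<^esub> (a \<otimes>\<^bsub>A\<^esub> b)"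
    if "a \<in> carrier A" "b \<in> carrier A" for a b
    using h.hom_add[OF that] h.hom_mult[OF that] by simp_all
  have B: "\<exists>a\<in>carrier A. x = I +>\<^bsub>A\<^esub> a" if "x \<in> carrier ?B" for x using that surj by auto
  have "module R ?B"
  proof (rule moduleI[OF R.is_cring h.S.is_abelian_group])
    fix r x assume r: "r \<in> carrier R" and "x \<in> carrier ?B"
    then obtain a where "a \<in> carrier A" "x = I +>\<^bsub>A\<^esub> a" using B by blast
    then show "r \<odot>\<^bsub>?B\<^esub> x \<in> carrier ?B" using sm[OF r] h.hom_closed[of "r \<odot>\<^bsub>A\<^esub> a"] r by simp
  next
    fix r q x assume r: "r \<in> carrier R" "q \<in> carrier R" and "x \<in> carrier ?B"
    then obtain a where a: "a \<in> carrier A" "x = I +>\<^bsub>A\<^esub> a" using B by blast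
    show "(r \<oplus>\<^bsub>R\<^esub> q) \<odot>\<^bsub>?B\<^esub> x = r \<odot>\<^bsub>?B\<^esub> x \<oplus>\<^bsub>?B\<^esub> q \<odot>\<^bsub>?B\<^esub> x"
      using a r by (simp add: sm hadd alg.smult_l_distr del: h.hom_add quot_algebra_simps)
    show "(r \<otimes>\<^bsub>R\<^esub> q) \<odot>\<^bsub>?B\<^esub> x = r \<odot>\<^bsub>?B\<^esub> (q \<odot>\<^bsub>?B\<^esub> x)"
      using a r sm by (simp add: alg.smult_assoc1)
  next
    fix r x y assume r: "r \<in> carrier R" and "x \<in> carrier ?B" "y \<in> carrier ?B"
    then obtain a b where a: "a \<in> carrier A" "x = I +>\<^bsub>A\<^esub> a" and b: "b \<in> carrier A" "y = I +>\<^bsub>A\<^esub> b"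
      using B by metis
    show "r \<odot>\<^bsub>?B\<^esub> (x \<oplus>\<^bsub>?B\<^esub> y) = r \<odot>\<^bsub>?B\<^esub> x \<oplus>\<^bsub>?B\<^esub> r \<odot>\<^bsub>?B\<^esub> y"
      using a b r by (simp add: sm hadd alg.smult_r_distr del: h.hom_add quot_algebra_simps)
  next
    fix x assume "x \<in> carrier ?B"
    then obtain a where a: "a \<in> carrier A" "x = I +>\<^bsub>A\<^esub> a" using B by blast
    then show "\<one>\<^bsub>R\<^esub> \<odot>\<^bsub>?B\<^esub> x = x" using sm by simp
  qed
  then show "nc_algebra R ?B"
  proof (intro nc_algebra.intro nc_algebra_axioms.intro h.S.ring_axioms)
    fix r x y assume r: "r \<in> carrier R" and "x \<in> carrier ?B" "y \<in> carrier ?B"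
    then obtain a b where a: "a \<in> carrier A" "x = I +>\<^bsub>A\<^esub> a" and b: "b \<in> carrier A" "y = I +>\<^bsub>A\<^esub> b"
      using B by metis
    show "(r \<odot>\<^bsub>?B\<^esub> x) \<otimes>\<^bsub>?B\<^esub> y = r \<odot>\<^bsub>?B\<^esub> (x \<otimes>\<^bsub>?B\<^esub> y)"
      using a b r by (simp add: sm hmult alg.smult_mult_l del: h.hom_mult quot_algebra_simps)
    show "x \<otimes>\<^bsub>?B\<^esub> (r \<odot>\<^bsub>?B\<^esub> y) = r \<odot>\<^bsub>?B\<^esub> (x \<otimes>\<^bsub>?B\<^esub> y)"
      using a b r by (simp add: sm hmult alg.smult_mult_r del: h.hom_mult quot_algebra_simps)
  qed
qed

lemma acc_surj:
  assumes M: "left_module A M" and N: "left_module A N" and f: "f \<in> mod_hom A M N"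
    and surj: "f ` carrier M = carrier N" and acc: "acc {U. submodule U A M}"
  shows "acc {U. submodule U A N}"
  unfolding acc_def
proof (intro allI impI)
  interpret N: left_module A N by fact
  fix U :: "nat \<Rightarrow> _"
  assume U: "\<forall>k. U k \<in> {U. submodule U A N} \<and> U k \<subseteq> U (Suc k)"
  let ?V = "\<lambda>k. {x \<in> carrier M. f x \<in> U k}"
  have "submodule (?V k) A M" for k by (rule submodule_vimage[OF M N f]) (use U in simp)
  then have "\<forall>k. ?V k \<in> {U. submodule U A M} \<and> ?V k \<subseteq> ?V (Suc k)" using U by auto
  then have "\<exists>k. \<forall>m\<ge>k. ?V m = ?V k" using acc[unfolded acc_def, THEN spec, of ?V] by simp
  then obtain k where k: "\<forall>m\<ge>k. ?V m = ?V k" ..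
  have img: "U m = f ` ?V m" for m
    using U surj N.submodule_subset[of "U m"] by auto
  have "U m = U k" if "m \<ge> k" for m
  proof -
    have "U m = f ` ?V m" by (rule img)
    also have "\<dots> = f ` ?V k" by (rule arg_cong[OF k[rule_format, OF that]])
    also have "\<dots> = U k" by (rule img[symmetric])
    finally show ?thesis .
  qed
  then show "\<exists>k. \<forall>m\<ge>k. U m = U k" by blast
qed

section \<open>Maximal left ideals and local lifts along surjective ring homomorphisms\<close>

lemma local_lift_surj:
  assumes h: "ring_hom_ring A B h" and surj: "carrier B = h ` carrier A"
  shows "local_lift A {a \<in> carrier A. h a \<in> I} {a \<in> carrier A. h a \<in> N} \<longleftrightarrow> local_lift B I N"
proof -
  interpret ring_hom_ring A B h by fact
  have diff: "h (a \<ominus>\<^bsub>A\<^esub> b) = h a \<ominus>\<^bsub>B\<^esub> h b" if "a \<in> carrier A" "b \<in> carrier A" for a b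
    using that by (simp add: a_minus_def)
  show ?thesis
    unfolding local_lift_def surj by (simp add: diff cong: bex_cong ball_cong)
qed

lemma left_ideal_image:
  assumes h: "ring_hom_ring A B h" and surj: "carrier B = h ` carrier A"
    and V: "submodule V A (regular_module A)"
  shows "submodule (h ` V) B (regular_module B)"
proof -
  interpret h: ring_hom_ring A B h by fact
  interpret rA: left_module A "regular_module A" by (rule h.R.regular_left_module)
  interpret rB: left_module B "regular_module B" by (rule h.S.regular_left_module)
  have VA: "v \<in> carrier A" if "v \<in> V" for v using rA.submodule_closed[OF V that] by simp
  show ?thesis
  proof (rule rB.submoduleI)
    show "h ` V \<subseteq> carrier (regular_module B)" using VA by auto
    show "\<zero>\<^bsub>regular_module B\<^esub> \<in> h ` V"
      using rA.submodule_zero[OF V] by (intro image_eqI[of _ _ "\<zero>\<^bsub>A\<^esub>"]) auto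
  next
    fix x y assume "x \<in> h ` V" "y \<in> h ` V"
    then obtain v w where "v \<in> V" "w \<in> V" "x = h v" "y = h w" by auto
    then show "x \<oplus>\<^bsub>regular_module B\<^esub> y \<in> h ` V"
      using rA.submodule_add[OF V, of v w] VA by (intro image_eqI[of _ _ "v \<oplus>\<^bsub>A\<^esub> w"]) auto
  next
    fix b x assume "b \<in> carrier B" "x \<in> h ` V"
    then obtain a v where "a \<in> carrier A" "v \<in> V" "b = h a" "x = h v" using surj by auto
    then show "b \<odot>\<^bsub>regular_module B\<^esub> x \<in> h ` V"
      using rA.submodule_smult[OF V, of a v] VA by (intro image_eqI[of _ _ "a \<otimes>\<^bsub>A\<^esub> v"]) auto
  qed
qed

lemma maximal_left_ideal_vimage:
  assumes h: "ring_hom_ring A B h" and surj: "carrier B = h ` carrier A" and N: "maximal_left_ideal B N"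
  shows "maximal_left_ideal A {a \<in> carrier A. h a \<in> N}" (is "maximal_left_ideal A ?N")
proof -
  interpret h: ring_hom_ring A B h by fact
  interpret rA: left_module A "regular_module A" by (rule h.R.regular_left_module)
  interpret rB: left_module B "regular_module B" by (rule h.S.regular_left_module)
  have sN: "submodule N B (regular_module B)" using N by (simp add: maximal_submodule_def)
  have "submodule ?N A (regular_module A)"
    by (rule rA.submoduleI)
      (use rB.submodule_zero[OF sN] rB.submodule_add[OF sN] rB.submodule_smult[OF sN] in auto)
  moreover have "?N \<noteq> carrier A"
    using N rB.submodule_subset[OF sN] surj by (auto simp: maximal_submodule_def)
  moreover have "V = ?N \<or> V = carrier A" if V: "submodule V A (regular_module A)" "?N \<subseteq> V" for V
  proof -
    have VA: "v \<in> carrier A" if "v \<in> V" for v using rA.submodule_closed[OF V(1) that] by simp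
    have "submodule (h ` V) B (regular_module B)" by (rule left_ideal_image[OF h surj V(1)])
    moreover have "N \<subseteq> h ` V"
    proof
      fix x assume "x \<in> N"
      moreover from this obtain a where "a \<in> carrier A" "x = h a"
        using rB.submodule_closed[OF sN] surj by auto
      ultimately show "x \<in> h ` V" using V(2) by auto
    qed
    ultimately consider "h ` V = N" | "h ` V = carrier B"
      using N unfolding maximal_submodule_def by auto
    then show ?thesis
    proof cases
      case 1
      then have "V \<subseteq> ?N" using VA by auto
      then show ?thesis using V(2) by blast
    next
      case 2
      have "a \<in> V" if a: "a \<in> carrier A" for a
      proof -
        have "h a \<in> h ` V" using 2 a by simp
        then obtain v where v: "v \<in> V" "h a = h v" by auto
        have "h (a \<ominus>\<^bsub>A\<^esub> v) = \<zero>\<^bsub>B\<^esub>" using v a VA by (simp add: a_minus_def h.S.r_neg)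
        then have "a \<ominus>\<^bsub>A\<^esub> v \<in> V" using V(2) rB.submodule_zero[OF sN] a VA[OF v(1)] by auto
        then have "(a \<ominus>\<^bsub>A\<^esub> v) \<oplus>\<^bsub>A\<^esub> v \<in> V" using rA.submodule_add[OF V(1) _ v(1)] by simp
        then show ?thesis using a VA[OF v(1)] by (simp add: a_minus_def h.R.a_assoc h.R.l_neg)
      qed
      then show ?thesis using VA by blast
    qed
  qed
  ultimately show ?thesis unfolding maximal_submodule_def by auto
qed

lemma maximal_left_ideal_image:
  assumes h: "ring_hom_ring A B h" and surj: "carrier B = h ` carrier A" and N: "maximal_left_ideal A N"
    and ker: "\<And>a. a \<in> carrier A \<Longrightarrow> h a = \<zero>\<^bsub>B\<^esub> \<Longrightarrow> a \<in> N"
  shows "maximal_left_ideal B (h ` N)" and "{a \<in> carrier A. h a \<in> h ` N} = N"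
proof -
  interpret h: ring_hom_ring A B h by fact
  interpret rA: left_module A "regular_module A" by (rule h.R.regular_left_module)
  interpret rB: left_module B "regular_module B" by (rule h.S.regular_left_module)
  have sN: "submodule N A (regular_module A)" using N by (simp add: maximal_submodule_def)
  have NA: "v \<in> carrier A" if "v \<in> N" for v using rA.submodule_closed[OF sN that] by simp
  show pre: "{a \<in> carrier A. h a \<in> h ` N} = N"
  proof
    show "{a \<in> carrier A. h a \<in> h ` N} \<subseteq> N"
    proof
      fix a assume "a \<in> {a \<in> carrier A. h a \<in> h ` N}"
      then obtain v where v: "a \<in> carrier A" "v \<in> N" "h a = h v" by auto
      have "h (a \<ominus>\<^bsub>A\<^esub> v) = \<zero>\<^bsub>B\<^esub>" using v NA by (simp add: a_minus_def h.S.r_neg)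
      then have "a \<ominus>\<^bsub>A\<^esub> v \<in> N" using ker v(1) NA[OF v(2)] by simp
      then have "(a \<ominus>\<^bsub>A\<^esub> v) \<oplus>\<^bsub>A\<^esub> v \<in> N" using rA.submodule_add[OF sN _ v(2)] by simp
      then show "a \<in> N" using v(1) NA[OF v(2)] by (simp add: a_minus_def h.R.a_assoc h.R.l_neg)
    qed
  qed (use NA in auto)
  have "submodule (h ` N) B (regular_module B)" by (rule left_ideal_image[OF h surj sN])
  moreover have "h ` N \<noteq> carrier B"
    using pre N surj by (auto simp: maximal_submodule_def)
  moreover have "V = h ` N \<or> V = carrier B" if V: "submodule V B (regular_module B)" "h ` N \<subseteq> V" for V
  proof -
    let ?V = "{a \<in> carrier A. h a \<in> V}"
    have "submodule ?V A (regular_module A)"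
      by (rule rA.submoduleI)
        (use rB.submodule_zero[OF V(1)] rB.submodule_add[OF V(1)] rB.submodule_smult[OF V(1)] in auto)
    moreover have "N \<subseteq> ?V" using V(2) NA by auto
    ultimately have "?V = N \<or> ?V = carrier A" using N unfolding maximal_submodule_def by auto
    moreover have "V = h ` ?V" using rB.submodule_subset[OF V(1)] surj by auto
    ultimately show ?thesis using surj by metis
  qed
  ultimately show "maximal_left_ideal B (h ` N)" unfolding maximal_submodule_def by auto
qed

section \<open>One step of the heredity chain\<close>

lemma split_heredity_local_lift:
  fixes R :: "('r, 's) ring_scheme" and A :: "('r, 'a) module"
  assumes alg: "nc_algebra R A"
    and loc: "\<And>t r. t \<in> carrier R \<Longrightarrow> t \<notin> Units R \<Longrightarrow> r \<in> carrier R \<Longrightarrow> \<one>\<^bsub>R\<^esub> \<ominus>\<^bsub>R\<^esub> r \<otimes>\<^bsub>R\<^esub> t \<in> Units R"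
    and acc: "acc {U. submodule U R A}" and J: "split_heredity_ideal R A J"
    and lift: "\<And>N. maximal_left_ideal A N \<Longrightarrow> J \<subseteq> N \<Longrightarrow> local_lift A J N"
    and N: "maximal_left_ideal A N"
  shows "local_lift A {\<zero>\<^bsub>A\<^esub>} N"
proof -
  let ?M = "left_ideal_mod A J"
  interpret A: ring A using alg by (simp add: nc_algebra_def)
  interpret alg: nc_algebra R A by fact
  interpret reg: left_module A "regular_module A" by (rule A.regular_left_module)
  have JA: "ideal J A" and JJ: "J \<cdot>\<^bsub>A\<^esub> J = J"
    and proj: "projective_module A (?M)"
    and mor: "morita_equivalent R (op_algebra (end_algebra A (?M))) (regular_module R)"
    using J unfolding split_heredity_ideal_def left_ideal_module_def by auto
  interpret I: ideal J A by fact
  have sJ: "submodule J A (regular_module A)"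
    by (rule reg.submoduleI) (use I.Icarr I.I_l_closed in auto)
  interpret J: left_module A "?M" by (rule reg.submodule_left_module[OF sJ])
  have accA: "acc {U. submodule U A (regular_module A)}"
    by (rule acc_subset[OF acc]) (use left_ideal_base_submodule[OF alg] in blast)
  have accJ: "acc {U. submodule U A (?M)}"
    by (rule acc_subset[OF accA]) (use reg.submodule_submodule[OF sJ] in blast)
  \<comment> \<open>A heredity ideal is assumed projective only; finite generation comes from the
    chain condition on left ideals.\<close>
  obtain n u s where b: "dual_basis A (?M) n u s"
    by (rule projective_dual_basis[OF proj J.fin_gen_of_acc[OF accJ]])
  obtain m :: nat and c where c: "\<And>i j. i < m \<Longrightarrow> j < m \<Longrightarrow> c i j \<in> mod_hom A (?M) (?M)"
    and csum: "\<And>x. x \<in> carrier (?M) \<Longrightarrow> x = (\<Oplus>\<^bsub>?M\<^esub>i\<in>{..<m}. c i i x)"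
    and cmult: "\<And>a j k. a \<in> mod_hom A (?M) (?M) \<Longrightarrow> j < m \<Longrightarrow> k < m \<Longrightarrow>
      \<exists>r\<in>carrier R. \<forall>i<m. \<forall>l<m. \<forall>x\<in>carrier (?M).
        c i j (a (c k l x)) = base_smult A (?M) r (c i l x)"
    by (rule end_matrix_units[OF alg J.left_module_axioms mor]) (rule that)
  have cJ: "c i j x \<in> J" if "i < m" "j < m" "x \<in> J" for i j x
    using mod_homD(1)[OF c[OF that(1,2)], of x] that(3) by simp
  have csum': "x = (\<Oplus>\<^bsub>A\<^esub>i\<in>{..<m}. c i i x)" if x: "x \<in> J" for x
    using csum[of x] A.left_ideal_finsum[OF sJ, of "{..<m}" "\<lambda>i. c i i x"] cJ x by simp
  have cmult': "\<exists>r\<in>carrier R. \<forall>i<m. \<forall>l<m. \<forall>x\<in>J. c i j (a (c k l x)) = r \<odot>\<^bsub>A\<^esub> c i l x"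
    if ajk: "a \<in> mod_hom A (?M) (?M)" "j < m" "k < m" for a j k
  proof -
    from cmult[OF ajk] obtain r where r: "r \<in> carrier R" "\<And>i l x. i < m \<Longrightarrow> l < m \<Longrightarrow> x \<in> J \<Longrightarrow>
        c i j (a (c k l x)) = base_smult A (?M) r (c i l x)" by auto
    have "base_smult A (?M) r x = r \<odot>\<^bsub>A\<^esub> x" if "x \<in> J" for x
      using r(1) I.Icarr[OF that] by (simp add: base_smult_def alg.smult_mult_l)
    then show ?thesis using r(2) cJ by (intro bexI[OF _ r(1)]) simp
  qed
  \<comment> \<open>Maximal left ideals not containing \<open>J\<close> are settled by the matrix
    units alone. The case \<open>J \<subseteq> N\<close> relies on them to split covers off.\<close>
  have lift0: "local_lift A {\<zero>\<^bsub>A\<^esub>} N'" if N': "maximal_left_ideal A N'" "\<not> J \<subseteq> N'" for N'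
    by (rule local_lift_not_containing[where c = c and m = m, OF alg _ acc sJ b _ _ _ N'])
      (fact loc, fact c, fact csum', fact cmult')
  show ?thesis
  proof (cases "J \<subseteq> N")
    case True
    show ?thesis
      by (rule local_lift_containing[OF A.ring_axioms accA JA JJ b lift0 N True lift[OF N True]])
  qed (rule lift0[OF N])
qed

text \<open>A local lift in \<open>A / I\<close> modulo \<open>J / I\<close> is the same as one in
  \<open>A\<close> modulo \<open>J\<close>. Pulling everything back in this way lets the induction
  stay in \<open>A\<close>, whereas passing to successive quotients would change the element type at
  each step.\<close>

lemma local_lift_chain_step:
  fixes R :: "('r, 's) ring_scheme" and A :: "('r, 'a) module"
  assumes alg: "nc_algebra R A"
    and loc: "\<And>t r. t \<in> carrier R \<Longrightarrow> t \<notin> Units R \<Longrightarrow> r \<in> carrier R \<Longrightarrow> \<one>\<^bsub>R\<^esub> \<ominus>\<^bsub>R\<^esub> r \<otimes>\<^bsub>R\<^esub> t \<in> Units R"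
    and acc: "acc {U. submodule U R A}" and I: "ideal I A" and J: "ideal J A" "I \<subseteq> J"
    and hered: "split_heredity_ideal R (quot_algebra A I) (quot_ideal A I J)"
    and lift: "\<And>N. maximal_left_ideal A N \<Longrightarrow> J \<subseteq> N \<Longrightarrow> local_lift A J N"
    and N: "maximal_left_ideal A N" "I \<subseteq> N"
  shows "local_lift A I N"
proof -
  interpret A: ring A using alg by (simp add: nc_algebra_def)
  interpret alg: nc_algebra R A by fact
  interpret I: ideal I A by fact
  interpret J: ideal J A by fact
  let ?B = "quot_algebra A I" and ?h = "(+>\<^bsub>A\<^esub>) I"
  note h = quot_algebra_hom(1)[OF I] and surj = quot_algebra_hom(2)[OF I] and ker = quot_algebra_hom(3)[OF I]
  note algB = quot_algebra_nc_algebra(1)[OF alg I] and sm = quot_algebra_nc_algebra(2)[OF alg I]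
  interpret h: ring_hom_ring A ?B ?h by (rule h)
  interpret B: left_module R ?B by (rule nc_algebra_left_module[OF algB])
  have hom: "restrict ?h (carrier A) \<in> mod_hom R A ?B"
    by (rule mod_homI) (use sm h.hom_closed h.hom_add in \<open>auto simp del: quot_algebra_simps\<close>)
  have accB: "acc {U. submodule U R ?B}"
    by (rule acc_surj[OF nc_algebra_left_module[OF alg] B.left_module_axioms hom _ acc])
      (use surj in \<open>simp del: quot_algebra_simps\<close>)
  have preJ: "{a \<in> carrier A. I +>\<^bsub>A\<^esub> a \<in> quot_ideal A I J} = J"
  proof
    show "{a \<in> carrier A. I +>\<^bsub>A\<^esub> a \<in> quot_ideal A I J} \<subseteq> J"
    proof
      fix a assume "a \<in> {a \<in> carrier A. I +>\<^bsub>A\<^esub> a \<in> quot_ideal A I J}"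
      then obtain j where aj: "a \<in> carrier A" "j \<in> J" "I +>\<^bsub>A\<^esub> a = I +>\<^bsub>A\<^esub> j" by (auto simp: quot_ideal_def)
      have "a \<in> I +>\<^bsub>A\<^esub> j" using I.a_rcos_self[OF aj(1)] aj(3) by simp
      then obtain i where "i \<in> I" "a = i \<oplus>\<^bsub>A\<^esub> j" by (auto simp: a_r_coset_def')
      then show "a \<in> J" using J(2) aj(2) by auto
    qed
    show "J \<subseteq> {a \<in> carrier A. I +>\<^bsub>A\<^esub> a \<in> quot_ideal A I J}"
      using J.Icarr by (auto simp: quot_ideal_def)
  qed
  have liftB: "local_lift ?B (quot_ideal A I J) N'"
    if N': "maximal_left_ideal ?B N'" "quot_ideal A I J \<subseteq> N'" for N'
  proof -
    have "J \<subseteq> {a \<in> carrier A. ?h a \<in> N'}" using preJ N'(2) by blast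
    then have "local_lift A J {a \<in> carrier A. ?h a \<in> N'}"
      by (rule lift[OF maximal_left_ideal_vimage[OF h surj N'(1)]])
    then show ?thesis
      using local_lift_surj[OF h surj, of "quot_ideal A I J" N'] preJ by simp
  qed
  have kerN: "a \<in> N" if "a \<in> carrier A" "?h a = \<zero>\<^bsub>?B\<^esub>" for a using ker[OF that(1)] that(2) N(2) by blast
  note NB = maximal_left_ideal_image[OF h surj N(1) kerN]
  have "local_lift ?B {\<zero>\<^bsub>?B\<^esub>} (?h ` N)"
    by (rule split_heredity_local_lift[OF algB loc accB hered liftB NB(1)])
  then have "local_lift A {a \<in> carrier A. ?h a \<in> {\<zero>\<^bsub>?B\<^esub>}} {a \<in> carrier A. ?h a \<in> ?h ` N}"
    using local_lift_surj[OF h surj] by blast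
  moreover have "{a \<in> carrier A. ?h a \<in> {\<zero>\<^bsub>?B\<^esub>}} = I" using ker I.Icarr by blast
  ultimately show ?thesis using NB(2) by simp
qed

text \<open>Map a finite free module onto \<open>M\<close> and discard a maximal summand inside the
  kernel; what remains is the cover. It consists of functions on \<open>nat\<close>, which matches
  the type of covers in \<open>semi_perfect\<close>.\<close>

lemma projective_cover_of_local_lifts:
  fixes A :: "('a, 'b) ring_scheme" and M :: "('a, 'm) module"
  assumes A: "ring A" and acc: "acc {U. submodule U A (regular_module A)}"
    and lift: "\<And>N. maximal_left_ideal A N \<Longrightarrow> local_lift A {\<zero>\<^bsub>A\<^esub>} N"
    and M: "left_module A M" "fin_gen_module A M"
  shows "\<exists>(P :: ('a, nat \<Rightarrow> 'a) module) f. projective_cover A M P f"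
proof -
  interpret A: ring A by fact
  interpret M: left_module A M by fact
  obtain S where S: "S \<subseteq> carrier M" "finite S" "\<And>N. submodule N A M \<Longrightarrow> S \<subseteq> N \<Longrightarrow> N = carrier M"
    using M(2) unfolding fin_gen_module_def by metis
  obtain u :: "nat \<Rightarrow> _" and n where u: "S = u ` {..<n}"
    using finite_imp_nat_seg_image_inj_on[OF S(2)] by (auto simp: lessThan_def)
  have uM: "u i \<in> carrier M" if "i \<in> {..<n}" for i using S(1) u that by blast
  let ?F = "free_module A {..<n}"
  interpret F: left_module A ?F by (rule M.free_module_left_module)
  note FM = F.left_module_axioms
  note b = A.free_module_dual_basis[of n]
  note accF = F.acc_fin_gen[OF acc dual_basis_fin_gen[OF FM b]]
  obtain e where e: "e \<in> mod_hom A ?F M" "e ` carrier ?F = carrier M"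
    and "\<And>c. c \<in> carrier ?F \<Longrightarrow> e c = lin_comb A M u c"
    by (rule M.free_module_surjection[where I = "{..<n}" and u = u])
      (rule uM, assumption, rule S(3)[unfolded u], assumption+, rule that)
  note K = submodule_mod_ker[OF FM M(1) e(1)]
  show ?thesis
  proof (rule F.superfluous_kernel_summand[OF accF b K])
    show "local_lift A {\<zero>\<^bsub>A\<^esub>} {a \<in> carrier A. a \<odot>\<^bsub>?F\<^esub> x \<in> N}"
    if "maximal_submodule A ?F N" "\<not> mod_ker ?F M e \<subseteq> N" "x \<in> carrier ?F" "x \<notin> N" for N x
    by (rule lift[OF F.submodule_annihilator_mod[OF that(1,3,4)]])
  next
    fix g assume g: "g \<in> mod_hom A ?F ?F"
    and gg: "\<And>x. x \<in> carrier ?F \<Longrightarrow> g (g x) = g x"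
    and gK: "\<And>x. x \<in> carrier ?F \<Longrightarrow> x \<ominus>\<^bsub>?F\<^esub> g x \<in> mod_ker ?F M e"
    and sup: "\<And>U x. submodule U A ?F \<Longrightarrow>
      (\<And>x. x \<in> carrier ?F \<Longrightarrow> \<exists>v\<in>U. g v = v \<and> g x \<ominus>\<^bsub>?F\<^esub> v \<in> mod_ker ?F M e) \<Longrightarrow>
      x \<in> carrier ?F \<Longrightarrow> g x \<in> U"
    note gc = mod_homD(1)[OF g]
    let ?P = "?F\<lparr>carrier := g ` carrier ?F\<rparr>"
    note sP = summand_dual_basis(1)[OF FM b g gg] and bP = summand_dual_basis(2)[OF FM b g gg]
    interpret P: left_module A ?P by (rule F.submodule_left_module[OF sP])
    have PF: "x \<in> carrier ?F" if "x \<in> g ` carrier ?F" for x using F.submodule_closed[OF sP that] .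
    define f where "f = restrict e (g ` carrier ?F)"
    have f: "f \<in> mod_hom A ?P M"
      by (rule mod_homI)
        (use mod_homD[OF e(1)] PF F.submodule_add[OF sP] F.submodule_smult[OF sP] in \<open>auto simp: f_def\<close>)
    \<comment> \<open>The discarded part \<open>x - g x\<close> lies in the kernel of
      \<open>e\<close>, so the restriction of \<open>e\<close> to the image of \<open>g\<close> is
      still onto.\<close>
    have eg: "e (g x) = e x" if x: "x \<in> carrier ?F" for x
    proof -
      have "e x \<ominus>\<^bsub>M\<^esub> e (g x) = \<zero>\<^bsub>M\<^esub>"
        using gK[OF x] mod_hom_diff[OF FM M(1) e(1) x gc[OF x]] by (simp add: mod_ker_def)
      moreover have "(e x \<ominus>\<^bsub>M\<^esub> e (g x)) \<oplus>\<^bsub>M\<^esub> e (g x) = e x"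
        using mod_homD(1)[OF e(1) x] mod_homD(1)[OF e(1) gc[OF x]]
        by (simp add: a_minus_def M.M.a_assoc M.M.l_neg)
      ultimately show ?thesis using mod_homD(1)[OF e(1) gc[OF x]] by simp
    qed
    have "projective_cover A M ?P f"
      unfolding projective_cover_def superfluous_def
    proof (intro conjI allI impI f)
      show "projective_module A ?P" by (rule dual_basis_projective[OF P.left_module_axioms bP])
      show "f ` carrier ?P = carrier M"
      proof -
        have "f ` carrier ?P = (\<lambda>x. e (g x)) ` carrier ?F" by (auto simp: f_def image_image)
        also have "\<dots> = e ` carrier ?F" by (rule image_cong) (use eg in auto)
        finally show ?thesis using e(2) by simp
      qed
      show "submodule (mod_ker ?P M f) A ?P"
        by (rule submodule_mod_ker[OF P.left_module_axioms M(1) f])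
      fix N assume N: "submodule N A ?P \<and> N <+>\<^bsub>?P\<^esub> mod_ker ?P M f = carrier ?P"
      have sN: "submodule N A ?F" and NP: "N \<subseteq> g ` carrier ?F"
        using N F.submodule_submodule[OF sP] by auto
      \<comment> \<open>A decomposition \<open>g y = v + k\<close> with \<open>v\<close> in
        \<open>N\<close> and \<open>k\<close> in the kernel provides the congruence modulo the
        kernel that \<open>sup\<close> asks for.\<close>
      have "g x \<in> N" if x: "x \<in> carrier ?F" for x
      proof (rule sup[OF sN _ x])
        fix y assume y: "y \<in> carrier ?F"
        have "g y \<in> N <+>\<^bsub>?P\<^esub> mod_ker ?P M f" using N y by simp
        then obtain v k where vk: "v \<in> N" "k \<in> mod_ker ?P M f" "g y = v \<oplus>\<^bsub>?F\<^esub> k"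
          by (auto simp: set_add_def')
        have kP: "k \<in> g ` carrier ?F" and ek: "e k = \<zero>\<^bsub>M\<^esub>" using vk(2) by (auto simp: mod_ker_def f_def)
        have vF: "v \<in> carrier ?F" using vk(1) NP PF by blast
        have gv: "g v = v" using vk(1) NP gg by auto
        have "g y = k \<oplus>\<^bsub>?F\<^esub> v" using vk(3) F.M.a_comm[OF vF PF[OF kP]] by simp
        then have "g y \<ominus>\<^bsub>?F\<^esub> v = k" using vF PF[OF kP] by (simp add: a_minus_def F.M.a_assoc F.M.r_neg)
        then show "\<exists>v\<in>N. g v = v \<and> g y \<ominus>\<^bsub>?F\<^esub> v \<in> mod_ker ?F M e"
          using vk(1) gv ek PF[OF kP] by (intro bexI[of _ v]) (auto simp: mod_ker_def)
      qed
      then show "N = carrier ?P" using NP by auto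
    qed
    then show ?thesis by blast
  qed
qed

theorem theorem3p4p1:
  fixes R :: "('r, 's) ring_scheme" and A :: "('r, 'a) module"
  assumes "local_ring R" and "noetherian_ring R" and "split_quasi_hereditary R A"
  shows "semi_perfect TYPE('m) A"
proof -
  have R: "cring R" and alg: "nc_algebra R A" and fg: "fin_gen_module R A"
    using assms(3) unfolding split_quasi_hereditary_def by auto
  obtain t and J :: "nat \<Rightarrow> 'a set" where J1: "J 1 = carrier A" and Jt: "J (t + 1) = {\<zero>\<^bsub>A\<^esub>}"
    and id: "\<And>i. i \<in> {1..t + 1} \<Longrightarrow> ideal (J i) A"
    and step: "\<And>i. i \<in> {1..t} \<Longrightarrow> J (i + 1) \<subseteq> J i \<and>
      split_heredity_ideal R (quot_algebra A (J (i + 1))) (quot_ideal A (J (i + 1)) (J i))"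
    using assms(3) unfolding split_quasi_hereditary_def by blast
  interpret A: ring A using alg by (simp add: nc_algebra_def)
  interpret reg: left_module A "regular_module A" by (rule A.regular_left_module)
  note acc = left_module.acc_fin_gen[OF nc_algebra_left_module[OF alg] noetherian_acc[OF R assms(2)] fg]
  have accA: "acc {U. submodule U A (regular_module A)}"
    by (rule acc_subset[OF acc]) (use left_ideal_base_submodule[OF alg] in blast)
  \<comment> \<open>Only maximal left ideals containing \<open>J (i + 1)\<close> come from the
    quotient by it. At \<open>i = 0\<close> there are none, as \<open>J 1\<close> is all of
    \<open>A\<close>; at \<open>i = t\<close> the condition is void, as \<open>J (t + 1)\<close> is
    zero.\<close>
  have chain: "i \<le> t \<Longrightarrow> maximal_left_ideal A N \<Longrightarrow> J (i + 1) \<subseteq> N \<Longrightarrow> local_lift A (J (i + 1)) N" for i N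
  proof (induction i arbitrary: N)
    case 0
    then have "N = carrier A"
      using J1 reg.submodule_subset[of N] by (auto simp: maximal_submodule_def)
    then show ?case using 0 by (simp add: maximal_submodule_def)
  next
    case (Suc i)
    have s: "J (Suc i + 1) \<subseteq> J (i + 1)"
      "split_heredity_ideal R (quot_algebra A (J (Suc i + 1))) (quot_ideal A (J (Suc i + 1)) (J (i + 1)))"
      using step[of "i + 1"] Suc.prems(1) by auto
    show ?case
      by (rule local_lift_chain_step[OF alg local_ring_unit[OF assms(1,2)] acc id id s Suc.IH Suc.prems(2,3)])
        (use Suc.prems(1) in auto)
  qed
  have "local_lift A {\<zero>\<^bsub>A\<^esub>} N" if N: "maximal_left_ideal A N" for N
    using chain[of t N] N Jt reg.submodule_zero[of N] by (auto simp: maximal_submodule_def)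
  then show ?thesis
    unfolding semi_perfect_def
    using projective_cover_of_local_lifts[OF A.ring_axioms accA] A.ring_axioms by blast
qed

end
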